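(* Let $d\ge1$, $T>0$, $0<H<\frac{1}{2(d+3)}$. Let $(b_n)_{n\ge1}\subset C_c^\infty([0,T]\times\mathbb{R}^d;\mathbb{R}^d)$ be such that $b_n(t,x)\to b(t,x)$ as $n\to\infty$ for a.e. $(t,x)\in[0,T]\times\mathbb{R}^d$, $\sup_{n\ge1}\Vert b_n\Vert_{L^1_\infty}<\infty$, and $|b_n(t,x)|\le M<\infty$ a.e. for all $n\ge1$ and some constant $M$. Fix $0\le s<T$ and a compact cube $K\subset\mathbb{R}^d$. Let $X^{s,x,n}_\cdot$ and $X^{s,x}_\cdot$ be the unique strong solutions of $$X_t^{s,x,n}=x+\int_s^tb_n(u,X^{s,x,n}_u)\,du+B^H_t-B^H_s,\qquad X_t^{s,x}=x+\int_s^tb(u,X^{s,x}_u)\,du+B^H_t-B^H_s,\quad s\le t\le T.$$ Let $(n_k)_{k\ge1}$ be a subsequence (depending only on $K$, $s$ and $T$) along which $\big((t,x)\mapsto X^{s,x,n_k}_t\big)_k$ converges to a limit $Y$ in $\mathcal{C}([s,T]\times K;L^2(\Omega;\mathbb{R}^d))$ and $\big((t,x)\mapsto\frac{\partial}{\partial x}X^{s,x,n_k}_t\big)_k$ converges to a limit $Y'$ in $\mathcal{C}([s,T]\times K;L^2(\Omega;\mathbb{R}^{d\times d}))$, and let $Z$ and $Z'$ be continuous (in $(t,x)$) versions of $Y$ and $Y'$, respectively. Then $$Z(s,t,x)=X^{s,x}_t\quad\text{and}\quad Z'(s,t,x)=\frac{\partial}{\partial x}X^{s,x}_t$$ for a.e.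 $(t,x,\omega)$, where $\frac{\partial}{\partial x}X^{s,x}_t$ is a representative of the spatial Sobolev derivative of $X^{s,x}_t$ in $W^{1,2}(U)$ for an open and bounded set $U\subset K$ (the second identity being understood for $x\in U$).
   Context: $B^H$ is a $d$-dimensional fractional Brownian motion with Hurst parameter $H$ on a probability space $(\Omega,\mathcal{F},\mu)$: a continuous centered Gaussian process on $[0,T]$ with $E[B^{H,(i)}_tB^{H,(j)}_s]=\frac{\delta_{ij}}{2}(t^{2H}+s^{2H}-|t-s|^{2H})$. $\Vert b\Vert_{L^1_\infty}:=\int_{\mathbb{R}^d}\operatorname{ess\,sup}_{t\in[0,T]}|b(t,x)|\,dx$. $\frac{\partial}{\partial x}X^{s,x,n}_t$ is the classical (Fréchet) derivative of $x\mapsto X^{s,x,n}_t$. The solutions are unique strong solutions: they exist on any filtered probability space carrying $B^H$, and any two solutions coincide. A continuous version of $Y$ is a random field $Z$ with a.s. continuous sample paths in $(t,x)\in[s,T]\times K$ such that for every $(t,x)$, $Z(s,t,x)=Y(s,t,x)$ a.s. (similarly for $Y'$). *)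

theory Defs
  imports "HOL-Probability.Probability"
begin

section \<open>Smooth functions and test functions\<close>

primrec C_order :: "nat \<Rightarrow> ('a::euclidean_space \<Rightarrow> 'b::real_normed_vector) \<Rightarrow> bool" where
  "C_order 0 f \<longleftrightarrow> continuous_on UNIV f"
| "C_order (Suc k) f \<longleftrightarrow>
     (\<forall>x. f differentiable (at x)) \<and>
     (\<forall>e\<in>Basis. C_order k (\<lambda>x. frechet_derivative f (at x) e))"

definition C_infinity_c :: "('a::euclidean_space \<Rightarrow> 'b::real_normed_vector) \<Rightarrow> bool" where
  "C_infinity_c f \<longleftrightarrow> (\<forall>k. C_order k f) \<and> compact (closure {x. f x \<noteq> 0})"

text \<open>Smoothness up to the boundary of the strip \<open>[0,T] \<times> \<real>\<^sup>d\<close> means being the restriction of a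
  function that is smooth on the whole space; in particular a function in this class
  need not vanish at the times \<open>0\<close> and \<open>T\<close>.\<close>

definition C_infinity_c_strip ::
  "real \<Rightarrow> (real \<Rightarrow> 'a::euclidean_space \<Rightarrow> 'b::real_normed_vector) \<Rightarrow> bool" where
  "C_infinity_c_strip T f \<longleftrightarrow>
     (\<exists>g. C_infinity_c g \<and> (\<forall>t\<in>{0..T}. \<forall>x. f t x = g (t, x)))"

definition L1_infinity_norm ::
  "real \<Rightarrow> (real \<Rightarrow> 'a::euclidean_space \<Rightarrow> 'b::real_normed_vector) \<Rightarrow> ennreal" where
  "L1_infinity_norm T b =
     (\<integral>\<^sup>+x. esssup (lebesgue_on {0..T}) (\<lambda>t. ennreal (norm (b t x))) \<partial>lborel)"

section \<open>Square integrable functions and the space $C(S; L^2)$\<close>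

definition square_integrable :: "'w measure \<Rightarrow> ('w \<Rightarrow> 'b::euclidean_space) \<Rightarrow> bool" where
  "square_integrable N f \<longleftrightarrow> f \<in> borel_measurable N \<and> integrable N (\<lambda>w. (norm (f w))\<^sup>2)"

definition L2_dist :: "'w measure \<Rightarrow> ('w \<Rightarrow> 'b::euclidean_space) \<Rightarrow> ('w \<Rightarrow> 'b) \<Rightarrow> real" where
  "L2_dist N f g = sqrt (\<integral>w. (norm (f w - g w))\<^sup>2 \<partial>N)"

definition in_C_L2 ::
  "'w measure \<Rightarrow> 'p::topological_space set \<Rightarrow> ('p \<Rightarrow> 'w \<Rightarrow> 'b::euclidean_space) \<Rightarrow> bool" where
  "in_C_L2 N S F \<longleftrightarrow>
     (\<forall>p\<in>S. square_integrable N (F p)) \<and>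
     (\<forall>p\<in>S. ((\<lambda>q. L2_dist N (F q) (F p)) \<longlongrightarrow> 0) (at p within S))"

definition converges_in_C_L2 ::
  "'w measure \<Rightarrow> 'p::topological_space set \<Rightarrow> (nat \<Rightarrow> 'p \<Rightarrow> 'w \<Rightarrow> 'b::euclidean_space) \<Rightarrow>
     ('p \<Rightarrow> 'w \<Rightarrow> 'b) \<Rightarrow> bool" where
  "converges_in_C_L2 N S F G \<longleftrightarrow>
     (\<forall>k. in_C_L2 N S (F k)) \<and> in_C_L2 N S G \<and>
     uniform_limit S (\<lambda>k p. L2_dist N (F k p) (G p)) (\<lambda>p. 0) sequentially"

definition continuous_version ::
  "'w measure \<Rightarrow> 'p::topological_space set \<Rightarrow> ('p \<Rightarrow> 'w \<Rightarrow> 'b::euclidean_space) \<Rightarrow>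
     ('p \<Rightarrow> 'w \<Rightarrow> 'b) \<Rightarrow> bool" where
  "continuous_version N S Y Z \<longleftrightarrow>
     (\<forall>p\<in>S. Z p \<in> borel_measurable N) \<and>
     (AE w in N. continuous_on S (\<lambda>p. Z p w)) \<and>
     (\<forall>p\<in>S. AE w in N. Z p w = Y p w)"

section \<open>Fractional Brownian motion\<close>

text \<open>Constants count as (degenerate) Gaussian variables.\<close>

definition gaussian_rv :: "'w measure \<Rightarrow> ('w \<Rightarrow> real) \<Rightarrow> bool" where
  "gaussian_rv M \<xi> \<longleftrightarrow>
     \<xi> \<in> borel_measurable M \<and>
     (\<exists>m \<sigma>. (\<sigma> = 0 \<and> (AE \<omega> in M. \<xi> \<omega> = m)) \<or>
            (\<sigma> > 0 \<and> distributed M lborel \<xi> (normal_density m \<sigma>)))"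

definition gaussian_process ::
  "'w measure \<Rightarrow> real set \<Rightarrow> (real \<Rightarrow> 'w \<Rightarrow> 'b::euclidean_space) \<Rightarrow> bool" where
  "gaussian_process M I B \<longleftrightarrow>
     (\<forall>t\<in>I. B t \<in> borel_measurable M) \<and>
     (\<forall>J c. finite J \<and> J \<subseteq> I \<longrightarrow> gaussian_rv M (\<lambda>\<omega>. \<Sum>t\<in>J. c t \<bullet> B t \<omega>))"

definition fractional_brownian_motion ::
  "'w measure \<Rightarrow> real \<Rightarrow> real \<Rightarrow> (real \<Rightarrow> 'w \<Rightarrow> real ^ 'd) \<Rightarrow> bool" where
  "fractional_brownian_motion M H T B \<longleftrightarrow>
     prob_space M \<and>
     gaussian_process M {0..T} B \<and>
     (\<forall>t\<in>{0..T}. \<forall>i. (\<integral>\<omega>. B t \<omega> $ i \<partial>M) = 0) \<and>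
     (\<forall>t\<in>{0..T}. \<forall>r\<in>{0..T}. \<forall>i j.
        (\<integral>\<omega>. B t \<omega> $ i * B r \<omega> $ j \<partial>M) =
        (if i = j then (t powr (2 * H) + r powr (2 * H) - \<bar>t - r\<bar> powr (2 * H)) / 2 else 0)) \<and>
     (AE \<omega> in M. continuous_on {0..T} (\<lambda>t. B t \<omega>))"

section \<open>Strong solutions\<close>

text \<open>The natural filtration of the driving process, augmented by the null events.\<close>

definition augmented_filtration ::
  "'w measure \<Rightarrow> (real \<Rightarrow> 'w \<Rightarrow> 'b::topological_space) \<Rightarrow> real \<Rightarrow> 'w measure" where
  "augmented_filtration M B t =
     sigma (space M) ({B u -` A \<inter> space M | u A. 0 \<le> u \<and> u \<le> t \<and> A \<in> sets borel} \<union> null_sets M)"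

text \<open>The drift is only determined up to null sets of \<open>[0,T] \<times> \<real>\<^sup>d\<close>, hence the Lebesgue integral
  is taken with respect to the complete measure \<open>lebesgue\<close>. Integrability is demanded explicitly,
  because the integral of a non-integrable function is \<open>0\<close> by convention.\<close>

definition strong_solution ::
  "'w measure \<Rightarrow> real \<Rightarrow> (real \<Rightarrow> 'w \<Rightarrow> 'b::euclidean_space) \<Rightarrow> (real \<Rightarrow> 'b \<Rightarrow> 'b) \<Rightarrow>
     real \<Rightarrow> 'b \<Rightarrow> (real \<Rightarrow> 'w \<Rightarrow> 'b) \<Rightarrow> bool" where
  "strong_solution M T B b s x X \<longleftrightarrow>
     (\<forall>t\<in>{s..T}. X t \<in> borel_measurable (augmented_filtration M B t)) \<and>
     (AE \<omega> in M. continuous_on {s..T} (\<lambda>t. X t \<omega>)) \<and>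
     (AE \<omega> in M. \<forall>t\<in>{s..T}.
        integrable (lebesgue_on {s..t}) (\<lambda>u. b u (X u \<omega>)) \<and>
        X t \<omega> = x + (\<integral>u. b u (X u \<omega>) \<partial>lebesgue_on {s..t}) + B t \<omega> - B s \<omega>)"

text \<open>Uniqueness only compares with other solutions adapted to the augmented filtration of the
  driving process, i.e. it is the weakest form of pathwise uniqueness.\<close>

definition unique_strong_solution ::
  "'w measure \<Rightarrow> real \<Rightarrow> (real \<Rightarrow> 'w \<Rightarrow> 'b::euclidean_space) \<Rightarrow> (real \<Rightarrow> 'b \<Rightarrow> 'b) \<Rightarrow>
     real \<Rightarrow> 'b \<Rightarrow> (real \<Rightarrow> 'w \<Rightarrow> 'b) \<Rightarrow> bool" where
  "unique_strong_solution M T B b s x X \<longleftrightarrow>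
     strong_solution M T B b s x X \<and>
     (\<forall>X'. strong_solution M T B b s x X' \<longrightarrow> (AE \<omega> in M. \<forall>t\<in>{s..T}. X' t \<omega> = X t \<omega>))"

section \<open>Random fields and spatial Sobolev derivatives\<close>

definition field_measure ::
  "real \<Rightarrow> real \<Rightarrow> 'b::euclidean_space set \<Rightarrow> 'w measure \<Rightarrow> (real \<times> 'b \<times> 'w) measure" where
  "field_measure s T U M =
     restrict_space lborel {s..T} \<Otimes>\<^sub>M (restrict_space lborel U \<Otimes>\<^sub>M M)"

text \<open>\<open>f\<close> belongs to $W^{1,2}(U)$ and \<open>G\<close> is its weak Jacobian matrix,
  with \<open>G x $ i $ j\<close> the weak partial derivative of the component \<open>i\<close> in direction \<open>j\<close>,
  in accordance with \<open>jacobian\<close>.\<close>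

definition W12_with_derivative ::
  "(real ^ 'd) set \<Rightarrow> (real ^ 'd \<Rightarrow> real ^ 'd) \<Rightarrow> (real ^ 'd \<Rightarrow> real ^ 'd ^ 'd) \<Rightarrow> bool" where
  "W12_with_derivative U f G \<longleftrightarrow>
     square_integrable (lebesgue_on U) f \<and>
     square_integrable (lebesgue_on U) G \<and>
     (\<forall>\<phi> :: real ^ 'd \<Rightarrow> real. C_infinity_c \<phi> \<and> closure {x. \<phi> x \<noteq> 0} \<subseteq> U \<longrightarrow>
        (\<forall>i j. (\<integral>x. f x $ i * frechet_derivative \<phi> (at x) (axis j 1) \<partial>lebesgue_on U) =
               - (\<integral>x. G x $ i $ j * \<phi> x \<partial>lebesgue_on U)))"

definition sobolev_derivative_field ::
  "'w measure \<Rightarrow> real \<Rightarrow> real \<Rightarrow> (real ^ 'd) set \<Rightarrow> (real \<Rightarrow> real ^ 'd \<Rightarrow> 'w \<Rightarrow> real ^ 'd) \<Rightarrow>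
     (real \<Rightarrow> real ^ 'd \<Rightarrow> 'w \<Rightarrow> real ^ 'd ^ 'd) \<Rightarrow> bool" where
  "sobolev_derivative_field M s T U X DX \<longleftrightarrow>
     (\<lambda>(t, x, \<omega>). DX t x \<omega>) \<in> borel_measurable (field_measure s T U M) \<and>
     (\<forall>t\<in>{s..T}. AE \<omega> in M. W12_with_derivative U (\<lambda>x. X t x \<omega>) (\<lambda>x. DX t x \<omega>))"

end

theory Submission
  imports Defs
begin

text \<open>
  Both identities come from \<open>L1\<close> limits at fixed points, and the difficulty is that the drift \<open>b\<close> is
  merely measurable and is approximated only almost everywhere.

  \<^emph>\<open>The limit solves the equation.\<close> For fixed \<open>x\<close> the solutions \<open>X k t\<close> of the approximating equations
  converge in mean to \<open>Z t\<close>. The drift terms converge as soon as the laws of \<open>X k t\<close> and \<open>Z t\<close>, for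
  \<open>t > s\<close>, are bounded by one multiple of Lebesgue measure: then exceptional Lebesgue null sets of the
  drift are not seen, and \<open>b k (u, X k u)\<close> may be compared with \<open>b (u, Z u)\<close> through a single continuous
  \<open>b j\<close> (\<open>drift_convergence_fixed_time\<close>). So \<open>Z\<close> is an adapted solution of the limiting equation
  (\<open>limit_solves_sde\<close>), and uniqueness identifies it with \<open>X\<close>.

  The bound on the laws comes from a Fourier argument. For \<open>u < t\<close> the drift contributes at most
  \<open>C (t - u)\<close> to \<open>X t - X u\<close>, and given the past up to \<open>u\<close> the variable \<open>\<xi> \<bullet> B t\<close> is Gaussian with
  variance at least \<open>|\<xi>|\<^sup>2 (t - u) powr (2 H) / 2\<close>. Hence the characteristic function of \<open>X t\<close> is at
  most \<open>exp (- |\<xi>|\<^sup>2 (t - u) powr (2 H) / 4) + |\<xi>| C (t - u)\<close>. With \<open>t - u\<close> equal to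
  \<open>|\<xi>| powr (- (2 d + 2))\<close> both terms decay at least like \<open>|\<xi>| powr (- 2 d)\<close>, because
  \<open>H < 1 / (2 (d + 3))\<close> leaves a positive power of \<open>|\<xi>|\<close> in the exponent; this is integrable and gives a
  bounded density. The lower bound on the conditional variance is local nondeterminism. For
  \<open>H \<le> 1 / 2\<close> it is elementary: disjoint increments are negatively correlated, so their covariance matrix
  is diagonally dominant (\<open>fbm_cov_nondeterminism\<close>).

  \<^emph>\<open>The limit of the derivatives.\<close> Along a segment in \<open>K\<close> the increment of \<open>X k t\<close> is the integral of its
  Jacobian. This identity passes to the limit in \<open>L1\<close> and, by continuity of \<open>Z\<close> and \<open>Z'\<close>, holds
  almost surely for all segments at once (\<open>limit_line_integral_all\<close>). Therefore \<open>Z t\<close> is almost surely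
  continuously differentiable inside \<open>K\<close> with Jacobian \<open>Z' t\<close>, integration by parts makes \<open>Z' t\<close> a weak
  derivative of \<open>X t\<close>, and weak derivatives are unique up to null sets.
\<close>

section \<open>Covariance of fractional Brownian motion\<close>

lemma powr_le_tangent:
  fixes x z \<alpha> :: real
  assumes "0 \<le> x" "0 < z" "0 \<le> \<alpha>" "\<alpha> \<le> 1"
  shows "x powr \<alpha> \<le> z powr \<alpha> + \<alpha> * z powr (\<alpha> - 1) * (x - z)"
proof -
  have "x powr \<alpha> * z powr (1 - \<alpha>) \<le> \<alpha> * x + (1 - \<alpha>) * z"
    using Youngs_inequality_0[of \<alpha> "1 - \<alpha>" x z] assms by (cases "x = 0") auto
  then have "x powr \<alpha> * z powr (1 - \<alpha>) * z powr (\<alpha> - 1) \<le> (\<alpha> * x + (1 - \<alpha>) * z) * z powr (\<alpha> - 1)"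
    by (intro mult_right_mono) auto
  moreover have "z powr (1 - \<alpha>) * z powr (\<alpha> - 1) = 1"
    using assms by (simp flip: powr_add)
  moreover have "z * z powr (\<alpha> - 1) = z powr \<alpha>"
    using assms by (simp add: powr_mult_base)
  ultimately show ?thesis
    by (simp add: algebra_simps)
qed

text \<open>The outer points \<open>A\<close> and \<open>B + \<delta>\<close> have \<open>A + \<delta>\<close> and \<open>B\<close> as convex combinations, with weights
  \<open>l\<close> and \<open>1 - l\<close> exchanged; adding the two concavity inequalities gives the claim.\<close>

lemma powr_increment_antimono:
  fixes A B \<delta> \<alpha> :: real
  assumes "0 \<le> A" "A \<le> B" "0 \<le> \<delta>" "0 \<le> \<alpha>" "\<alpha> \<le> 1"
  shows "A powr \<alpha> + (B + \<delta>) powr \<alpha> \<le> (A + \<delta>) powr \<alpha> + B powr \<alpha>"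
proof (cases "B + \<delta> - A = 0 \<or> A + \<delta> = 0 \<or> B = 0")
  case True
  then consider "B + \<delta> = A" | "A = 0" "\<delta> = 0" | "B = 0" using assms by force
  then show ?thesis using assms by cases auto
next
  case False
  define l where "l = \<delta> / (B + \<delta> - A)"
  have pos: "B + \<delta> - A > 0" "A + \<delta> > 0" "B > 0" using False assms by auto
  have l: "0 \<le> l" "l \<le> 1" using pos assms by (auto simp: l_def field_simps)
  have e: "l * (B + \<delta> - A) = \<delta>" using pos by (simp add: l_def)
  have concave: "l' * u powr \<alpha> + (1 - l') * v powr \<alpha> \<le> z powr \<alpha>"
    if "0 \<le> l'" "l' \<le> 1" "0 \<le> u" "0 \<le> v" "0 < z" "z = l' * u + (1 - l') * v" for l' u v z
  proof -
    have "l' * u powr \<alpha> \<le> l' * (z powr \<alpha> + \<alpha> * z powr (\<alpha> - 1) * (u - z))"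
      using powr_le_tangent[of u z \<alpha>] that assms by (intro mult_left_mono) auto
    moreover have "(1 - l') * v powr \<alpha> \<le> (1 - l') * (z powr \<alpha> + \<alpha> * z powr (\<alpha> - 1) * (v - z))"
      using powr_le_tangent[of v z \<alpha>] that assms by (intro mult_left_mono) auto
    moreover have "l' * (z powr \<alpha> + \<alpha> * z powr (\<alpha> - 1) * (u - z))
        + (1 - l') * (z powr \<alpha> + \<alpha> * z powr (\<alpha> - 1) * (v - z))
        = z powr \<alpha> + \<alpha> * z powr (\<alpha> - 1) * (l' * u + (1 - l') * v - z)"
      by algebra
    ultimately show ?thesis using that by simp
  qed
  have "l * (B + \<delta>) powr \<alpha> + (1 - l) * A powr \<alpha> \<le> (A + \<delta>) powr \<alpha>"
    using e assms l pos by (intro concave) (auto simp: algebra_simps)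
  moreover have "(1 - l) * (B + \<delta>) powr \<alpha> + (1 - (1 - l)) * A powr \<alpha> \<le> B powr \<alpha>"
    using e assms l pos by (intro concave) (auto simp: algebra_simps)
  ultimately show ?thesis by (simp add: algebra_simps)
qed

text \<open>Abel summation turns a combination of the values of a function that starts at \<open>0\<close> into a combination
  of its increments.\<close>

lemma sum_by_increments:
  fixes a f :: "nat \<Rightarrow> real"
  assumes "f 0 = 0"
  shows "(\<Sum>i\<le>n. a i * f i) = (\<Sum>j<n. (\<Sum>i\<in>{j<..n}. a i) * (f (Suc j) - f j))"
proof -
  have "(\<Sum>i\<le>n. a i * f i) = (\<Sum>i\<le>n. \<Sum>j<n. if j < i then a i * (f (Suc j) - f j) else 0)"
  proof (intro sum.cong refl)
    fix i assume i: "i \<in> {..n}"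
    have "a i * f i = a i * (\<Sum>j<i. f (Suc j) - f j)"
      using assms by (simp add: sum_lessThan_telescope)
    also have "\<dots> = (\<Sum>j<i. a i * (f (Suc j) - f j))"
      by (simp add: sum_distrib_left)
    also have "\<dots> = (\<Sum>j<n. if j < i then a i * (f (Suc j) - f j) else 0)"
      using i by (intro sum.mono_neutral_cong_left) auto
    finally show "a i * f i = \<dots>" .
  qed
  also have "\<dots> = (\<Sum>j<n. \<Sum>i\<le>n. if j < i then a i * (f (Suc j) - f j) else 0)"
    by (rule sum.swap)
  also have "\<dots> = (\<Sum>j<n. \<Sum>i\<in>{j<..n}. a i * (f (Suc j) - f j))"
    by (intro sum.cong refl sum.mono_neutral_cong_right) auto
  finally show ?thesis by (simp add: sum_distrib_right)
qed

text \<open>Off the diagonal the inequality \<open>2 c i c j \<le> (c i)\<^sup>2 + (c j)\<^sup>2\<close> is multiplied by a nonpositive entry, so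
  the form dominates its diagonal part weighted by the row sums. All row sums being nonnegative, one
  term can be singled out.\<close>

lemma diagonally_dominant_form:
  fixes D :: "nat \<Rightarrow> nat \<Rightarrow> real"
  assumes sym: "\<And>i j. i < n \<Longrightarrow> j < n \<Longrightarrow> D i j = D j i"
    and off: "\<And>i j. i < n \<Longrightarrow> j < n \<Longrightarrow> i \<noteq> j \<Longrightarrow> D i j \<le> 0"
    and row: "\<And>i. i < n \<Longrightarrow> 0 \<le> (\<Sum>j<n. D i j)"
    and m: "m < n"
  shows "(c m)\<^sup>2 * (\<Sum>j<n. D m j) \<le> (\<Sum>i<n. \<Sum>j<n. c i * c j * D i j)"
proof -
  have "(c m)\<^sup>2 * (\<Sum>j<n. D m j) \<le> (\<Sum>i<n. (c i)\<^sup>2 * (\<Sum>j<n. D i j))"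
    using m row by (intro member_le_sum) auto
  also have "\<dots> = (\<Sum>i<n. \<Sum>j<n. (c i)\<^sup>2 * D i j)"
    by (simp add: sum_distrib_left)
  also have "\<dots> = (\<Sum>i<n. \<Sum>j<n. ((c i)\<^sup>2 + (c j)\<^sup>2) / 2 * D i j)"
  proof -
    have "(\<Sum>i<n. \<Sum>j<n. (c i)\<^sup>2 * D i j) = (\<Sum>i<n. \<Sum>j<n. (c j)\<^sup>2 * D i j)"
      by (subst sum.swap) (auto intro!: sum.cong simp: sym)
    moreover have "(\<Sum>i<n. \<Sum>j<n. ((c i)\<^sup>2 + (c j)\<^sup>2) / 2 * D i j)
       = ((\<Sum>i<n. \<Sum>j<n. (c i)\<^sup>2 * D i j) + (\<Sum>i<n. \<Sum>j<n. (c j)\<^sup>2 * D i j)) / 2"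
      by (simp add: sum.distrib[symmetric] sum_divide_distrib algebra_simps add_divide_distrib)
    ultimately show ?thesis by simp
  qed
  also have "\<dots> \<le> (\<Sum>i<n. \<Sum>j<n. c i * c j * D i j)"
  proof (intro sum_mono)
    fix i j assume ij: "i \<in> {..<n}" "j \<in> {..<n}"
    show "((c i)\<^sup>2 + (c j)\<^sup>2) / 2 * D i j \<le> c i * c j * D i j"
    proof (cases "i = j")
      case True then show ?thesis by (simp add: power2_eq_square)
    next
      case False
      have "c i * c j \<le> ((c i)\<^sup>2 + (c j)\<^sup>2) / 2"
        using sum_squares_bound[of "c i" "c j"] by simp
      then show ?thesis using off[of i j] ij False by (intro mult_right_mono_neg) auto
    qed
  qed
  finally show ?thesis .
qed

definition fbm_cov :: "real \<Rightarrow> real \<Rightarrow> real \<Rightarrow> real" where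
  "fbm_cov H t r = (t powr (2 * H) + r powr (2 * H) - \<bar>t - r\<bar> powr (2 * H)) / 2"

lemma fbm_cov_sym: "fbm_cov H t r = fbm_cov H r t"
  by (simp add: fbm_cov_def abs_minus_commute algebra_simps)

lemma fbm_cov_0: "0 \<le> t \<Longrightarrow> fbm_cov H t 0 = 0"
  by (simp add: fbm_cov_def)

text \<open>The condition \<open>H \<le> 1 / 2\<close> enters here: it makes \<open>x \<mapsto> x powr (2 H)\<close> concave.\<close>

lemma fbm_increments_negatively_correlated:
  assumes "0 < H" "H \<le> 1 / 2" "0 \<le> x" "x \<le> y" "y \<le> z" "z \<le> w"
  shows "fbm_cov H y w - fbm_cov H y z - fbm_cov H x w + fbm_cov H x z \<le> 0"
proof -
  have "(z - y) powr (2 * H) + (z - x + (w - z)) powr (2 * H)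
     \<le> (z - y + (w - z)) powr (2 * H) + (z - x) powr (2 * H)"
    using assms by (intro powr_increment_antimono) auto
  then show ?thesis
    using assms by (simp add: fbm_cov_def field_simps abs_minus_commute)
qed

text \<open>The form is rewritten in the increments, whose covariance matrix \<open>D\<close> has nonpositive entries off the
  diagonal. Its row sums are covariances of an increment with the final value, which are nonnegative;
  for the last increment this is at least half its variance, and the coefficient of the last
  increment is the coefficient of the last value.\<close>

lemma fbm_cov_nondeterminism_sequence:
  fixes p :: "nat \<Rightarrow> real" and a :: "nat \<Rightarrow> real"
  assumes H: "0 < H" "H \<le> 1 / 2"
    and p: "p 0 = 0" "\<And>i j. i \<le> j \<Longrightarrow> j \<le> Suc n \<Longrightarrow> p i \<le> p j"
  shows "(a (Suc n))\<^sup>2 * (p (Suc n) - p n) powr (2 * H) / 2 \<le> (\<Sum>i\<le>Suc n. \<Sum>j\<le>Suc n. a i * a j * fbm_cov H (p i) (p j))"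
proof -
  let ?R = "fbm_cov H" and ?N = "Suc n"
  define c where "c j = (\<Sum>i\<in>{j<..?N}. a i)" for j
  define D where "D i j = ?R (p (Suc i)) (p (Suc j)) - ?R (p (Suc i)) (p j) - ?R (p i) (p (Suc j)) + ?R (p i) (p j)" for i j
  have p0: "0 \<le> p i" if "i \<le> ?N" for i using p(2)[of 0 i] that p(1) by auto
  have R0: "?R 0 (p i) = 0" "?R (p i) 0 = 0" if "i \<le> ?N" for i
    using p0[OF that] fbm_cov_0 fbm_cov_sym by metis+
  have "(\<Sum>i\<le>?N. \<Sum>j\<le>?N. a i * a j * ?R (p i) (p j)) = (\<Sum>i\<le>?N. a i * (\<Sum>j\<le>?N. a j * ?R (p i) (p j)))"
    by (simp only: sum_distrib_left mult.assoc)
  also have "\<dots> = (\<Sum>i<?N. c i * ((\<Sum>j\<le>?N. a j * ?R (p (Suc i)) (p j)) - (\<Sum>j\<le>?N. a j * ?R (p i) (p j))))"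
    unfolding c_def by (rule sum_by_increments) (use R0 p in auto)
  also have "\<dots> = (\<Sum>i<?N. c i * (\<Sum>j\<le>?N. a j * (?R (p (Suc i)) (p j) - ?R (p i) (p j))))"
    by (simp only: sum_subtractf[symmetric] right_diff_distrib)
  also have "\<dots> = (\<Sum>i<?N. c i * (\<Sum>j<?N. c j * D i j))"
  proof (rule sum.cong[OF refl])
    fix i assume "i \<in> {..<?N}"
    then have i: "i < ?N" by simp
    have "(\<Sum>j\<le>?N. a j * (?R (p (Suc i)) (p j) - ?R (p i) (p j))) =
      (\<Sum>j<?N. c j * (?R (p (Suc i)) (p (Suc j)) - ?R (p i) (p (Suc j)) - (?R (p (Suc i)) (p j) - ?R (p i) (p j))))"
      unfolding c_def using p(1) by (intro sum_by_increments) (use i R0[of i] R0[of "Suc i"] in auto)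
    also have "\<dots> = (\<Sum>j<?N. c j * D i j)"
      by (intro sum.cong refl) (simp add: D_def)
    finally show "c i * (\<Sum>j\<le>?N. a j * (?R (p (Suc i)) (p j) - ?R (p i) (p j))) = c i * (\<Sum>j<?N. c j * D i j)"
      by simp
  qed
  also have "\<dots> = (\<Sum>i<?N. \<Sum>j<?N. c i * c j * D i j)"
    by (simp only: sum_distrib_left mult.assoc)
  finally have eq: "(\<Sum>i\<le>?N. \<Sum>j\<le>?N. a i * a j * ?R (p i) (p j)) = (\<Sum>i<?N. \<Sum>j<?N. c i * c j * D i j)" .
  have row: "(\<Sum>j<?N. D i j) = ?R (p (Suc i)) (p ?N) - ?R (p i) (p ?N)" if "i < ?N" for i
  proof -
    have "(\<Sum>j<?N. D i j) = (\<Sum>j<?N. (?R (p (Suc i)) (p (Suc j)) - ?R (p i) (p (Suc j))) - (?R (p (Suc i)) (p j) - ?R (p i) (p j)))"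
      by (simp add: D_def algebra_simps)
    also have "\<dots> = (?R (p (Suc i)) (p ?N) - ?R (p i) (p ?N)) - (?R (p (Suc i)) (p 0) - ?R (p i) (p 0))"
      by (rule sum_lessThan_telescope)
    finally show ?thesis using R0[of i] R0[of "Suc i"] p(1) that by simp
  qed
  have row0: "0 \<le> (\<Sum>j<?N. D i j)" if "i < ?N" for i
  proof -
    have le: "0 \<le> p i" "p i \<le> p (Suc i)" "p (Suc i) \<le> p ?N" using p0 p(2) that by auto
    have "p i powr (2*H) \<le> p (Suc i) powr (2*H)" "(p ?N - p (Suc i)) powr (2*H) \<le> (p ?N - p i) powr (2*H)"
      using le H by (auto intro!: powr_mono2)
    then show ?thesis using le unfolding row[OF that] by (simp add: fbm_cov_def)
  qed
  have off: "D i j \<le> 0" if "i < j" "j < ?N" for i j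
    using fbm_increments_negatively_correlated[of H "p i" "p (Suc i)" "p j" "p (Suc j)"] H p0 p(2) that
    by (simp add: D_def)
  have sym: "D i j = D j i" for i j
    unfolding D_def by (simp add: fbm_cov_sym)
  have "(c n)\<^sup>2 * (\<Sum>j<?N. D n j) \<le> (\<Sum>i<?N. \<Sum>j<?N. c i * c j * D i j)"
    using off row0 sym by (intro diagonally_dominant_form) (auto, metis linorder_neqE_nat sym less_SucI less_Suc_eq)
  moreover have "c n = a ?N"
  proof -
    have "{n<..?N} = {?N}" by auto
    then show ?thesis by (simp add: c_def)
  qed
  moreover have row_n: "(p ?N - p n) powr (2*H) / 2 \<le> (\<Sum>j<?N. D n j)"
  proof -
    have le: "0 \<le> p n" "p n \<le> p ?N" using p0 p(2) by auto
    then have "p n powr (2*H) \<le> p ?N powr (2*H)" using H by (auto intro!: powr_mono2)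
    then show ?thesis using le row[of n] by (simp add: fbm_cov_def field_simps)
  qed
  moreover from row_n have "(a ?N)\<^sup>2 * ((p ?N - p n) powr (2*H) / 2) \<le> (a ?N)\<^sup>2 * (\<Sum>j<?N. D n j)"
    by (rule mult_left_mono) simp
  ultimately show ?thesis using eq by simp
qed

text \<open>The lower bound does not depend on the number of points in the past, which is what permits
  conditioning on the whole past. The points are sorted and the time \<open>0\<close> is added, with coefficient
  \<open>0\<close> where it is new.\<close>

lemma fbm_cov_nondeterminism:
  fixes \<alpha> :: "real \<Rightarrow> real"
  assumes H: "0 < H" "H \<le> 1 / 2" and J: "finite J" "J \<subseteq> {0..u}" and u: "0 \<le> u" "u < t"
  shows "(\<alpha> t)\<^sup>2 * (t - u) powr (2 * H) / 2 \<le> (\<Sum>q\<in>insert t J. \<Sum>r\<in>insert t J. \<alpha> q * \<alpha> r * fbm_cov H q r)"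
proof -
  define I where "I = insert 0 J"
  define xs where "xs = sorted_list_of_set I"
  define n where "n = length xs"
  define p where "p i = (xs @ [t]) ! i" for i
  define \<beta> where "\<beta> q = (if q \<in> insert t J then \<alpha> q else 0)" for q
  have finI: "finite I" using J by (simp add: I_def)
  have set: "set xs = I" "sorted xs" "distinct xs" using finI by (auto simp: xs_def)
  have I: "I \<subseteq> {0..u}" using J u by (auto simp: I_def)
  have tI: "t \<notin> I" using I u by auto
  have srt: "sorted (xs @ [t])" "distinct (xs @ [t])"
    using set I u tI by (force simp: sorted_append)+
  have ne: "xs \<noteq> []" using set(1) by (auto simp: I_def)
  obtain m where m: "n = Suc m" using ne by (cases n) (auto simp: n_def)
  have mono: "p i \<le> p j" if "i \<le> j" "j \<le> Suc m" for i j
    unfolding p_def using that srt(1) m by (intro sorted_nth_mono) (auto simp: n_def)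
  have "0 \<in> set (xs @ [t])" using set by (auto simp: I_def)
  then obtain i0 where i0: "i0 \<le> Suc m" "p i0 = 0"
    unfolding in_set_conv_nth p_def using m by (auto simp: n_def less_Suc_eq_le)
  have "p 0 \<in> set (xs @ [t])" unfolding p_def by (rule nth_mem) simp
  then have "0 \<le> p 0" using set I u by auto
  with mono[of 0 i0] i0 have p0: "p 0 = 0" by auto
  have pt: "p (Suc m) = t" unfolding p_def using m by (simp add: n_def nth_append)
  have "p m \<in> I" unfolding p_def set(1)[symmetric] using m by (simp add: n_def nth_append)
  then have pm: "p m \<le> u" using I by auto
  have bij: "bij_betw p {..Suc m} (insert t I)"
  proof -
    have "bij_betw ((!) (xs @ [t])) {..<length (xs @ [t])} (set (xs @ [t]))"
      using srt(2) by (intro bij_betw_nth) auto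
    moreover have "{..<length (xs @ [t])} = {..Suc m}" using m by (auto simp: n_def)
    ultimately show ?thesis using set by (simp add: p_def[abs_def])
  qed
  have "(t - u) powr (2 * H) \<le> (p (Suc m) - p m) powr (2 * H)"
    using pm pt u H by (auto intro!: powr_mono2)
  then have "(\<alpha> t)\<^sup>2 * (t - u) powr (2 * H) / 2 \<le> (\<beta> (p (Suc m)))\<^sup>2 * (p (Suc m) - p m) powr (2 * H) / 2"
    using pt by (auto intro!: divide_right_mono mult_left_mono simp: \<beta>_def)
  also have "\<dots> \<le> (\<Sum>i\<le>Suc m. \<Sum>j\<le>Suc m. \<beta> (p i) * \<beta> (p j) * fbm_cov H (p i) (p j))"
    using mono p0 by (intro fbm_cov_nondeterminism_sequence H) auto
  also have "\<dots> = (\<Sum>q\<in>insert t I. \<Sum>r\<in>insert t I. \<beta> q * \<beta> r * fbm_cov H q r)"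
    by (simp add: sum.reindex_bij_betw[OF bij, of "\<lambda>q. (\<Sum>r\<in>insert t I. \<beta> q * \<beta> r * fbm_cov H q r)", symmetric]
        sum.reindex_bij_betw[OF bij, symmetric] del: sum.atMost_Suc)
  also have "\<dots> = (\<Sum>q\<in>insert t I. \<beta> q * (\<Sum>r\<in>insert t I. \<beta> r * fbm_cov H q r))"
    by (simp only: sum_distrib_left mult.assoc)
  also have "\<dots> = (\<Sum>q\<in>insert t J. \<alpha> q * (\<Sum>r\<in>insert t I. \<beta> r * fbm_cov H q r))"
    using finI by (intro sum.mono_neutral_cong_right) (auto simp: I_def \<beta>_def)
  also have "\<dots> = (\<Sum>q\<in>insert t J. \<alpha> q * (\<Sum>r\<in>insert t J. \<alpha> r * fbm_cov H q r))"
    using finI by (intro sum.cong refl arg_cong[where f="(*) _"] sum.mono_neutral_cong_right) (auto simp: I_def \<beta>_def)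
  finally show ?thesis by (simp only: sum_distrib_left mult.assoc)
qed

section \<open>Gaussian variables and their projections\<close>

lemma (in prob_space) gaussian_rv_square_integrable:
  assumes "gaussian_rv M \<xi>"
  shows "integrable M \<xi>" "integrable M (\<lambda>\<omega>. (\<xi> \<omega>)\<^sup>2)"
proof -
  obtain m \<sigma> where *: "\<xi> \<in> borel_measurable M"
    "(\<sigma> = 0 \<and> (AE \<omega> in M. \<xi> \<omega> = m)) \<or> (\<sigma> > 0 \<and> distributed M lborel \<xi> (normal_density m \<sigma>))"
    using assms by (auto simp: gaussian_rv_def)
  note [measurable] = *(1)
  show "integrable M \<xi>" "integrable M (\<lambda>\<omega>. (\<xi> \<omega>)\<^sup>2)"
  proof -
    have "integrable M \<xi> \<and> integrable M (\<lambda>\<omega>. (\<xi> \<omega>)\<^sup>2)"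
    proof (cases "\<sigma> > 0")
      case False
      then have ae: "AE \<omega> in M. \<xi> \<omega> = m" using * by auto
      have "integrable M \<xi> = integrable M (\<lambda>_. m)" "integrable M (\<lambda>\<omega>. (\<xi> \<omega>)\<^sup>2) = integrable M (\<lambda>_. m\<^sup>2)"
        by (intro integrable_cong_AE; use ae in auto)+
      then show ?thesis by simp
    next
      case True
      then have D: "distributed M lborel \<xi> (normal_density m \<sigma>)" using * by auto
      have 1: "integrable M \<xi>"
        using integrable_normal_moment_nz_1[OF True, of m] distributed_integrable[OF D, of "\<lambda>x. x"] by simp
      have "integrable lborel (\<lambda>x. normal_density m \<sigma> x * (x - m)\<^sup>2)"
        by (rule integrable_normal_moment[OF True])
      then have "integrable M (\<lambda>\<omega>. (\<xi> \<omega> - m)\<^sup>2)"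
        using distributed_integrable[OF D, of "\<lambda>x. (x - m)\<^sup>2"] by simp
      then have "integrable M (\<lambda>\<omega>. (\<xi> \<omega> - m)\<^sup>2 + 2 * m * \<xi> \<omega> - m\<^sup>2)"
        using 1 by auto
      then have "integrable M (\<lambda>\<omega>. (\<xi> \<omega>)\<^sup>2)"
        by (rule back_subst[of "integrable M"]) (auto simp: power2_eq_square algebra_simps)
      with 1 show ?thesis by simp
    qed
    then show "integrable M \<xi>" "integrable M (\<lambda>\<omega>. (\<xi> \<omega>)\<^sup>2)" by auto
  qed
qed

lemma (in prob_space) centered_gaussian_char:
  assumes "gaussian_rv M \<xi>" "(\<integral>\<omega>. \<xi> \<omega> \<partial>M) = 0"
  shows "(\<integral>\<omega>. iexp (\<xi> \<omega>) \<partial>M) = complex_of_real (exp (- (\<integral>\<omega>. (\<xi> \<omega>)\<^sup>2 \<partial>M) / 2))"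
proof -
  obtain m \<sigma> where *: "\<xi> \<in> borel_measurable M"
    "(\<sigma> = 0 \<and> (AE \<omega> in M. \<xi> \<omega> = m)) \<or> (\<sigma> > 0 \<and> distributed M lborel \<xi> (normal_density m \<sigma>))"
    using assms by (auto simp: gaussian_rv_def)
  note [measurable] = *(1)
  show ?thesis
  proof (cases "\<sigma> > 0")
    case False
    then have ae: "AE \<omega> in M. \<xi> \<omega> = m" using * by auto
    have "(\<integral>\<omega>. \<xi> \<omega> \<partial>M) = (\<integral>\<omega>. m \<partial>M)" using ae by (intro integral_cong_AE) auto
    then have m: "m = 0" using assms by (simp add: prob_space)
    have "(\<integral>\<omega>. iexp (\<xi> \<omega>) \<partial>M) = (\<integral>\<omega>. 1 \<partial>M)" using ae m by (intro integral_cong_AE) auto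
    moreover have "(\<integral>\<omega>. (\<xi> \<omega>)\<^sup>2 \<partial>M) = (\<integral>\<omega>. 0 \<partial>M)" using ae m by (intro integral_cong_AE) auto
    ultimately show ?thesis by (simp add: prob_space)
  next
    case True
    then have D: "distributed M lborel \<xi> (normal_density m \<sigma>)" using * by auto
    have m: "m = 0" using normal_distributed_expectation[OF True D] assms by simp
    have var: "(\<integral>\<omega>. (\<xi> \<omega>)\<^sup>2 \<partial>M) = \<sigma>\<^sup>2"
      using normal_distributed_variance[OF True D] assms by simp
    have std: "distributed M lborel (\<lambda>x. (\<xi> x - m) / \<sigma>) std_normal_density"
      using D normal_standard_normal_convert[OF True] by simp
    have "std_normal_distribution = distr M lborel (\<lambda>x. (\<xi> x - m) / \<sigma>)"
      using distributed_distr_eq_density[OF std] by simp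
    then have "char std_normal_distribution \<sigma> = (\<integral>\<omega>. iexp (\<sigma> * ((\<xi> \<omega> - m) / \<sigma>)) \<partial>M)"
      unfolding char_def by (simp only:) (subst integral_distr; simp)
    then show ?thesis
      using True m unfolding char_std_normal_distribution var by simp
  qed
qed

lemma square_integrable_mult:
  fixes f g :: "'w \<Rightarrow> real"
  assumes [measurable]: "f \<in> borel_measurable M" "g \<in> borel_measurable M"
    and "integrable M (\<lambda>\<omega>. (f \<omega>)\<^sup>2)" "integrable M (\<lambda>\<omega>. (g \<omega>)\<^sup>2)"
  shows "integrable M (\<lambda>\<omega>. f \<omega> * g \<omega>)"
proof (rule Bochner_Integration.integrable_bound)
  show "integrable M (\<lambda>\<omega>. (f \<omega>)\<^sup>2 + (g \<omega>)\<^sup>2)" using assms by auto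
  show "AE \<omega> in M. norm (f \<omega> * g \<omega>) \<le> norm ((f \<omega>)\<^sup>2 + (g \<omega>)\<^sup>2)"
  proof (intro AE_I2)
    fix \<omega>
    have "2 * \<bar>f \<omega>\<bar> * \<bar>g \<omega>\<bar> \<le> \<bar>f \<omega>\<bar>\<^sup>2 + \<bar>g \<omega>\<bar>\<^sup>2" by (rule sum_squares_bound)
    moreover have "0 \<le> \<bar>f \<omega>\<bar> * \<bar>g \<omega>\<bar>" by simp
    ultimately have "\<bar>f \<omega>\<bar> * \<bar>g \<omega>\<bar> \<le> \<bar>f \<omega>\<bar>\<^sup>2 + \<bar>g \<omega>\<bar>\<^sup>2" by linarith
    then show "norm (f \<omega> * g \<omega>) \<le> norm ((f \<omega>)\<^sup>2 + (g \<omega>)\<^sup>2)" by (simp add: abs_mult)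
  qed
qed measurable

lemma abs_exp_minus_diff_le:
  fixes x y :: real
  assumes "0 \<le> x" "0 \<le> y"
  shows "\<bar>exp (- x) - exp (- y)\<bar> \<le> \<bar>x - y\<bar>"
proof -
  have *: "exp (- x) - exp (- y) \<le> y - x" if "0 \<le> x" "x \<le> y" for x y :: real
  proof -
    have "exp (- x) - exp (- y) = exp (- x) * (1 - exp (- (y - x)))"
      by (simp add: algebra_simps flip: exp_add)
    also have "\<dots> \<le> 1 * (y - x)"
    proof (intro mult_mono)
      have "1 + - (y - x) \<le> exp (- (y - x))" by (rule exp_ge_add_one_self)
      then show "1 - exp (- (y - x)) \<le> y - x" by linarith
    qed (use that in auto)
    finally show ?thesis by simp
  qed
  show ?thesis using *[of x y] *[of y x] assms by (cases "x \<le> y") (auto simp: abs_real_def)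
qed

lemma norm_iexp_diff_le: "norm (iexp x - iexp y) \<le> \<bar>x - y\<bar>"
proof -
  have "iexp x - iexp y = iexp y * (iexp (x - y) - 1)"
    by (simp add: algebra_simps flip: exp_add)
  then have "norm (iexp x - iexp y) = norm (iexp (x - y) - 1)"
    by (simp add: norm_mult)
  also have "\<dots> \<le> \<bar>x - y\<bar>" using iexp_approx1[of "x - y" 0] by simp
  finally show ?thesis .
qed

text \<open>The argument of Riesz and Fischer: the sum of the norms of the increments has finite expectation, hence
  is almost surely finite.\<close>

lemma AE_convergent_of_summable_increments:
  fixes f :: "nat \<Rightarrow> 'w \<Rightarrow> 'b::{banach, second_countable_topology}"
  assumes [measurable]: "\<And>k. f k \<in> borel_measurable M"
    and le: "\<And>k. (\<integral>\<^sup>+\<omega>. norm (f (Suc k) \<omega> - f k \<omega>) \<partial>M) \<le> ennreal (e k)"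
    and e: "\<And>k. 0 \<le> e k" "summable e"
  shows "AE \<omega> in M. convergent (\<lambda>k. f k \<omega>)"
proof -
  have "(\<integral>\<^sup>+\<omega>. (\<Sum>k. ennreal (norm (f (Suc k) \<omega> - f k \<omega>))) \<partial>M) = (\<Sum>k. \<integral>\<^sup>+\<omega>. norm (f (Suc k) \<omega> - f k \<omega>) \<partial>M)"
    by (rule nn_integral_suminf) auto
  also have "\<dots> \<le> (\<Sum>k. ennreal (e k))" using le by (intro suminf_le) auto
  also have "\<dots> < \<infinity>" using e by (simp add: suminf_ennreal2)
  finally have "AE \<omega> in M. (\<Sum>k. ennreal (norm (f (Suc k) \<omega> - f k \<omega>))) \<noteq> \<infinity>"
    by (intro nn_integral_PInf_AE) auto
  then show ?thesis
  proof eventually_elim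
    case (elim \<omega>)
    then have "summable (\<lambda>k. norm (f (Suc k) \<omega> - f k \<omega>))"
      by (intro summable_suminf_not_top) auto
    then have "summable (\<lambda>k. f (Suc k) \<omega> - f k \<omega>)" by (rule summable_norm_cancel)
    then have "convergent (\<lambda>n. \<Sum>k<n. f (Suc k) \<omega> - f k \<omega>)" by (simp add: summable_iff_convergent)
    moreover have "(\<lambda>n. \<Sum>k<n. f (Suc k) \<omega> - f k \<omega>) = (\<lambda>n. f n \<omega> - f 0 \<omega>)"
      by (rule ext, rule sum_lessThan_telescope)
    ultimately have "convergent (\<lambda>n. f n \<omega> - f 0 \<omega>)" by simp
    then have "convergent (\<lambda>n. f n \<omega> - f 0 \<omega> + f 0 \<omega>)" by (intro convergent_add convergent_const)
    then show ?case by simp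
  qed
qed

text \<open>For jointly Gaussian variables, conditioning \<open>iexp \<eta>\<close> on the linear space \<open>V\<close> yields
  \<open>exp (- S / 2) iexp p\<close>, where \<open>p\<close> is the projection of \<open>\<eta>\<close> onto the closure of \<open>V\<close> and \<open>S\<close> the residual
  variance. Instead of \<open>p\<close> the statement provides \<open>G = iexp p\<close>, obtained as the almost sure limit of
  \<open>iexp (L k)\<close> along a minimising sequence \<open>L\<close>, and expresses the conditioning by testing against the
  exponentials of \<open>V\<close>. Gaussianity enters only through the characteristic functions of \<open>V\<close> and
  \<open>\<eta> + V\<close>.\<close>

lemma (in prob_space) gaussian_projection:
  fixes V :: "('a \<Rightarrow> real) set" and \<eta> :: "'a \<Rightarrow> real"
  assumes zero: "(\<lambda>\<omega>. 0) \<in> V"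
    and add: "\<And>f g. f \<in> V \<Longrightarrow> g \<in> V \<Longrightarrow> (\<lambda>\<omega>. f \<omega> + g \<omega>) \<in> V"
    and scale: "\<And>f a. f \<in> V \<Longrightarrow> (\<lambda>\<omega>. a * f \<omega>) \<in> V"
    and meas: "\<And>f. f \<in> V \<Longrightarrow> f \<in> borel_measurable M"
    and sq: "\<And>f. f \<in> V \<Longrightarrow> integrable M (\<lambda>\<omega>. (f \<omega>)\<^sup>2)"
    and \<eta>: "\<eta> \<in> borel_measurable M" "integrable M (\<lambda>\<omega>. (\<eta> \<omega>)\<^sup>2)"
    and char_V: "\<And>f. f \<in> V \<Longrightarrow> (\<integral>\<omega>. iexp (f \<omega>) \<partial>M) = complex_of_real (exp (- (\<integral>\<omega>. (f \<omega>)\<^sup>2 \<partial>M) / 2))"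
    and char_\<eta>: "\<And>f. f \<in> V \<Longrightarrow> (\<integral>\<omega>. iexp (\<eta> \<omega> + f \<omega>) \<partial>M) = complex_of_real (exp (- (\<integral>\<omega>. (\<eta> \<omega> + f \<omega>)\<^sup>2 \<partial>M) / 2))"
    and lower: "\<And>f. f \<in> V \<Longrightarrow> v \<le> (\<integral>\<omega>. (\<eta> \<omega> - f \<omega>)\<^sup>2 \<partial>M)"
  obtains S :: real and G :: "'a \<Rightarrow> complex"
  where "v \<le> S" "G \<in> borel_measurable M" "AE \<omega> in M. norm (G \<omega>) \<le> 1"
    "\<And>f. f \<in> V \<Longrightarrow> (\<integral>\<omega>. iexp (f \<omega>) * (iexp (\<eta> \<omega>) - complex_of_real (exp (- S / 2)) * G \<omega>) \<partial>M) = 0"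
proof -
  define q where "q f = (\<integral>\<omega>. (\<eta> \<omega> - f \<omega>)\<^sup>2 \<partial>M)" for f
  define S where "S = (INF f\<in>V. q f)"
  have bdd: "bdd_below (q ` V)" using lower by (intro bdd_belowI[of _ v]) (auto simp: q_def)
  have Sle: "S \<le> q f" if "f \<in> V" for f unfolding S_def using bdd that by (rule cINF_lower)
  have vS: "v \<le> S" unfolding S_def using zero lower by (intro cINF_greatest) (auto simp: q_def)
  have "\<exists>f\<in>V. q f < S + (1/4)^k" for k :: nat
  proof -
    have "S < S + (1/4)^k" by simp
    then show ?thesis unfolding S_def using bdd zero by (subst (asm) cINF_less_iff) auto
  qed
  \<comment> \<open>The geometric rate makes the increments of \<open>iexp (L k)\<close> summable in mean below.\<close>
  then obtain L where L: "\<And>k. L k \<in> V" "\<And>k. q (L k) < S + (1/4)^k" by metis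
  note [measurable] = \<eta>(1) meas[OF L(1)]
  have prod: "integrable M (\<lambda>\<omega>. f \<omega> * g \<omega>)"
    if "f \<in> insert \<eta> V" "g \<in> insert \<eta> V" for f g
    using that meas sq \<eta> by (intro square_integrable_mult) auto
  have q_expand: "q f = (\<integral>\<omega>. (\<eta> \<omega>)\<^sup>2 \<partial>M) - 2 * (\<integral>\<omega>. \<eta> \<omega> * f \<omega> \<partial>M) + (\<integral>\<omega>. (f \<omega>)\<^sup>2 \<partial>M)" if "f \<in> V" for f
  proof -
    have "q f = (\<integral>\<omega>. (\<eta> \<omega>)\<^sup>2 - 2 * (\<eta> \<omega> * f \<omega>) + (f \<omega>)\<^sup>2 \<partial>M)"
      unfolding q_def by (intro Bochner_Integration.integral_cong refl) (simp add: power2_eq_square algebra_simps)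
    then show ?thesis using prod[of \<eta> f] \<eta> sq that by simp
  qed
  have sq_expand: "(\<integral>\<omega>. (a * f \<omega> + b * g \<omega>)\<^sup>2 \<partial>M)
      = a\<^sup>2 * (\<integral>\<omega>. (f \<omega>)\<^sup>2 \<partial>M) + 2 * a * b * (\<integral>\<omega>. f \<omega> * g \<omega> \<partial>M) + b\<^sup>2 * (\<integral>\<omega>. (g \<omega>)\<^sup>2 \<partial>M)"
    if "f \<in> insert \<eta> V" "g \<in> insert \<eta> V" for f g and a b :: real
  proof -
    have "(\<integral>\<omega>. (a * f \<omega> + b * g \<omega>)\<^sup>2 \<partial>M)
      = (\<integral>\<omega>. a\<^sup>2 * (f \<omega> * f \<omega>) + 2 * a * b * (f \<omega> * g \<omega>) + b\<^sup>2 * (g \<omega> * g \<omega>) \<partial>M)"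
      by (intro Bochner_Integration.integral_cong refl) (simp add: power2_eq_square algebra_simps)
    then show ?thesis using prod[of f g] prod[of f f] prod[of g g] that by (simp add: power2_eq_square)
  qed
  have cross_add: "(\<integral>\<omega>. h \<omega> * (a * f \<omega> + b * g \<omega>) \<partial>M) = a * (\<integral>\<omega>. h \<omega> * f \<omega> \<partial>M) + b * (\<integral>\<omega>. h \<omega> * g \<omega> \<partial>M)"
    if "h \<in> insert \<eta> V" "f \<in> insert \<eta> V" "g \<in> insert \<eta> V" for f g h and a b :: real
  proof -
    have "(\<integral>\<omega>. h \<omega> * (a * f \<omega> + b * g \<omega>) \<partial>M) = (\<integral>\<omega>. a * (h \<omega> * f \<omega>) + b * (h \<omega> * g \<omega>) \<partial>M)"
      by (intro Bochner_Integration.integral_cong refl) (simp add: algebra_simps)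
    then show ?thesis using prod[of h f] prod[of h g] that by simp
  qed
  have comb: "(\<lambda>\<omega>. a * f \<omega> + b * g \<omega>) \<in> V" if "f \<in> V" "g \<in> V" for f g a b
    using add[OF scale[OF that(1), of a] scale[OF that(2), of b]] .
  have q_nonneg: "0 \<le> q f" for f by (simp add: q_def)
  have LV: "L k \<in> insert \<eta> V" for k using L by auto
  \<comment> \<open>By the parallelogram identity, the midpoint of two almost minimisers forces them to be close.\<close>
  have step: "(\<integral>\<omega>. (L (Suc k) \<omega> - L k \<omega>)\<^sup>2 \<partial>M) \<le> 4 * (1/4)^k" for k
  proof -
    let ?f = "L (Suc k)" and ?g = "L k"
    have "S \<le> q (\<lambda>\<omega>. (1/2) * ?f \<omega> + (1/2) * ?g \<omega>)" by (intro Sle comb L)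
    also have "\<dots> = (\<integral>\<omega>. (\<eta> \<omega>)\<^sup>2 \<partial>M) - (\<integral>\<omega>. \<eta> \<omega> * ?f \<omega> \<partial>M) - (\<integral>\<omega>. \<eta> \<omega> * ?g \<omega> \<partial>M)
       + ((\<integral>\<omega>. (?f \<omega>)\<^sup>2 \<partial>M) + 2 * (\<integral>\<omega>. ?f \<omega> * ?g \<omega> \<partial>M) + (\<integral>\<omega>. (?g \<omega>)\<^sup>2 \<partial>M)) / 4"
      unfolding q_expand[OF comb[OF L(1) L(1)]] sq_expand[OF LV LV] cross_add[OF insertI1 LV LV]
      by (simp add: power2_eq_square field_simps)
    finally have "4 * S \<le> 2 * q ?f + 2 * q ?g - ((\<integral>\<omega>. (?f \<omega>)\<^sup>2 \<partial>M) - 2 * (\<integral>\<omega>. ?f \<omega> * ?g \<omega> \<partial>M) + (\<integral>\<omega>. (?g \<omega>)\<^sup>2 \<partial>M))"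
      unfolding q_expand[OF L(1)] by (simp add: field_simps)
    moreover have "(\<integral>\<omega>. (?f \<omega> - ?g \<omega>)\<^sup>2 \<partial>M) = (\<integral>\<omega>. (?f \<omega>)\<^sup>2 \<partial>M) - 2 * (\<integral>\<omega>. ?f \<omega> * ?g \<omega> \<partial>M) + (\<integral>\<omega>. (?g \<omega>)\<^sup>2 \<partial>M)"
      using sq_expand[OF LV LV, of 1 "Suc k" "-1" k] by simp
    ultimately have "(\<integral>\<omega>. (?f \<omega> - ?g \<omega>)\<^sup>2 \<partial>M) \<le> 2 * (q ?f - S) + 2 * (q ?g - S)" by simp
    also have "\<dots> \<le> 4 * (1/4)^k"
    proof -
      have *: "2 * (y - S) + 2 * (x - S) \<le> 4 * e" if "0 \<le> e" "x < S + e" "y < S + 1/4 * e" for e x y :: real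
        using that by argo
      show ?thesis by (rule *) (use L(2)[of k] L(2)[of "Suc k"] in auto)
    qed
    finally show ?thesis .
  qed
  have "AE \<omega> in M. convergent (\<lambda>k. iexp (L k \<omega>))"
  proof (rule AE_convergent_of_summable_increments)
    show "(\<integral>\<^sup>+\<omega>. norm (iexp (L (Suc k) \<omega>) - iexp (L k \<omega>)) \<partial>M) \<le> ennreal (3 * (1/2)^k)" for k
    proof -
      let ?D = "\<lambda>\<omega>. L (Suc k) \<omega> - L k \<omega>"
      \<comment> \<open>Young's inequality with the weights \<open>(1/2) ^ k\<close> and \<open>2 ^ k\<close> passes from second to first moments.\<close>
      have bound: "norm (iexp (L (Suc k) \<omega>) - iexp (L k \<omega>)) \<le> (1/2) ^ k + 2 ^ k * (?D \<omega>)\<^sup>2 / 2" for \<omega>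
      proof -
        have ab: "(1/2::real)^k * 2^k = 1" by (simp flip: power_mult_distrib)
        have "0 \<le> (1/2)^k * (1 - 2^k * \<bar>?D \<omega>\<bar>)\<^sup>2" by simp
        also have "\<dots> = (1/2)^k - 2 * ((1/2)^k * 2^k) * \<bar>?D \<omega>\<bar> + ((1/2)^k * 2^k) * 2^k * \<bar>?D \<omega>\<bar>\<^sup>2"
          by algebra
        finally have "2 * \<bar>?D \<omega>\<bar> \<le> (1/2)^k + 2^k * (?D \<omega>)\<^sup>2"
          unfolding ab by simp
        moreover have "0 \<le> (1/2::real)^k" by simp
        ultimately have "\<bar>?D \<omega>\<bar> \<le> (1/2) ^ k + 2 ^ k * (?D \<omega>)\<^sup>2 / 2" by argo
        then show ?thesis using norm_iexp_diff_le[of "L (Suc k) \<omega>" "L k \<omega>"] by linarith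
      qed
      have int: "integrable M (\<lambda>\<omega>. (?D \<omega>)\<^sup>2)" using sq[OF comb[OF L(1) L(1), of 1 "Suc k" "-1" k]] by simp
      have "(\<integral>\<^sup>+\<omega>. norm (iexp (L (Suc k) \<omega>) - iexp (L k \<omega>)) \<partial>M)
         \<le> (\<integral>\<^sup>+\<omega>. ennreal ((1/2) ^ k + 2 ^ k * (?D \<omega>)\<^sup>2 / 2) \<partial>M)"
        by (intro nn_integral_mono ennreal_leI bound)
      also have "\<dots> = ennreal (\<integral>\<omega>. (1/2) ^ k + 2 ^ k * (?D \<omega>)\<^sup>2 / 2 \<partial>M)"
        using int by (intro nn_integral_eq_integral) auto
      also have "(\<integral>\<omega>. (1/2) ^ k + 2 ^ k * (?D \<omega>)\<^sup>2 / 2 \<partial>M) = (1/2)^k + 2^k * (\<integral>\<omega>. (?D \<omega>)\<^sup>2 \<partial>M) / 2"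
        using int by (simp add: prob_space)
      also have "\<dots> \<le> (1/2)^k + 2^k * (4 * (1/4)^k) / 2"
        using step[of k] by (intro add_left_mono divide_right_mono mult_left_mono) auto
      also have "\<dots> = 3 * (1/2)^k"
        by (simp add: power_divide power_mult_distrib[of 2 2 k, symmetric, simplified] flip: power_mult_distrib)
           (simp add: field_simps flip: power_mult_distrib)
      finally show ?thesis by (simp add: ennreal_leI)
    qed
  qed (auto intro!: summable_mult summable_geometric)
  define G where "G \<omega> = lim (\<lambda>k. iexp (L k \<omega>))" for \<omega>
  have lim: "AE \<omega> in M. (\<lambda>k. iexp (L k \<omega>)) \<longlonglongrightarrow> G \<omega>"
    using \<open>AE \<omega> in M. convergent (\<lambda>k. iexp (L k \<omega>))\<close> by eventually_elim (simp add: G_def convergent_LIMSEQ_iff)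
  have G_meas[measurable]: "G \<in> borel_measurable M"
    unfolding G_def by (rule borel_measurable_lim_metric) auto
  have G1: "AE \<omega> in M. norm (G \<omega>) \<le> 1"
    using lim
  proof eventually_elim
    case (elim \<omega>)
    from tendsto_norm[OF this] show ?case by (simp add: LIMSEQ_const_iff)
  qed
  have zero_int: "(\<integral>\<omega>. iexp (f \<omega>) * (iexp (\<eta> \<omega>) - complex_of_real (exp (- S / 2)) * G \<omega>) \<partial>M) = 0" if f: "f \<in> V" for f
  proof -
    note [measurable] = meas[OF f]
    let ?I = "\<lambda>k. \<integral>\<omega>. iexp (f \<omega>) * (iexp (\<eta> \<omega>) - exp (- S / 2) * iexp (L k \<omega>)) \<partial>M"
    have "?I \<longlonglongrightarrow> (\<integral>\<omega>. iexp (f \<omega>) * (iexp (\<eta> \<omega>) - complex_of_real (exp (- S / 2)) * G \<omega>) \<partial>M)"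
    proof (rule integral_dominated_convergence[where w="\<lambda>_. 1 + exp (- S / 2)"])
      show "AE \<omega> in M. (\<lambda>k. iexp (f \<omega>) * (iexp (\<eta> \<omega>) - exp (- S / 2) * iexp (L k \<omega>)))
          \<longlonglongrightarrow> iexp (f \<omega>) * (iexp (\<eta> \<omega>) - complex_of_real (exp (- S / 2)) * G \<omega>)"
        using lim by eventually_elim (intro tendsto_intros)
      show "AE \<omega> in M. norm (iexp (f \<omega>) * (iexp (\<eta> \<omega>) - exp (- S / 2) * iexp (L k \<omega>))) \<le> 1 + exp (- S / 2)" for k
        by (intro AE_I2) (auto simp: norm_mult intro!: order_trans[OF norm_triangle_ineq4])
    qed auto
    moreover have "?I \<longlonglongrightarrow> 0"
    proof -
      define p where "p k = (\<integral>\<omega>. (f \<omega> + L k \<omega>)\<^sup>2 \<partial>M)" for k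
      \<comment> \<open>\<open>r k\<close> is the inner product of the residual \<open>\<eta> - L k\<close> with \<open>f + L k\<close>; for the exact projection it would vanish.\<close>
      define r where "r k = (\<integral>\<omega>. \<eta> \<omega> * (f \<omega> + L k \<omega>) \<partial>M) - (\<integral>\<omega>. L k \<omega> * (f \<omega> + L k \<omega>) \<partial>M)" for k
      define P where "P = 2 * (\<integral>\<omega>. (f \<omega>)\<^sup>2 \<partial>M) + 4 * (\<integral>\<omega>. (\<eta> \<omega>)\<^sup>2 \<partial>M) + 4 * (S + 1)"
      have fL: "(\<lambda>\<omega>. f \<omega> + L k \<omega>) \<in> V" for k using add[OF f L(1)] .
      have S0: "0 \<le> S" unfolding S_def using zero q_nonneg by (intro cINF_greatest) auto
      have I: "?I k = complex_of_real (exp (- ((\<integral>\<omega>. (\<eta> \<omega> + f \<omega>)\<^sup>2 \<partial>M) / 2)) - exp (- ((S + p k) / 2)))" for k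
      proof -
        have "?I k = (\<integral>\<omega>. iexp (\<eta> \<omega> + f \<omega>) - exp (- S / 2) * iexp (f \<omega> + L k \<omega>) \<partial>M)"
          by (intro Bochner_Integration.integral_cong refl) (simp add: algebra_simps exp_add)
        also have "\<dots> = (\<integral>\<omega>. iexp (\<eta> \<omega> + f \<omega>) \<partial>M) - exp (- S / 2) * (\<integral>\<omega>. iexp (f \<omega> + L k \<omega>) \<partial>M)"
          by (subst Bochner_Integration.integral_diff)
             (auto intro!: integrable_const_bound[where B=1] integrable_mult_right simp: norm_mult)
        also have "\<dots> = complex_of_real (exp (- (\<integral>\<omega>. (\<eta> \<omega> + f \<omega>)\<^sup>2 \<partial>M) / 2) - exp (- S / 2) * exp (- (p k) / 2))"
          by (simp only: char_\<eta>[OF f] char_V[OF fL] p_def of_real_mult of_real_diff)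
        also have "exp (- S / 2) * exp (- (p k) / 2) = exp (- ((S + p k) / 2))"
          by (simp add: exp_add[symmetric] field_simps)
        finally show ?thesis by simp
      qed
      have var: "(\<integral>\<omega>. (\<eta> \<omega> + f \<omega>)\<^sup>2 \<partial>M) = q (L k) + p k + 2 * r k" for k
      proof -
        have fV: "f \<in> insert \<eta> V" using f by simp
        show ?thesis
          using sq_expand[OF insertI1 fV, of 1 1] sq_expand[OF fV LV, of 1 1 k]
            cross_add[OF insertI1 fV LV, of 1 1 k] cross_add[OF LV fV LV, of k 1 1 k]
          unfolding r_def p_def q_expand[OF L(1)] by (simp add: power2_eq_square mult.commute)
      qed
      have p_le: "p k \<le> P" for k
      proof -
        have "p k \<le> (\<integral>\<omega>. 2 * (f \<omega>)\<^sup>2 + 4 * (\<eta> \<omega>)\<^sup>2 + 4 * (\<eta> \<omega> - L k \<omega>)\<^sup>2 \<partial>M)"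
          unfolding p_def
        proof (intro integral_mono)
          have "integrable M (\<lambda>\<omega>. (\<eta> \<omega> * \<eta> \<omega> - 2 * (\<eta> \<omega> * L k \<omega>)) + L k \<omega> * L k \<omega>)"
            using prod[OF insertI1 LV] prod[OF LV LV] prod[OF insertI1 insertI1] by auto
          then have "integrable M (\<lambda>\<omega>. (\<eta> \<omega> - L k \<omega>)\<^sup>2)"
            by (rule back_subst[of "integrable M"]) (auto simp: power2_eq_square algebra_simps)
          then show "integrable M (\<lambda>\<omega>. 2 * (f \<omega>)\<^sup>2 + 4 * (\<eta> \<omega>)\<^sup>2 + 4 * (\<eta> \<omega> - L k \<omega>)\<^sup>2)"
            using sq[OF f] \<eta> by auto
          show "integrable M (\<lambda>\<omega>. (f \<omega> + L k \<omega>)\<^sup>2)" by (rule sq[OF fL])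
          fix \<omega>
          have "0 \<le> (f \<omega> - L k \<omega>)\<^sup>2 + 2 * (\<eta> \<omega> + (\<eta> \<omega> - L k \<omega>))\<^sup>2"
            by simp
          then have "0 \<le> (f \<omega> - L k \<omega>)\<^sup>2" "0 \<le> (\<eta> \<omega> + (\<eta> \<omega> - L k \<omega>))\<^sup>2" by auto
          then show "(f \<omega> + L k \<omega>)\<^sup>2 \<le> 2 * (f \<omega>)\<^sup>2 + 4 * (\<eta> \<omega>)\<^sup>2 + 4 * (\<eta> \<omega> - L k \<omega>)\<^sup>2"
            by (simp add: power2_eq_square algebra_simps)
        qed
        also have "\<dots> = 2 * (\<integral>\<omega>. (f \<omega>)\<^sup>2 \<partial>M) + 4 * (\<integral>\<omega>. (\<eta> \<omega>)\<^sup>2 \<partial>M) + 4 * q (L k)"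
        proof -
          have "integrable M (\<lambda>\<omega>. (\<eta> \<omega> * \<eta> \<omega> - 2 * (\<eta> \<omega> * L k \<omega>)) + L k \<omega> * L k \<omega>)"
            using prod[OF insertI1 LV] prod[OF LV LV] prod[OF insertI1 insertI1] by auto
          then have "integrable M (\<lambda>\<omega>. (\<eta> \<omega> - L k \<omega>)\<^sup>2)"
            by (rule back_subst[of "integrable M"]) (auto simp: power2_eq_square algebra_simps)
          then show ?thesis using sq[OF f] \<eta> by (simp add: q_def)
        qed
        also have "\<dots> \<le> P"
        proof -
          have "(1/4::real)^k \<le> 1" by (rule power_le_one) auto
          then show ?thesis using L(2)[of k] by (simp add: P_def)
        qed
        finally show ?thesis .
      qed
      \<comment> \<open>Near minimality of \<open>L k\<close>, tested in the direction \<open>f + L k\<close> with the step lengths \<open>\<plusminus>(1/2) ^ k\<close>.\<close>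
      have r_le: "\<bar>r k\<bar> \<le> (1/2)^k * (1 + P)" for k
      proof -
        have *: "2 * a * r k \<le> (1/4)^k + a\<^sup>2 * p k" for a
        proof -
          have "S \<le> q (\<lambda>\<omega>. 1 * L k \<omega> + a * (f \<omega> + L k \<omega>))" by (intro Sle comb fL L)
          also have "\<dots> = q (L k) - 2 * a * r k + a\<^sup>2 * p k"
            using fL[of k] unfolding q_expand[OF comb[OF L(1) fL]] q_expand[OF L(1)] p_def r_def
            by (subst sq_expand[OF LV], simp, subst cross_add[OF insertI1 LV], simp) (simp add: algebra_simps)
          finally show ?thesis using L(2)[of k] by simp
        qed
        have pw: "((1/2::real)^k)\<^sup>2 = (1/4)^k"
          by (simp add: power2_eq_square flip: power_mult_distrib)
        have "2 * (1/2)^k * \<bar>r k\<bar> \<le> (1/4)^k * (1 + p k)"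
          using *[of "(1/2)^k"] *[of "- ((1/2)^k)"] pw by (auto simp: abs_real_def algebra_simps)
        also have "\<dots> \<le> (1/4)^k * (1 + P)" using p_le by (intro mult_left_mono) auto
        also have "(1/4::real)^k = (1/2)^k * (1/2)^k" by (simp flip: power_mult_distrib)
        finally have "(1/2)^k * (2 * \<bar>r k\<bar>) \<le> (1/2)^k * ((1/2)^k * (1 + P))" by (simp add: mult_ac)
        then have "2 * \<bar>r k\<bar> \<le> (1/2)^k * (1 + P)" by (subst (asm) mult_le_cancel_left_pos) auto
        moreover have "0 \<le> \<bar>r k\<bar>" by simp
        ultimately show ?thesis by linarith
      qed
      have "norm (?I k) \<le> (1/4)^k + (1/2)^k * (1 + P)" for k
      proof -
        have "norm (?I k) = \<bar>exp (- ((\<integral>\<omega>. (\<eta> \<omega> + f \<omega>)\<^sup>2 \<partial>M) / 2)) - exp (- ((S + p k) / 2))\<bar>"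
          unfolding I norm_of_real real_norm_def ..
        also have "\<dots> \<le> \<bar>(\<integral>\<omega>. (\<eta> \<omega> + f \<omega>)\<^sup>2 \<partial>M) / 2 - (S + p k) / 2\<bar>"
          using S0 by (intro abs_exp_minus_diff_le) (auto simp: p_def)
        also have "(\<integral>\<omega>. (\<eta> \<omega> + f \<omega>)\<^sup>2 \<partial>M) / 2 - (S + p k) / 2 = (q (L k) - S) / 2 + r k"
          unfolding var[of k] by (simp add: field_simps)
        also have "\<bar>(q (L k) - S) / 2 + r k\<bar> \<le> \<bar>(q (L k) - S) / 2\<bar> + \<bar>r k\<bar>" by (rule abs_triangle_ineq)
        also have "\<dots> \<le> (1/4)^k + (1/2)^k * (1 + P)"
          using L(2)[of k] Sle[OF L(1), of k] by (intro add_mono r_le) auto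
        finally show ?thesis .
      qed
      moreover have "(\<lambda>k. (1/4)^k + (1/2)^k * (1 + P)) \<longlonglongrightarrow> 0"
        by (intro tendsto_add_zero tendsto_mult_left_zero LIMSEQ_power_zero) auto
      ultimately show ?thesis by (rule Lim_null_comparison[OF always_eventually[OF allI]])
    qed
    ultimately show ?thesis by (rule LIMSEQ_unique)
  qed
  show thesis by (rule that[OF vS G_meas G1 zero_int])
qed

section \<open>Fourier uniqueness on sigma-algebras\<close>

lemma (in prob_space) integrable_bounded_mult:
  fixes f Z :: "'a \<Rightarrow> 'b::{real_normed_div_algebra, banach, second_countable_topology}"
  assumes [measurable]: "f \<in> borel_measurable M" "Z \<in> borel_measurable M"
    and f: "AE \<omega> in M. norm (f \<omega>) \<le> 1" and Z: "AE \<omega> in M. norm (Z \<omega>) \<le> c"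
  shows "integrable M (\<lambda>\<omega>. f \<omega> * Z \<omega>)"
proof (rule integrable_const_bound[where B=c])
  show "AE \<omega> in M. norm (f \<omega> * Z \<omega>) \<le> c"
    using f Z
  proof eventually_elim
    case (elim \<omega>)
    have "norm (f \<omega>) * norm (Z \<omega>) \<le> 1 * c" using elim by (intro mult_mono) auto
    then show ?case by (simp add: norm_mult)
  qed
qed measurable

lemma borel_measurable_cnj_comp[measurable]:
  "f \<in> borel_measurable M \<Longrightarrow> (\<lambda>x. cnj (f x)) \<in> borel_measurable M"
  by (rule borel_measurable_continuous_on[of cnj]) (auto intro!: continuous_intros)

lemma norm_indicator_le_1: "norm (indicator A x :: 'b::real_normed_algebra_1) \<le> 1"
  by (simp add: indicator_def)

text \<open>For \<open>k > c\<close> the function \<open>1 + Z / k\<close> is a probability density, since \<open>Z\<close> has mean zero. Under this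
  density \<open>\<xi>\<close> has the same characteristic function as under \<open>M\<close>, hence by Levy's uniqueness theorem the
  same law.\<close>

lemma (in prob_space) fourier_weight_zero_real:
  fixes \<xi> Z :: "'a \<Rightarrow> real"
  assumes [measurable]: "\<xi> \<in> borel_measurable M" "Z \<in> borel_measurable M" "D \<in> sets borel"
    and bound: "AE \<omega> in M. \<bar>Z \<omega>\<bar> \<le> c"
    and zero: "\<And>\<theta>. (\<integral>\<omega>. iexp (\<theta> * \<xi> \<omega>) * complex_of_real (Z \<omega>) \<partial>M) = 0"
  shows "(\<integral>\<omega>. indicator D (\<xi> \<omega>) * Z \<omega> \<partial>M) = 0"
proof -
  have "AE \<omega> in M. 0 \<le> c" using bound by eventually_elim auto
  then have c0: "0 \<le> c" by simp
  define k where "k = c + 1"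
  have k: "0 < k" using c0 by (simp add: k_def)
  have Zint: "integrable M Z" using bound by (intro integrable_const_bound[where B=c]) auto
  have "complex_of_real (\<integral>\<omega>. Z \<omega> \<partial>M) = 0" using zero[of 0] by simp
  then have EZ: "(\<integral>\<omega>. Z \<omega> \<partial>M) = 0" by simp
  define w where "w \<omega> = (k + Z \<omega>) / k" for \<omega>
  have w_meas[measurable]: "w \<in> borel_measurable M" unfolding w_def by measurable
  have w0: "AE \<omega> in M. 0 \<le> w \<omega>" using bound by eventually_elim (use k in \<open>auto simp: w_def k_def abs_real_def split: if_splits\<close>)
  have wint: "integrable M w" unfolding w_def using Zint by auto
  have Ew: "(\<integral>\<omega>. w \<omega> \<partial>M) = 1" using Zint EZ k by (simp add: w_def prob_space)
  define \<mu> where "\<mu> = density M (\<lambda>\<omega>. ennreal (w \<omega>))"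
  have "emeasure \<mu> (space \<mu>) = (\<integral>\<^sup>+\<omega>. ennreal (w \<omega>) \<partial>M)"
    by (simp add: \<mu>_def emeasure_density cong: nn_integral_cong)
  also have "\<dots> = 1" using nn_integral_eq_integral[OF wint w0] Ew by simp
  finally have "prob_space \<mu>" by (rule prob_spaceI)
  then interpret \<mu>: prob_space \<mu> .
  have [measurable]: "\<xi> \<in> borel_measurable \<mu>" by (simp add: \<mu>_def)
  let ?M1 = "distr \<mu> borel \<xi>" and ?M2 = "distr M borel \<xi>"
  have rd: "real_distribution ?M1" "real_distribution ?M2"
    by (simp_all add: \<mu>.real_distribution_distr real_distribution_distr)
  have "char ?M1 = char ?M2"
  proof
    fix \<theta>
    have i1: "integrable M (\<lambda>\<omega>. iexp (\<theta> * \<xi> \<omega>))" by (intro integrable_const_bound[where B=1]) auto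
    have i2: "integrable M (\<lambda>\<omega>. iexp (\<theta> * \<xi> \<omega>) * complex_of_real (Z \<omega>))"
      using bound by (intro integrable_bounded_mult[where c=c]) auto
    have "char ?M1 \<theta> = (\<integral>\<omega>. iexp (\<theta> * \<xi> \<omega>) \<partial>\<mu>)" unfolding char_def by (subst integral_distr) auto
    also have "\<dots> = (\<integral>\<omega>. w \<omega> *\<^sub>R iexp (\<theta> * \<xi> \<omega>) \<partial>M)"
      unfolding \<mu>_def using w0 by (intro integral_density) auto
    also have "\<dots> = (\<integral>\<omega>. iexp (\<theta> * \<xi> \<omega>) + (iexp (\<theta> * \<xi> \<omega>) * complex_of_real (Z \<omega>)) * complex_of_real (1 / k) \<partial>M)"
      using k by (intro Bochner_Integration.integral_cong refl) (simp add: w_def scaleR_conv_of_real field_simps)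
    also have "\<dots> = (\<integral>\<omega>. iexp (\<theta> * \<xi> \<omega>) \<partial>M)"
      using i1 i2 zero[of \<theta>] by (subst Bochner_Integration.integral_add) auto
    also have "\<dots> = char ?M2 \<theta>" unfolding char_def by (subst integral_distr) auto
    finally show "char ?M1 \<theta> = char ?M2 \<theta>" .
  qed
  then have eq: "?M1 = ?M2" using rd Levy_uniqueness by blast
  have "(\<integral>\<omega>. w \<omega> * indicator D (\<xi> \<omega>) \<partial>M) = (\<integral>\<omega>. indicator D (\<xi> \<omega>) \<partial>\<mu>)"
    unfolding \<mu>_def using w0 by (subst integral_density) auto
  also have "\<dots> = (\<integral>x. indicator D x \<partial>?M1)" by (subst integral_distr) auto
  also have "\<dots> = (\<integral>x. indicator D x \<partial>?M2)" by (simp only: eq)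
  also have "\<dots> = (\<integral>\<omega>. indicator D (\<xi> \<omega>) \<partial>M)" by (subst integral_distr) auto
  finally have e: "(\<integral>\<omega>. w \<omega> * indicator D (\<xi> \<omega>) \<partial>M) = (\<integral>\<omega>. indicator D (\<xi> \<omega>) \<partial>M)" .
  have j1: "integrable M (\<lambda>\<omega>. indicator D (\<xi> \<omega>) :: real)" by (intro integrable_const_bound[where B=1]) (auto split: split_indicator)
  have j2: "integrable M (\<lambda>\<omega>. indicator D (\<xi> \<omega>) * Z \<omega>)"
    using bound by (intro integrable_bounded_mult[where c=c]) (simp_all add: norm_indicator_le_1)
  have "(\<integral>\<omega>. w \<omega> * indicator D (\<xi> \<omega>) \<partial>M) = (\<integral>\<omega>. indicator D (\<xi> \<omega>) + indicator D (\<xi> \<omega>) * Z \<omega> * (1 / k) \<partial>M)"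
    using k by (intro Bochner_Integration.integral_cong refl) (simp add: w_def field_simps)
  also have "\<dots> = (\<integral>\<omega>. indicator D (\<xi> \<omega>) \<partial>M) + (\<integral>\<omega>. indicator D (\<xi> \<omega>) * Z \<omega> \<partial>M) * (1 / k)"
    using j1 j2 by (subst Bochner_Integration.integral_add) auto
  finally show ?thesis using e k by simp
qed

text \<open>The hypothesis at \<open>- \<theta>\<close> gives the hypothesis for the conjugate of \<open>Z\<close>, hence for real and imaginary
  parts.\<close>

lemma (in prob_space) fourier_weight_zero:
  fixes \<xi> :: "'a \<Rightarrow> real" and Z :: "'a \<Rightarrow> complex"
  assumes [measurable]: "\<xi> \<in> borel_measurable M" "Z \<in> borel_measurable M" "D \<in> sets borel"
    and bound: "AE \<omega> in M. norm (Z \<omega>) \<le> c"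
    and zero: "\<And>\<theta>. (\<integral>\<omega>. iexp (\<theta> * \<xi> \<omega>) * Z \<omega> \<partial>M) = 0"
  shows "(\<integral>\<omega>. indicator D (\<xi> \<omega>) * Z \<omega> \<partial>M) = 0"
proof -
  have int: "integrable M (\<lambda>\<omega>. iexp (\<theta> * \<xi> \<omega>) * Z \<omega>)" for \<theta>
    using bound by (intro integrable_bounded_mult[where c=c]) (simp_all add: norm_indicator_le_1)
  have intc: "integrable M (\<lambda>\<omega>. iexp (\<theta> * \<xi> \<omega>) * cnj (Z \<omega>))" for \<theta>
    using bound by (intro integrable_bounded_mult[where c=c]) (simp_all add: norm_indicator_le_1)
  have zeroc: "(\<integral>\<omega>. iexp (\<theta> * \<xi> \<omega>) * cnj (Z \<omega>) \<partial>M) = 0" for \<theta>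
  proof -
    have "(\<integral>\<omega>. iexp (\<theta> * \<xi> \<omega>) * cnj (Z \<omega>) \<partial>M) = (\<integral>\<omega>. cnj (iexp ((- \<theta>) * \<xi> \<omega>) * Z \<omega>) \<partial>M)"
      by (simp add: exp_cnj)
    also have "\<dots> = cnj (\<integral>\<omega>. iexp ((- \<theta>) * \<xi> \<omega>) * Z \<omega> \<partial>M)" by (rule Bochner_Integration.integral_cnj)
    finally show ?thesis by (simp only: zero complex_cnj_zero)
  qed
  have re: "(\<integral>\<omega>. iexp (\<theta> * \<xi> \<omega>) * complex_of_real (Re (Z \<omega>)) \<partial>M) = 0" for \<theta>
  proof -
    have "(\<integral>\<omega>. iexp (\<theta> * \<xi> \<omega>) * complex_of_real (Re (Z \<omega>)) \<partial>M)
      = (\<integral>\<omega>. (iexp (\<theta> * \<xi> \<omega>) * Z \<omega> + iexp (\<theta> * \<xi> \<omega>) * cnj (Z \<omega>)) * (1/2) \<partial>M)"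
      by (intro Bochner_Integration.integral_cong refl) (simp add: complex_eq_iff field_simps)
    then show ?thesis using int[of \<theta>] intc[of \<theta>] zero[of \<theta>] zeroc[of \<theta>] by simp
  qed
  have im: "(\<integral>\<omega>. iexp (\<theta> * \<xi> \<omega>) * complex_of_real (Im (Z \<omega>)) \<partial>M) = 0" for \<theta>
  proof -
    have "(\<integral>\<omega>. iexp (\<theta> * \<xi> \<omega>) * complex_of_real (Im (Z \<omega>)) \<partial>M)
      = (\<integral>\<omega>. (iexp (\<theta> * \<xi> \<omega>) * Z \<omega> - iexp (\<theta> * \<xi> \<omega>) * cnj (Z \<omega>)) * (- \<i>/2) \<partial>M)"
      by (intro Bochner_Integration.integral_cong refl) (simp add: complex_eq_iff field_simps)
    then show ?thesis using int[of \<theta>] intc[of \<theta>] zero[of \<theta>] zeroc[of \<theta>] by simp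
  qed
  have bre: "AE \<omega> in M. \<bar>Re (Z \<omega>)\<bar> \<le> c" using bound by eventually_elim (rule order_trans[OF abs_Re_le_cmod])
  have bim: "AE \<omega> in M. \<bar>Im (Z \<omega>)\<bar> \<le> c" using bound by eventually_elim (rule order_trans[OF abs_Im_le_cmod])
  have I: "(\<integral>\<omega>. indicator D (\<xi> \<omega>) * Re (Z \<omega>) \<partial>M) = 0" "(\<integral>\<omega>. indicator D (\<xi> \<omega>) * Im (Z \<omega>) \<partial>M) = 0"
    by (rule fourier_weight_zero_real[OF _ _ _ bre re] fourier_weight_zero_real[OF _ _ _ bim im]; measurable)+
  have int': "integrable M (\<lambda>\<omega>. indicator D (\<xi> \<omega>) * Z \<omega>)"
    using bound by (intro integrable_bounded_mult[where c=c]) (simp_all add: norm_indicator_le_1)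
  have r: "Re (indicator D (\<xi> \<omega>) * Z \<omega>) = indicator D (\<xi> \<omega>) * Re (Z \<omega>)"
     "Im (indicator D (\<xi> \<omega>) * Z \<omega>) = indicator D (\<xi> \<omega>) * Im (Z \<omega>)" for \<omega>
    by (auto split: split_indicator)
  show ?thesis
    using I integral_Re[OF int'] integral_Im[OF int'] unfolding r by (simp add: complex_eq_iff)
qed

text \<open>The coordinates are treated one at a time; an indicator already obtained is absorbed into \<open>Z\<close>.\<close>

lemma (in prob_space) fourier_weight_zero_finite:
  fixes \<xi> :: "'i \<Rightarrow> 'a \<Rightarrow> real" and Z :: "'a \<Rightarrow> complex"
  assumes "finite J" and "\<And>j. j \<in> J \<Longrightarrow> \<xi> j \<in> borel_measurable M" and "Z \<in> borel_measurable M"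
    and "\<And>j. j \<in> J \<Longrightarrow> D j \<in> sets borel"
    and "AE \<omega> in M. norm (Z \<omega>) \<le> c"
    and "\<And>\<theta>. (\<integral>\<omega>. iexp (\<Sum>j\<in>J. \<theta> j * \<xi> j \<omega>) * Z \<omega> \<partial>M) = 0"
  shows "(\<integral>\<omega>. (\<Prod>j\<in>J. indicator (D j) (\<xi> j \<omega>)) * Z \<omega> \<partial>M) = 0"
  using assms
proof (induction J arbitrary: Z)
  case empty
  then show ?case by simp
next
  case (insert i J)
  have [measurable]: "\<xi> i \<in> borel_measurable M" "Z \<in> borel_measurable M" "D i \<in> sets borel"
    "\<And>j. j \<in> J \<Longrightarrow> \<xi> j \<in> borel_measurable M"
    using insert.prems by auto
  note bound = \<open>AE \<omega> in M. norm (Z \<omega>) \<le> c\<close>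
  have "(\<integral>\<omega>. (\<Prod>j\<in>J. indicator (D j) (\<xi> j \<omega>)) * (indicator (D i) (\<xi> i \<omega>) * Z \<omega>) \<partial>M) = 0"
  proof (rule insert.IH)
    show "AE \<omega> in M. norm (indicator (D i) (\<xi> i \<omega>) * Z \<omega>) \<le> c"
      using bound by eventually_elim (auto simp: norm_mult indicator_def intro: order_trans[OF norm_ge_zero])
    fix \<theta>
    have "(\<integral>\<omega>. indicator (D i) (\<xi> i \<omega>) * (iexp (\<Sum>j\<in>J. \<theta> j * \<xi> j \<omega>) * Z \<omega>) \<partial>M) = 0"
    proof (rule fourier_weight_zero)
      show "AE \<omega> in M. norm (iexp (\<Sum>j\<in>J. \<theta> j * \<xi> j \<omega>) * Z \<omega>) \<le> c"
        using bound by eventually_elim (auto simp: norm_mult)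
      fix \<theta>'
      have *: "(\<Sum>j\<in>insert i J. (\<theta>(i := \<theta>')) j * \<xi> j \<omega>) = \<theta>' * \<xi> i \<omega> + (\<Sum>j\<in>J. \<theta> j * \<xi> j \<omega>)" for \<omega>
        using insert.hyps by (auto intro!: sum.cong)
      have "(\<integral>\<omega>. iexp (\<theta>' * \<xi> i \<omega>) * (iexp (\<Sum>j\<in>J. \<theta> j * \<xi> j \<omega>) * Z \<omega>) \<partial>M)
         = (\<integral>\<omega>. iexp (\<Sum>j\<in>insert i J. (\<theta>(i := \<theta>')) j * \<xi> j \<omega>) * Z \<omega> \<partial>M)"
        unfolding * by (simp add: exp_add distrib_left mult.assoc)
      then show "(\<integral>\<omega>. iexp (\<theta>' * \<xi> i \<omega>) * (iexp (\<Sum>j\<in>J. \<theta> j * \<xi> j \<omega>) * Z \<omega>) \<partial>M) = 0"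
        using insert.prems(5)[of "\<theta>(i := \<theta>')"] by simp
    qed measurable
    then show "(\<integral>\<omega>. iexp (\<Sum>j\<in>J. \<theta> j * \<xi> j \<omega>) * (indicator (D i) (\<xi> i \<omega>) * Z \<omega>) \<partial>M) = 0"
      by (simp add: mult_ac)
  qed (use insert.prems in auto)
  then show ?case using insert.hyps by (simp add: mult_ac)
qed

text \<open>Cylinder events together with the null events form an intersection-stable generator, so Dynkin's
  theorem applies. Null events are included because the filtration is augmented.\<close>

lemma (in prob_space) fourier_weight_zero_sigma:
  fixes \<xi> :: "'i \<Rightarrow> 'a \<Rightarrow> real" and Z :: "'a \<Rightarrow> complex"
  assumes \<xi>[measurable]: "\<And>i. i \<in> I \<Longrightarrow> \<xi> i \<in> borel_measurable M" and Z[measurable]: "Z \<in> borel_measurable M"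
    and bound: "AE \<omega> in M. norm (Z \<omega>) \<le> c"
    and zero: "\<And>J \<theta>. finite J \<Longrightarrow> J \<subseteq> I \<Longrightarrow> (\<integral>\<omega>. iexp (\<Sum>j\<in>J. \<theta> j * \<xi> j \<omega>) * Z \<omega> \<partial>M) = 0"
    and A: "A \<in> sigma_sets (space M) ({\<xi> i -` D \<inter> space M | i D. i \<in> I \<and> D \<in> sets borel} \<union> null_sets M)"
  shows "(\<integral>\<omega>. indicator A \<omega> * Z \<omega> \<partial>M) = 0"
proof -
  define C where "C = {{\<omega> \<in> space M. \<forall>j\<in>J. \<xi> j \<omega> \<in> D j} | J D. finite J \<and> J \<subseteq> I \<and> (\<forall>j. D j \<in> sets borel)}"
  define P where "P = C \<union> null_sets M"
  have CM: "a \<in> sets M" if "a \<in> C" for a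
  proof -
    from that obtain J D where [measurable]: "finite J" "J \<subseteq> I" "\<And>j. D j \<in> sets borel" and a: "a = {\<omega> \<in> space M. \<forall>j\<in>J. \<xi> j \<omega> \<in> D j}"
      by (auto simp: C_def)
    have "{\<omega> \<in> space M. \<forall>j\<in>J. \<xi> j \<omega> \<in> D j} \<in> sets M"
    proof (intro sets.sets_Collect_finite_All)
      fix j assume "j \<in> J"
      then have "\<xi> j -` D j \<inter> space M \<in> sets M"
        using \<open>J \<subseteq> I\<close> \<open>\<And>j. D j \<in> sets borel\<close> by (intro measurable_sets[OF \<xi>]) auto
      moreover have "\<xi> j -` D j \<inter> space M = {\<omega> \<in> space M. \<xi> j \<omega> \<in> D j}" by auto
      ultimately show "{\<omega> \<in> space M. \<xi> j \<omega> \<in> D j} \<in> sets M" by simp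
    qed fact
    then show ?thesis using a by simp
  qed
  have PM: "P \<subseteq> sets M" using CM by (auto simp: P_def)
  have "Int_stable P"
  proof (rule Int_stableI)
    fix a b assume a: "a \<in> P" and b: "b \<in> P"
    show "a \<inter> b \<in> P"
    proof (cases "a \<in> null_sets M \<or> b \<in> null_sets M")
      case True
      then have "a \<inter> b \<in> null_sets M" using a b PM
        by (metis null_set_Int1 null_set_Int2 subsetD)
      then show ?thesis by (simp add: P_def)
    next
      case False
      then have "a \<in> C" "b \<in> C" using a b by (auto simp: P_def)
      then obtain J1 D1 J2 D2 where J: "finite J1" "J1 \<subseteq> I" "\<forall>j. D1 j \<in> sets borel" "a = {\<omega> \<in> space M. \<forall>j\<in>J1. \<xi> j \<omega> \<in> D1 j}"
        "finite J2" "J2 \<subseteq> I" "\<forall>j. D2 j \<in> sets borel" "b = {\<omega> \<in> space M. \<forall>j\<in>J2. \<xi> j \<omega> \<in> D2 j}"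
        unfolding C_def by blast
      define D where "D j = (if j \<in> J1 then D1 j else UNIV) \<inter> (if j \<in> J2 then D2 j else UNIV)" for j
      have "a \<inter> b = {\<omega> \<in> space M. \<forall>j\<in>J1 \<union> J2. \<xi> j \<omega> \<in> D j}"
        using J by (auto simp: D_def)
      moreover have "\<forall>j. D j \<in> sets borel" using J by (auto simp: D_def)
      ultimately have "a \<inter> b \<in> C" using J by (auto simp: C_def intro!: exI[of _ "J1 \<union> J2"] exI[of _ D])
      then show ?thesis by (simp add: P_def)
    qed
  qed
  moreover have "P \<subseteq> Pow (space M)" using PM sets.sets_into_space by blast
  moreover have "A \<in> sigma_sets (space M) P"
  proof -
    have "{\<xi> i -` D \<inter> space M | i D. i \<in> I \<and> D \<in> sets borel} \<union> null_sets M \<subseteq> P"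
    proof -
      have "\<xi> i -` D \<inter> space M \<in> C" if "i \<in> I" "D \<in> sets borel" for i D
      proof -
        have "\<xi> i -` D \<inter> space M = {\<omega> \<in> space M. \<forall>j\<in>{i}. \<xi> j \<omega> \<in> (\<lambda>_. D) j}" by auto
        then show ?thesis using that unfolding C_def
          by (intro CollectI exI[of _ "{i}"] exI[of _ "\<lambda>_. D"]) auto
      qed
      then show ?thesis by (auto simp: P_def)
    qed
    then show ?thesis using A sigma_sets_mono' by blast
  qed
  moreover have sub: "sigma_sets (space M) P \<subseteq> sets M" using PM by (rule sets.sigma_sets_subset)
  have int: "integrable M (\<lambda>\<omega>. indicator a \<omega> * Z \<omega>)" if "a \<in> sets M" for a
    using that bound by (intro integrable_bounded_mult[where c=c]) (simp_all add: norm_indicator_le_1)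
  have Zint: "integrable M Z" using bound by (intro integrable_const_bound[where B=c]) auto
  have EZ: "(\<integral>\<omega>. Z \<omega> \<partial>M) = 0" using zero[of "{}" "\<lambda>_. 0"] by simp
  ultimately show ?thesis
  proof (induction A rule: sigma_sets_induct_disjoint)
    case (basic A)
    show ?case
    proof (cases "A \<in> null_sets M")
      case True
      then have "AE \<omega> in M. \<omega> \<notin> A" by (rule AE_not_in)
      then have "(\<integral>\<omega>. indicator A \<omega> * Z \<omega> \<partial>M) = (\<integral>\<omega>. 0 \<partial>M)"
        using True by (intro integral_cong_AE) auto
      then show ?thesis by simp
    next
      case False
      then have "A \<in> C" using basic by (simp add: P_def)
      then obtain J D where J: "finite J" "J \<subseteq> I" "\<forall>j. D j \<in> sets borel" and a: "A = {\<omega> \<in> space M. \<forall>j\<in>J. \<xi> j \<omega> \<in> D j}"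
        by (auto simp: C_def)
      have ind: "indicator A \<omega> = (\<Prod>j\<in>J. indicator (D j) (\<xi> j \<omega>) :: complex)" if "\<omega> \<in> space M" for \<omega>
        using J that by (auto simp: a indicator_def prod_zero_iff)
      have "(\<integral>\<omega>. (\<Prod>j\<in>J. indicator (D j) (\<xi> j \<omega>)) * Z \<omega> \<partial>M) = 0"
        by (rule fourier_weight_zero_finite[OF J(1) _ Z _ bound zero]) (use J in auto)
      then show ?thesis by (simp add: ind cong: Bochner_Integration.integral_cong)
    qed
  next
    case empty
    then show ?case by simp
  next
    case (compl A)
    then have [measurable]: "A \<in> sets M" using sub by auto
    have "(\<integral>\<omega>. indicator (space M - A) \<omega> * Z \<omega> \<partial>M) = (\<integral>\<omega>. Z \<omega> - indicator A \<omega> * Z \<omega> \<partial>M)"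
      by (intro Bochner_Integration.integral_cong refl) (auto split: split_indicator)
    also have "\<dots> = 0"
      using int[of A] int[of "space M"] compl.IH EZ
      Zint by (subst Bochner_Integration.integral_diff) auto
    finally show ?case .
  next
    case (union A)
    then have AM[measurable]: "\<And>i. A i \<in> sets M" using sub by auto
    have sc: "indicator a \<omega> *\<^sub>R Z \<omega> = indicator a \<omega> * Z \<omega>" for a :: "'a set" and \<omega>
      by (auto split: split_indicator)
    have "(LINT \<omega>:(\<Union>i. A i)|M. Z \<omega>) = (\<Sum>i. LINT \<omega>:A i|M. Z \<omega>)"
    proof (rule lebesgue_integral_countable_add)
      show "set_integrable M (\<Union>i. A i) Z"
        using int[of "\<Union>i. A i"] by (simp add: set_integrable_def sc)
    qed (use union in \<open>auto simp: disjoint_family_on_def\<close>)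
    then show ?case using union.IH EZ by (simp add: set_lebesgue_integral_def sc)
  qed
qed

text \<open>The hypothesis on indicators says that the conditional expectation of \<open>Z\<close> given \<open>F\<close> vanishes.\<close>

lemma (in prob_space) integral_mult_zero_of_indicators_real:
  fixes Z \<Psi> :: "'a \<Rightarrow> real"
  assumes F: "subalgebra M F" and [measurable]: "Z \<in> borel_measurable M" and \<Psi>: "\<Psi> \<in> borel_measurable F"
    and bound: "AE \<omega> in M. \<bar>Z \<omega>\<bar> \<le> c" "AE \<omega> in M. \<bar>\<Psi> \<omega>\<bar> \<le> c'"
    and zero: "\<And>A. A \<in> sets F \<Longrightarrow> (\<integral>\<omega>. indicator A \<omega> * Z \<omega> \<partial>M) = 0"
  shows "(\<integral>\<omega>. \<Psi> \<omega> * Z \<omega> \<partial>M) = 0"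
proof -
  interpret F: finite_measure_subalgebra M F using F by unfold_locales
  note [measurable] = measurable_from_subalg[OF F \<Psi>]
  have Zint: "integrable M Z" using bound by (intro integrable_const_bound[where B=c]) auto
  have "AE \<omega> in M. real_cond_exp M F Z \<omega> = 0"
  proof (rule F.real_cond_exp_charact)
    fix A assume "A \<in> sets F"
    then show "(LINT \<omega>:A|M. Z \<omega>) = (LINT \<omega>:A|M. 0)"
      using zero by (simp add: set_lebesgue_integral_def)
  qed (use Zint in auto)
  moreover have int: "integrable M (\<lambda>\<omega>. \<Psi> \<omega> * Z \<omega>)"
  proof (rule Bochner_Integration.integrable_bound[of M "\<lambda>\<omega>. c' * \<bar>Z \<omega>\<bar>"])
    show "AE \<omega> in M. norm (\<Psi> \<omega> * Z \<omega>) \<le> norm (c' * \<bar>Z \<omega>\<bar>)"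
      using bound(2)
    proof eventually_elim
      case (elim \<omega>)
      then have "\<bar>\<Psi> \<omega>\<bar> * \<bar>Z \<omega>\<bar> \<le> \<bar>c'\<bar> * \<bar>Z \<omega>\<bar>" by (intro mult_right_mono) auto
      then show ?case by (simp add: abs_mult)
    qed
    show "integrable M (\<lambda>\<omega>. c' * \<bar>Z \<omega>\<bar>)" using Zint by simp
    show "(\<lambda>\<omega>. \<Psi> \<omega> * Z \<omega>) \<in> borel_measurable M" by measurable
  qed
  moreover have "(\<integral>\<omega>. \<Psi> \<omega> * real_cond_exp M F Z \<omega> \<partial>M) = (\<integral>\<omega>. \<Psi> \<omega> * Z \<omega> \<partial>M)"
    by (rule F.real_cond_exp_intg(2)[OF int \<Psi>]) auto
  moreover have "(\<integral>\<omega>. \<Psi> \<omega> * real_cond_exp M F Z \<omega> \<partial>M) = (\<integral>\<omega>. 0 \<partial>M)"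
    using calculation(1) by (intro integral_cong_AE) (auto intro!: borel_measurable_times)
  ultimately show ?thesis by simp
qed

lemma (in prob_space) integral_mult_zero_of_indicators:
  fixes Z \<Psi> :: "'a \<Rightarrow> complex"
  assumes F: "subalgebra M F" and Z[measurable]: "Z \<in> borel_measurable M" and \<Psi>: "\<Psi> \<in> borel_measurable F"
    and bound: "AE \<omega> in M. norm (Z \<omega>) \<le> c" "AE \<omega> in M. norm (\<Psi> \<omega>) \<le> c'"
    and zero: "\<And>A. A \<in> sets F \<Longrightarrow> (\<integral>\<omega>. indicator A \<omega> * Z \<omega> \<partial>M) = 0"
  shows "(\<integral>\<omega>. \<Psi> \<omega> * Z \<omega> \<partial>M) = 0"
proof -
  note \<Psi>M[measurable] = measurable_from_subalg[OF F \<Psi>]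
  have Zint: "integrable M Z" using bound by (intro integrable_const_bound[where B=c]) auto
  have parts: "(\<integral>\<omega>. indicator A \<omega> * Re (Z \<omega>) \<partial>M) = 0" "(\<integral>\<omega>. indicator A \<omega> * Im (Z \<omega>) \<partial>M) = 0" if A: "A \<in> sets F" for A
  proof -
    have [measurable]: "A \<in> sets M" using A F by (auto simp: subalgebra_def)
    have int': "integrable M (\<lambda>\<omega>. indicator A \<omega> * Z \<omega>)"
      using bound by (intro integrable_bounded_mult[where c=c]) (simp_all add: norm_indicator_le_1)
    have r: "Re (indicator A \<omega> * Z \<omega>) = indicator A \<omega> * Re (Z \<omega>)"
       "Im (indicator A \<omega> * Z \<omega>) = indicator A \<omega> * Im (Z \<omega>)" for \<omega>
      by (auto split: split_indicator)
    show "(\<integral>\<omega>. indicator A \<omega> * Re (Z \<omega>) \<partial>M) = 0" "(\<integral>\<omega>. indicator A \<omega> * Im (Z \<omega>) \<partial>M) = 0"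
      using zero[OF A] integral_Re[OF int'] integral_Im[OF int'] unfolding r by simp_all
  qed
  have bZ: "AE \<omega> in M. \<bar>Re (Z \<omega>)\<bar> \<le> c" "AE \<omega> in M. \<bar>Im (Z \<omega>)\<bar> \<le> c"
    using bound(1) by (eventually_elim, blast intro: abs_Re_le_cmod[THEN order_trans] abs_Im_le_cmod[THEN order_trans])+
  have b\<Psi>: "AE \<omega> in M. \<bar>Re (\<Psi> \<omega>)\<bar> \<le> c'" "AE \<omega> in M. \<bar>Im (\<Psi> \<omega>)\<bar> \<le> c'"
    using bound(2) by (eventually_elim, blast intro: abs_Re_le_cmod[THEN order_trans] abs_Im_le_cmod[THEN order_trans])+
  have m: "(\<lambda>\<omega>. Re (\<Psi> \<omega>)) \<in> borel_measurable F" "(\<lambda>\<omega>. Im (\<Psi> \<omega>)) \<in> borel_measurable F"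
     "(\<lambda>\<omega>. Re (Z \<omega>)) \<in> borel_measurable M" "(\<lambda>\<omega>. Im (Z \<omega>)) \<in> borel_measurable M"
    using \<Psi> by measurable
  have z: "(\<integral>\<omega>. Re (\<Psi> \<omega>) * Re (Z \<omega>) \<partial>M) = 0" "(\<integral>\<omega>. Re (\<Psi> \<omega>) * Im (Z \<omega>) \<partial>M) = 0"
    "(\<integral>\<omega>. Im (\<Psi> \<omega>) * Re (Z \<omega>) \<partial>M) = 0" "(\<integral>\<omega>. Im (\<Psi> \<omega>) * Im (Z \<omega>) \<partial>M) = 0"
    by (rule integral_mult_zero_of_indicators_real[OF F m(3) m(1) bZ(1) b\<Psi>(1) parts(1)]
        integral_mult_zero_of_indicators_real[OF F m(4) m(1) bZ(2) b\<Psi>(1) parts(2)]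
        integral_mult_zero_of_indicators_real[OF F m(3) m(2) bZ(1) b\<Psi>(2) parts(1)]
        integral_mult_zero_of_indicators_real[OF F m(4) m(2) bZ(2) b\<Psi>(2) parts(2)]; assumption)+
  have ir: "integrable M (\<lambda>\<omega>. f (\<Psi> \<omega>) * g (Z \<omega>))" if fg: "f \<in> {Re, Im}" "g \<in> {Re, Im}" for f g
  proof (rule Bochner_Integration.integrable_bound[of M "\<lambda>\<omega>. c' * norm (Z \<omega>)"])
    show "integrable M (\<lambda>\<omega>. c' * norm (Z \<omega>))" using Zint by auto
    show "AE \<omega> in M. norm (f (\<Psi> \<omega>) * g (Z \<omega>)) \<le> norm (c' * norm (Z \<omega>))"
      using bound(2)
    proof eventually_elim
      case (elim \<omega>)
      have "\<bar>f (\<Psi> \<omega>)\<bar> \<le> norm (\<Psi> \<omega>)" "\<bar>g (Z \<omega>)\<bar> \<le> norm (Z \<omega>)" using fg abs_Re_le_cmod abs_Im_le_cmod by auto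
      moreover have "0 \<le> c'" using elim norm_ge_zero order_trans by blast
      ultimately show ?case using elim by (auto simp: abs_mult intro!: mult_mono)
    qed
    show "(\<lambda>\<omega>. f (\<Psi> \<omega>) * g (Z \<omega>)) \<in> borel_measurable M" using fg by auto
  qed
  have int: "integrable M (\<lambda>\<omega>. \<Psi> \<omega> * Z \<omega>)"
  proof (rule Bochner_Integration.integrable_bound[of M "\<lambda>\<omega>. c' * norm (Z \<omega>)"])
    show "AE \<omega> in M. norm (\<Psi> \<omega> * Z \<omega>) \<le> norm (c' * norm (Z \<omega>))"
      using bound(2)
    proof eventually_elim
      case (elim \<omega>)
      then have "norm (\<Psi> \<omega>) * norm (Z \<omega>) \<le> \<bar>c'\<bar> * norm (Z \<omega>)" by (intro mult_right_mono) auto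
      then show ?case by (simp add: norm_mult abs_mult)
    qed
    show "integrable M (\<lambda>\<omega>. c' * norm (Z \<omega>))" using Zint by simp
    show "(\<lambda>\<omega>. \<Psi> \<omega> * Z \<omega>) \<in> borel_measurable M" by measurable
  qed
  have "Re (\<integral>\<omega>. \<Psi> \<omega> * Z \<omega> \<partial>M) = 0"
    using z ir by (simp add: integral_Re[OF int, symmetric])
  moreover have "Im (\<integral>\<omega>. \<Psi> \<omega> * Z \<omega> \<partial>M) = 0"
    using z ir by (simp add: integral_Im[OF int, symmetric])
  ultimately show ?thesis by (simp add: complex_eq_iff)
qed

section \<open>Fractional Brownian motion given its past\<close>

locale fbm_driver = prob_space M for M :: "'w measure" +
  fixes H T :: real and B :: "real \<Rightarrow> 'w \<Rightarrow> real ^ 'd"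
  assumes fbm: "fractional_brownian_motion M H T B"
    and H: "0 < H" "H \<le> 1 / 2"
begin

lemma B_measurable: "t \<in> {0..T} \<Longrightarrow> B t \<in> borel_measurable M"
  using fbm by (auto simp: fractional_brownian_motion_def gaussian_process_def)

lemma gaussian_combination:
  "finite J \<Longrightarrow> J \<subseteq> {0..T} \<Longrightarrow> gaussian_rv M (\<lambda>\<omega>. \<Sum>t\<in>J. c t \<bullet> B t \<omega>)"
  using fbm by (auto simp: fractional_brownian_motion_def gaussian_process_def)

lemma component_gaussian:
  assumes "t \<in> {0..T}"
  shows "gaussian_rv M (\<lambda>\<omega>. B t \<omega> $ i)"
  using gaussian_combination[of "{t}" "\<lambda>_. axis i 1"] assms by (simp add: inner_axis')

lemma component_product_integrable:
  assumes "t \<in> {0..T}" "r \<in> {0..T}"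
  shows "integrable M (\<lambda>\<omega>. B t \<omega> $ i * B r \<omega> $ j)"
  using gaussian_rv_square_integrable[OF component_gaussian] assms
  by (intro square_integrable_mult) (auto dest: borel_measurable_integrable)

lemma combination_mean:
  assumes "finite J" "J \<subseteq> {0..T}"
  shows "(\<integral>\<omega>. (\<Sum>t\<in>J. c t \<bullet> B t \<omega>) \<partial>M) = 0"
proof -
  have c: "integrable M (\<lambda>\<omega>. B t \<omega> $ i)" "(\<integral>\<omega>. B t \<omega> $ i \<partial>M) = 0" if "t \<in> J" for t i
    using that assms fbm gaussian_rv_square_integrable(1)[OF component_gaussian]
    by (auto simp: fractional_brownian_motion_def)
  have "(\<integral>\<omega>. (\<Sum>t\<in>J. c t \<bullet> B t \<omega>) \<partial>M) = (\<integral>\<omega>. (\<Sum>t\<in>J. \<Sum>i\<in>UNIV. c t $ i * B t \<omega> $ i) \<partial>M)"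
    by (simp add: inner_vec_def)
  also have "\<dots> = (\<Sum>t\<in>J. \<Sum>i\<in>UNIV. c t $ i * (\<integral>\<omega>. B t \<omega> $ i \<partial>M))"
    using c by (simp add: Bochner_Integration.integral_sum)
  also have "\<dots> = 0" using c by simp
  finally show ?thesis .
qed

lemma combination_variance:
  assumes "finite J" "J \<subseteq> {0..T}"
  shows "(\<integral>\<omega>. (\<Sum>t\<in>J. c t \<bullet> B t \<omega>)\<^sup>2 \<partial>M)
    = (\<Sum>i\<in>UNIV. \<Sum>q\<in>J. \<Sum>r\<in>J. c q $ i * c r $ i * fbm_cov H q r)"
proof -
  have cov: "(\<integral>\<omega>. B t \<omega> $ i * B r \<omega> $ j \<partial>M) = (if i = j then fbm_cov H t r else 0)"
    if "t \<in> J" "r \<in> J" for t r i j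
  proof -
    have "t \<in> {0..T}" "r \<in> {0..T}" using that assms by auto
    then show ?thesis using fbm unfolding fractional_brownian_motion_def fbm_cov_def by blast
  qed
  have int: "integrable M (\<lambda>\<omega>. B t \<omega> $ i * B r \<omega> $ j)" if "t \<in> J" "r \<in> J" for t r i j
    using that assms by (intro component_product_integrable) auto
  have "(\<integral>\<omega>. (\<Sum>t\<in>J. c t \<bullet> B t \<omega>)\<^sup>2 \<partial>M)
    = (\<integral>\<omega>. (\<Sum>t\<in>J. \<Sum>r\<in>J. \<Sum>i\<in>UNIV. \<Sum>j\<in>UNIV. (c t $ i * c r $ j) * (B t \<omega> $ i * B r \<omega> $ j)) \<partial>M)"
    by (intro Bochner_Integration.integral_cong refl)
       (simp add: inner_vec_def power2_eq_square sum_product mult_ac)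
  also have "\<dots> = (\<Sum>t\<in>J. \<Sum>r\<in>J. \<Sum>i\<in>UNIV. \<Sum>j\<in>UNIV. (c t $ i * c r $ j) * (\<integral>\<omega>. B t \<omega> $ i * B r \<omega> $ j \<partial>M))"
    using int by (simp add: Bochner_Integration.integral_sum)
  also have "\<dots> = (\<Sum>t\<in>J. \<Sum>r\<in>J. \<Sum>i\<in>UNIV. c t $ i * c r $ i * fbm_cov H t r)"
    by (intro sum.cong refl) (simp add: cov if_distrib[of "\<lambda>x. _ * x"] cong: if_cong)
  also have "\<dots> = (\<Sum>t\<in>J. \<Sum>i\<in>UNIV. \<Sum>r\<in>J. c t $ i * c r $ i * fbm_cov H t r)"
    by (intro sum.cong refl sum.swap)
  also have "\<dots> = (\<Sum>i\<in>UNIV. \<Sum>q\<in>J. \<Sum>r\<in>J. c q $ i * c r $ i * fbm_cov H q r)"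
    by (rule sum.swap)
  finally show ?thesis .
qed

lemma combination_char:
  assumes "finite J" "J \<subseteq> {0..T}"
  shows "(\<integral>\<omega>. iexp (\<Sum>t\<in>J. c t \<bullet> B t \<omega>) \<partial>M)
    = complex_of_real (exp (- (\<integral>\<omega>. (\<Sum>t\<in>J. c t \<bullet> B t \<omega>)\<^sup>2 \<partial>M) / 2))"
  by (rule centered_gaussian_char[OF gaussian_combination combination_mean]) (use assms in auto)

text \<open>Different components of \<open>B\<close> are uncorrelated, so the scalar estimate is summed over the components.\<close>

lemma local_nondeterminism:
  assumes u: "0 \<le> u" "u < t" "t \<le> T" and J: "finite J" "J \<subseteq> {0..u}"
  shows "(norm \<xi>)\<^sup>2 * (t - u) powr (2 * H) / 2 \<le> (\<integral>\<omega>. (\<xi> \<bullet> B t \<omega> - (\<Sum>r\<in>J. c r \<bullet> B r \<omega>))\<^sup>2 \<partial>M)"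
proof -
  define c' where "c' r = (if r = t then \<xi> else - c r)" for r
  have tJ: "t \<notin> J" using J u by auto
  have "(\<Sum>r\<in>insert t J. c' r \<bullet> B r \<omega>) = \<xi> \<bullet> B t \<omega> - (\<Sum>r\<in>J. c r \<bullet> B r \<omega>)" for \<omega>
  proof -
    have "(\<Sum>r\<in>J. c' r \<bullet> B r \<omega>) = (\<Sum>r\<in>J. - (c r \<bullet> B r \<omega>))"
      using tJ by (intro sum.cong) (auto simp: c'_def)
    then show ?thesis using J tJ by (simp add: sum_negf) (simp add: c'_def)
  qed
  then have "(\<integral>\<omega>. (\<xi> \<bullet> B t \<omega> - (\<Sum>r\<in>J. c r \<bullet> B r \<omega>))\<^sup>2 \<partial>M) = (\<integral>\<omega>. (\<Sum>r\<in>insert t J. c' r \<bullet> B r \<omega>)\<^sup>2 \<partial>M)"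
    by simp
  also have "\<dots> = (\<Sum>i\<in>UNIV. \<Sum>q\<in>insert t J. \<Sum>r\<in>insert t J. c' q $ i * c' r $ i * fbm_cov H q r)"
    using J u by (intro combination_variance) auto
  also have "\<dots> \<ge> (\<Sum>i\<in>UNIV. (c' t $ i)\<^sup>2 * (t - u) powr (2 * H) / 2)"
    by (intro sum_mono fbm_cov_nondeterminism H J u)
  also have "(\<Sum>i\<in>UNIV. (c' t $ i)\<^sup>2 * (t - u) powr (2 * H) / 2) = (norm \<xi>)\<^sup>2 * (t - u) powr (2 * H) / 2"
    by (simp add: c'_def power2_norm_eq_inner inner_vec_def sum_distrib_right sum_divide_distrib flip: power2_eq_square)
  finally show ?thesis .
qed

lemma sets_augmented_filtration:
  assumes "u \<le> T"
  shows "sets (augmented_filtration M B u) =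
    sigma_sets (space M) ({B r -` A \<inter> space M | r A. 0 \<le> r \<and> r \<le> u \<and> A \<in> sets borel} \<union> null_sets M)"
proof -
  have "{B r -` A \<inter> space M | r A. 0 \<le> r \<and> r \<le> u \<and> A \<in> sets borel} \<union> null_sets M \<subseteq> Pow (space M)"
    using sets.sets_into_space by (auto dest: null_setsD2)
  then show ?thesis by (simp add: augmented_filtration_def)
qed

lemma subalgebra_augmented_filtration:
  assumes "u \<le> T"
  shows "subalgebra M (augmented_filtration M B u)"
proof -
  have "{B r -` A \<inter> space M | r A. 0 \<le> r \<and> r \<le> u \<and> A \<in> sets borel} \<union> null_sets M \<subseteq> sets M"
    using assms by (auto intro!: measurable_sets[OF B_measurable])
  then have "sets (augmented_filtration M B u) \<subseteq> sets M"
    unfolding sets_augmented_filtration[OF assms] by (rule sets.sigma_sets_subset)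
  moreover have "space (augmented_filtration M B u) = space M"
    by (simp add: augmented_filtration_def space_measure_of_conv)
  ultimately show ?thesis by (simp add: subalgebra_def)
qed

text \<open>Real-valued generators make the augmented past accessible to the Fourier argument.\<close>

lemma augmented_filtration_components:
  assumes "u \<le> T" and A: "A \<in> sets (augmented_filtration M B u)"
  shows "A \<in> sigma_sets (space M)
    ({(\<lambda>\<omega>. B (fst p) \<omega> $ snd p) -` D \<inter> space M | p D. p \<in> {0..u} \<times> UNIV \<and> D \<in> sets borel} \<union> null_sets M)"
    (is "A \<in> sigma_sets _ ?G")
proof -
  have GP: "?G \<subseteq> Pow (space M)" using sets.sets_into_space by (auto dest: null_setsD2)
  define N where "N = sigma (space M) ?G"
  have N: "sets N = sigma_sets (space M) ?G" "space N = space M" using GP by (auto simp: N_def)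
  have Bm: "B r \<in> borel_measurable N" if "0 \<le> r" "r \<le> u" for r
  proof (rule borel_measurable_euclidean_space[THEN iffD2], intro ballI)
    fix e :: "real ^ 'd" assume "e \<in> Basis"
    then obtain i where e: "e = axis i 1" by (auto simp: Basis_vec_def)
    have "(\<lambda>\<omega>. B r \<omega> $ i) \<in> borel_measurable N"
    proof (rule measurableI)
      fix D :: "real set" assume "D \<in> sets borel"
      then have "(\<lambda>\<omega>. B r \<omega> $ i) -` D \<inter> space M \<in> ?G"
        using that by (intro UnI1 CollectI exI[of _ "(r, i)"] exI[of _ D]) auto
      then show "(\<lambda>\<omega>. B r \<omega> $ i) -` D \<inter> space N \<in> sets N" unfolding N by (rule sigma_sets.Basic)
    qed auto
    then show "(\<lambda>\<omega>. B r \<omega> \<bullet> e) \<in> borel_measurable N" by (simp add: e inner_axis)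
  qed
  have "{B r -` A \<inter> space M | r A. 0 \<le> r \<and> r \<le> u \<and> A \<in> sets borel} \<union> null_sets M \<subseteq> sets N"
  proof
    fix a assume "a \<in> {B r -` A \<inter> space M | r A. 0 \<le> r \<and> r \<le> u \<and> A \<in> sets borel} \<union> null_sets M"
    then show "a \<in> sets N"
    proof
      assume "a \<in> null_sets M" then show ?thesis unfolding N by (intro sigma_sets.Basic) auto
    next
      assume "a \<in> {B r -` A \<inter> space M | r A. 0 \<le> r \<and> r \<le> u \<and> A \<in> sets borel}"
      then obtain r A where "a = B r -` A \<inter> space N" "0 \<le> r" "r \<le> u" "A \<in> sets borel" by (auto simp: N)
      then show ?thesis using measurable_sets[OF Bm] by auto
    qed
  qed
  then have "sigma_sets (space N) ({B r -` A \<inter> space M | r A. 0 \<le> r \<and> r \<le> u \<and> A \<in> sets borel} \<union> null_sets M) \<subseteq> sets N"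
    by (rule sets.sigma_sets_subset)
  then show ?thesis using A by (auto simp: sets_augmented_filtration[OF assms(1)] N)
qed

text \<open>Given the past up to \<open>u\<close>, the variable \<open>\<xi> \<bullet> B t\<close> is Gaussian with variance at least
  \<open>|\<xi>|\<^sup>2 (t - u) powr (2 H) / 2\<close>, so its conditional characteristic function is small. The conditioning is
  carried out by \<open>gaussian_projection\<close>, with the linear span \<open>V\<close> of the past: the error
  \<open>Z = iexp \<eta> - exp (- S / 2) G\<close> integrates to zero against exponentials of \<open>V\<close>, and Fourier uniqueness
  extends this to every bounded \<open>\<Psi>\<close> measurable with respect to the augmented past.\<close>

lemma conditional_char_decay:
  fixes \<Psi> :: "'w \<Rightarrow> complex"
  assumes u: "0 \<le> u" "u < t" "t \<le> T"
    and \<Psi>: "\<Psi> \<in> borel_measurable (augmented_filtration M B u)" "AE \<omega> in M. norm (\<Psi> \<omega>) \<le> 1"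
  shows "norm (\<integral>\<omega>. \<Psi> \<omega> * iexp (\<xi> \<bullet> B t \<omega>) \<partial>M) \<le> exp (- ((norm \<xi>)\<^sup>2 * (t - u) powr (2 * H) / 4))"
proof -
  define V where "V = {\<lambda>\<omega>. \<Sum>r\<in>J. c r \<bullet> B r \<omega> | J c. finite J \<and> J \<subseteq> {0..u}}"
  define \<eta> where "\<eta> \<omega> = \<xi> \<bullet> B t \<omega>" for \<omega>
  define v where "v = (norm \<xi>)\<^sup>2 * (t - u) powr (2 * H) / 2"
  have uT: "u \<le> T" using u by simp
  have tT: "t \<in> {0..T}" using u by simp
  have sub: "subalgebra M (augmented_filtration M B u)" by (rule subalgebra_augmented_filtration[OF uT])
  note [measurable] = B_measurable[OF tT] measurable_from_subalg[OF sub \<Psi>(1)]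
  have \<eta>_meas[measurable]: "\<eta> \<in> borel_measurable M" unfolding \<eta>_def[abs_def] by measurable
  have \<eta>_sum: "\<eta> \<omega> + (\<Sum>r\<in>J. c r \<bullet> B r \<omega>) = (\<Sum>r\<in>insert t J. (c(t := \<xi>)) r \<bullet> B r \<omega>)"
    if "finite J" "J \<subseteq> {0..u}" for J c \<omega>
  proof -
    have "t \<notin> J" using that u by auto
    then have "(\<Sum>r\<in>J. (c(t := \<xi>)) r \<bullet> B r \<omega>) = (\<Sum>r\<in>J. c r \<bullet> B r \<omega>)" by (intro sum.cong) auto
    then show ?thesis using \<open>t \<notin> J\<close> that(1) by (simp add: \<eta>_def)
  qed
  have VE: "\<exists>J c. f = (\<lambda>\<omega>. \<Sum>r\<in>J. c r \<bullet> B r \<omega>) \<and> finite J \<and> J \<subseteq> {0..u} \<and> J \<subseteq> {0..T}" if "f \<in> V" for f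
    using that uT unfolding V_def by fastforce
  obtain S G where S: "v \<le> S" and G[measurable]: "G \<in> borel_measurable M" and G1: "AE \<omega> in M. norm (G \<omega>) \<le> 1"
    and zero: "\<And>f. f \<in> V \<Longrightarrow> (\<integral>\<omega>. iexp (f \<omega>) * (iexp (\<eta> \<omega>) - complex_of_real (exp (- S / 2)) * G \<omega>) \<partial>M) = 0"
  proof (rule gaussian_projection[of V \<eta> v])
    show "(\<lambda>\<omega>. 0) \<in> V" unfolding V_def by (auto intro!: exI[of _ "{}"])
  next
    fix f g assume "f \<in> V" "g \<in> V"
    then obtain J c J' c' where fg: "f = (\<lambda>\<omega>. \<Sum>r\<in>J. c r \<bullet> B r \<omega>)" "finite J" "J \<subseteq> {0..u}"
      "g = (\<lambda>\<omega>. \<Sum>r\<in>J'. c' r \<bullet> B r \<omega>)" "finite J'" "J' \<subseteq> {0..u}"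
      unfolding V_def by blast
    define d where "d r = (if r \<in> J then c r else 0) + (if r \<in> J' then c' r else 0)" for r
    have "f \<omega> + g \<omega> = (\<Sum>r\<in>J \<union> J'. d r \<bullet> B r \<omega>)" for \<omega>
    proof -
      have "f \<omega> = (\<Sum>r\<in>J \<union> J'. (if r \<in> J then c r else 0) \<bullet> B r \<omega>)"
        unfolding fg using fg by (intro sum.mono_neutral_cong_left) auto
      moreover have "g \<omega> = (\<Sum>r\<in>J \<union> J'. (if r \<in> J' then c' r else 0) \<bullet> B r \<omega>)"
        unfolding fg using fg by (intro sum.mono_neutral_cong_left) auto
      ultimately show ?thesis by (simp add: d_def inner_add_left sum.distrib)
    qed
    then show "(\<lambda>\<omega>. f \<omega> + g \<omega>) \<in> V" unfolding V_def using fg by (intro CollectI exI[of _ "J \<union> J'"] exI[of _ d]) auto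
  next
    fix f a assume "f \<in> V"
    then obtain J c where f: "f = (\<lambda>\<omega>. \<Sum>r\<in>J. c r \<bullet> B r \<omega>)" "finite J" "J \<subseteq> {0..u}" unfolding V_def by blast
    have "(\<lambda>\<omega>. a * f \<omega>) = (\<lambda>\<omega>. \<Sum>r\<in>J. (a *\<^sub>R c r) \<bullet> B r \<omega>)"
      by (simp add: f sum_distrib_left)
    then show "(\<lambda>\<omega>. a * f \<omega>) \<in> V" unfolding V_def using f by (intro CollectI exI[of _ J] exI[of _ "\<lambda>r. a *\<^sub>R c r"]) auto
  next
    fix f assume "f \<in> V"
    then obtain J c where f: "f = (\<lambda>\<omega>. \<Sum>r\<in>J. c r \<bullet> B r \<omega>)" "finite J" "J \<subseteq> {0..u}" "J \<subseteq> {0..T}" using VE by blast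
    note g = gaussian_rv_square_integrable[OF gaussian_combination[OF f(2,4), of c]]
    show "f \<in> borel_measurable M" "integrable M (\<lambda>\<omega>. (f \<omega>)\<^sup>2)" using g f(1) by (auto dest: borel_measurable_integrable)
    show "(\<integral>\<omega>. iexp (f \<omega>) \<partial>M) = complex_of_real (exp (- (\<integral>\<omega>. (f \<omega>)\<^sup>2 \<partial>M) / 2))"
      unfolding f(1) by (rule combination_char[OF f(2,4)])
    show "(\<integral>\<omega>. iexp (\<eta> \<omega> + f \<omega>) \<partial>M) = complex_of_real (exp (- (\<integral>\<omega>. (\<eta> \<omega> + f \<omega>)\<^sup>2 \<partial>M) / 2))"
      unfolding f(1) \<eta>_sum[OF f(2,3)] by (rule combination_char) (use f tT in auto)
    show "v \<le> (\<integral>\<omega>. (\<eta> \<omega> - f \<omega>)\<^sup>2 \<partial>M)"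
      unfolding f(1) v_def \<eta>_def by (rule local_nondeterminism[OF u f(2,3)])
  next
    show "\<eta> \<in> borel_measurable M" by fact
    show "integrable M (\<lambda>\<omega>. (\<eta> \<omega>)\<^sup>2)"
      using gaussian_rv_square_integrable(2)[OF gaussian_combination[of "{t}" "\<lambda>_. \<xi>"]] tT by (simp add: \<eta>_def)
  qed (rule that; (assumption | simp))
  define Z where "Z \<omega> = iexp (\<eta> \<omega>) - complex_of_real (exp (- S / 2)) * G \<omega>" for \<omega>
  have Z_meas[measurable]: "Z \<in> borel_measurable M" unfolding Z_def[abs_def] by measurable
  have Zb: "AE \<omega> in M. norm (Z \<omega>) \<le> 1 + exp (- S / 2)"
    using G1
  proof eventually_elim
    case (elim \<omega>)
    have "norm (Z \<omega>) \<le> norm (iexp (\<eta> \<omega>)) + norm (complex_of_real (exp (- S / 2)) * G \<omega>)"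
      unfolding Z_def by (rule norm_triangle_ineq4)
    also have "\<dots> \<le> 1 + exp (- S / 2)" using elim by (simp add: norm_mult)
    finally show ?case .
  qed
  have "(\<integral>\<omega>. \<Psi> \<omega> * Z \<omega> \<partial>M) = 0"
  proof (rule integral_mult_zero_of_indicators[OF sub Z_meas \<Psi>(1) Zb \<Psi>(2)])
    fix A assume "A \<in> sets (augmented_filtration M B u)"
    note A = augmented_filtration_components[OF uT this]
    show "(\<integral>\<omega>. indicator A \<omega> * Z \<omega> \<partial>M) = 0"
    proof (rule fourier_weight_zero_sigma[OF _ Z_meas Zb _ A])
      fix p :: "real \<times> 'd" assume "p \<in> {0..u} \<times> UNIV"
      then have "gaussian_rv M (\<lambda>\<omega>. B (fst p) \<omega> $ snd p)" using uT by (intro component_gaussian) auto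
      then show "(\<lambda>\<omega>. B (fst p) \<omega> $ snd p) \<in> borel_measurable M" by (simp add: gaussian_rv_def)
    next
      fix J :: "(real \<times> 'd) set" and \<theta> :: "real \<times> 'd \<Rightarrow> real"
      assume J: "finite J" "J \<subseteq> {0..u} \<times> UNIV"
      \<comment> \<open>The indices in \<open>J\<close> are regrouped by time, to recognise an element of \<open>V\<close>.\<close>
      define c where "c r = (\<chi> i. if (r, i) \<in> J then \<theta> (r, i) else 0)" for r
      have "(\<Sum>p\<in>J. \<theta> p * B (fst p) \<omega> $ snd p) = (\<Sum>r\<in>fst ` J. c r \<bullet> B r \<omega>)" for \<omega>
      proof -
        have "(\<Sum>p\<in>J. \<theta> p * B (fst p) \<omega> $ snd p)
           = (\<Sum>p\<in>fst ` J \<times> UNIV. if p \<in> J then \<theta> p * B (fst p) \<omega> $ snd p else 0)"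
          using J by (intro sum.mono_neutral_cong_left) force+
        also have "\<dots> = (\<Sum>r\<in>fst ` J. \<Sum>i\<in>UNIV. if (r, i) \<in> J then \<theta> (r, i) * B r \<omega> $ i else 0)"
          by (auto simp: sum.cartesian_product split_beta intro!: sum.cong)
        also have "\<dots> = (\<Sum>r\<in>fst ` J. c r \<bullet> B r \<omega>)"
          by (auto simp: c_def inner_vec_def intro!: sum.cong)
        finally show ?thesis .
      qed
      moreover have inV: "(\<lambda>\<omega>. \<Sum>r\<in>fst ` J. c r \<bullet> B r \<omega>) \<in> V"
        unfolding V_def using J by (intro CollectI exI[of _ "fst ` J"] exI[of _ c]) auto
      ultimately show "(\<integral>\<omega>. iexp (\<Sum>p\<in>J. \<theta> p * B (fst p) \<omega> $ snd p) * Z \<omega> \<partial>M) = 0"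
        using zero[OF inV] by (simp only: Z_def)
    qed
  qed
  moreover have i1: "integrable M (\<lambda>\<omega>. \<Psi> \<omega> * iexp (\<eta> \<omega>))"
    using \<Psi>(2) by (intro integrable_bounded_mult[where c=1]) auto
  moreover have i2: "integrable M (\<lambda>\<omega>. \<Psi> \<omega> * G \<omega>)"
    using \<Psi>(2) G1 by (intro integrable_bounded_mult[where c=1]) auto
  moreover have "(\<integral>\<omega>. \<Psi> \<omega> * Z \<omega> \<partial>M) = (\<integral>\<omega>. \<Psi> \<omega> * iexp (\<eta> \<omega>) - complex_of_real (exp (- S / 2)) * (\<Psi> \<omega> * G \<omega>) \<partial>M)"
    by (intro Bochner_Integration.integral_cong refl) (simp add: Z_def algebra_simps)
  ultimately have "(\<integral>\<omega>. \<Psi> \<omega> * iexp (\<eta> \<omega>) \<partial>M) = complex_of_real (exp (- S / 2)) * (\<integral>\<omega>. \<Psi> \<omega> * G \<omega> \<partial>M)"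
    by simp
  then have "norm (\<integral>\<omega>. \<Psi> \<omega> * iexp (\<eta> \<omega>) \<partial>M) = exp (- S / 2) * norm (\<integral>\<omega>. \<Psi> \<omega> * G \<omega> \<partial>M)"
    by (simp add: norm_mult)
  also have "\<dots> \<le> exp (- S / 2) * 1"
  proof (rule mult_left_mono)
    have "norm (\<integral>\<omega>. \<Psi> \<omega> * G \<omega> \<partial>M) \<le> (\<integral>\<omega>. norm (\<Psi> \<omega> * G \<omega>) \<partial>M)" by (rule integral_norm_bound)
    also have "\<dots> \<le> (\<integral>\<omega>. 1 \<partial>M)"
    proof (rule integral_mono_AE)
      show "AE \<omega> in M. norm (\<Psi> \<omega> * G \<omega>) \<le> 1"
        using \<Psi>(2) G1 by eventually_elim (auto simp: norm_mult mult_le_one)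
    qed (use i2 in auto)
    finally show "norm (\<integral>\<omega>. \<Psi> \<omega> * G \<omega> \<partial>M) \<le> 1" by (simp add: prob_space)
  qed simp
  also have "\<dots> \<le> exp (- (v / 2))" using S by simp
  finally show ?thesis by (simp add: v_def \<eta>_def)
qed

end

section \<open>Bounded densities from decaying characteristic functions\<close>

lemma norm_lebesgue_integral_diff_le:
  fixes f :: "real \<Rightarrow> 'b::euclidean_space"
  assumes f: "integrable (lebesgue_on {s..t}) f" and le: "s \<le> u" "u \<le> t" and C: "\<And>r. r \<in> {u..t} \<Longrightarrow> norm (f r) \<le> C" "0 \<le> C"
  shows "norm ((\<integral>r. f r \<partial>lebesgue_on {s..t}) - (\<integral>r. f r \<partial>lebesgue_on {s..u})) \<le> C * (t - u)"
proof -
  have f1: "f integrable_on {s..t}" using f by (rule integrable_on_lebesgue_on) auto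
  have fu: "integrable (lebesgue_on {s..u}) f"
  proof -
    have "set_integrable lebesgue {s..t} f"
      using f by (simp add: set_integrable_def integrable_restrict_space)
    then have "set_integrable lebesgue {s..u} f"
      by (rule set_integrable_subset) (use le in auto)
    then show ?thesis by (simp add: set_integrable_def integrable_restrict_space)
  qed
  have f2: "f integrable_on {u..t}" using f1 by (rule integrable_subinterval_real) (use le in auto)
  have eq: "(\<integral>r. f r \<partial>lebesgue_on {s..t}) = integral {s..t} f" "(\<integral>r. f r \<partial>lebesgue_on {s..u}) = integral {s..u} f"
    by (rule lebesgue_integral_eq_integral[OF f] lebesgue_integral_eq_integral[OF fu]; simp)+
  have "integral {s..u} f + integral {u..t} f = integral {s..t} f"
    using le f1 by (intro Henstock_Kurzweil_Integration.integral_combine) auto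
  moreover have "norm (integral {u..t} f) \<le> C * measure lborel (cbox u t)"
    using f2 C by (intro has_integral_bound[of C f _ u t]) (auto simp: has_integral_integral)
  ultimately have "norm (integral {s..t} f - integral {s..u} f) \<le> C * measure lborel (cbox u t)"
    by (metis add_diff_cancel_left')
  then show ?thesis using le by (simp add: eq)
qed

lemma exp_minus_le_inverse_power:
  fixes z :: real
  assumes "0 < z"
  shows "exp (- z) \<le> (real k / z) ^ k"
proof (cases "k = 0")
  case True
  then show ?thesis using assms by simp
next
  case False
  have "(z / real k) ^ k \<le> (1 + z / real k) ^ k" using assms by (intro power_mono) auto
  also have "\<dots> \<le> exp z" using False assms by (intro exp_ge_one_plus_x_over_n_power_n) auto
  finally have "(z / real k) ^ k \<le> exp z" .
  then have "1 / exp z \<le> 1 / (z / real k) ^ k"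
    using assms False by (intro divide_left_mono) auto
  then show ?thesis by (simp add: exp_minus power_divide divide_inverse power_mult_distrib power_inverse mult.commute)
qed

lemma norm_component_product_le:
  fixes \<xi> :: "real ^ 'd"
  shows "(\<Prod>i\<in>UNIV. 1 + (\<xi> $ i)\<^sup>2) \<le> (1 + (norm \<xi>)\<^sup>2) ^ CARD('d)"
proof -
  have "(\<Prod>i\<in>UNIV. 1 + (\<xi> $ i)\<^sup>2) \<le> (\<Prod>i\<in>(UNIV::'d set). 1 + (norm \<xi>)\<^sup>2)"
  proof (intro prod_mono conjI)
    fix i
    have "\<bar>\<xi> $ i\<bar> \<le> norm \<xi>" by (rule component_le_norm_cart)
    then have "\<bar>\<xi> $ i\<bar>\<^sup>2 \<le> (norm \<xi>)\<^sup>2" by (intro power_mono) auto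
    then show "1 + (\<xi> $ i)\<^sup>2 \<le> 1 + (norm \<xi>)\<^sup>2" by simp
  qed (auto intro: add_nonneg_nonneg)
  then show ?thesis by simp
qed

text \<open>The gap \<open>t - u\<close> is free, and it is chosen as \<open>e = |\<xi>| powr (- (2 d + 2))\<close>: the second term is then of
  order \<open>|\<xi>| powr (- (2 d + 1))\<close>, and the exponent in the first one is a positive power
  \<open>|\<xi>| powr \<gamma>\<close>. The constant \<open>Q\<close> is found before \<open>\<phi>\<close>, which makes the bound uniform over all
  approximating solutions.\<close>

lemma char_decay_optimised:
  fixes H C s t :: real
  assumes H: "0 < H" "H < 1 / (2 * (real CARD('d) + 3))" and C: "0 \<le> C" and st: "s < t"
  shows "\<exists>Q\<ge>0. \<forall>\<phi> :: real ^ 'd \<Rightarrow> real.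
     (\<forall>\<xi>. \<phi> \<xi> \<le> 1) \<longrightarrow>
     (\<forall>\<xi> u. s \<le> u \<and> u < t \<longrightarrow> \<phi> \<xi> \<le> exp (- ((norm \<xi>)\<^sup>2 * (t - u) powr (2 * H) / 4)) + norm \<xi> * (C * (t - u))) \<longrightarrow>
     (\<forall>\<xi>. \<phi> \<xi> * (\<Prod>i\<in>UNIV. 1 + (\<xi> $ i)\<^sup>2) \<le> Q)"
proof -
  define d where "d = CARD('d)"
  define \<gamma> where "\<gamma> = 2 - 2 * H * (2 * real d + 2)"
  \<comment> \<open>For \<open>|\<xi>| \<ge> R\<close> the gap \<open>e\<close> fits into \<open>[s, t]\<close>.\<close>
  define R where "R = max 1 (1 / (t - s))"
  have "H * (2 * (real d + 3)) < 1" using H by (simp add: d_def field_simps)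
  then have \<gamma>: "0 < \<gamma>" using H by (simp add: \<gamma>_def algebra_simps)
  obtain k :: nat where k: "2 * real d \<le> real k * \<gamma>" 
    using reals_Archimedean3[OF \<gamma>] by (metis less_le_not_le linear)
  define Q1 where "Q1 = (4 * real k) ^ k"
  define Q where "Q = (1 + R\<^sup>2) ^ d + (Q1 + C) * 2 ^ d"
  have R1: "1 \<le> R" by (simp add: R_def)
  have Q10: "0 \<le> Q1" by (simp add: Q1_def)
  have Q0: "0 \<le> Q" using C Q10 R1 by (simp add: Q_def)
  show ?thesis
  proof (intro exI[of _ Q] conjI Q0 allI impI)
    fix \<phi> :: "real ^ 'd \<Rightarrow> real" and \<xi> :: "real ^ 'd"
    assume 1: "\<forall>\<xi>. \<phi> \<xi> \<le> 1"
      and dec: "\<forall>\<xi> u. s \<le> u \<and> u < t \<longrightarrow> \<phi> \<xi> \<le> exp (- ((norm \<xi>)\<^sup>2 * (t - u) powr (2 * H) / 4)) + norm \<xi> * (C * (t - u))"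
    define y where "y = norm \<xi>"
    define P where "P = (\<Prod>i\<in>UNIV. 1 + (\<xi> $ i)\<^sup>2)"
    have y0: "0 \<le> y" by (simp add: y_def)
    have P0: "0 \<le> P" unfolding P_def by (intro prod_nonneg) (auto intro: add_nonneg_nonneg)
    have Py: "P \<le> (1 + y\<^sup>2) ^ d" unfolding P_def y_def d_def by (rule norm_component_product_le)
    show "\<phi> \<xi> * (\<Prod>i\<in>UNIV. 1 + (\<xi> $ i)\<^sup>2) \<le> Q"
    proof (cases "y < R")
      case True
      have "\<phi> \<xi> * P \<le> 1 * P" using 1 P0 by (intro mult_right_mono) auto
      also have "\<dots> \<le> (1 + y\<^sup>2) ^ d" using Py by simp
      also have "\<dots> \<le> (1 + R\<^sup>2) ^ d" using True y0 by (intro power_mono add_left_mono) auto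
      also have "\<dots> \<le> Q" using Q10 C by (simp add: Q_def)
      finally show ?thesis by (simp add: P_def)
    next
      case False
      then have yR: "R \<le> y" and y1: "1 \<le> y" using R1 by auto
      define e where "e = (1 / y) ^ (2 * d + 2)"
      have e_pos: "0 < e" using y1 by (simp add: e_def)
      have "e \<le> (1 / y) ^ 1" unfolding e_def using y1 by (intro power_decreasing) auto
      also have "\<dots> \<le> 1 / R" using yR R1 by (simp add: frac_le)
      also have "\<dots> \<le> t - s" using st by (simp add: R_def field_simps max_def)
      finally have e_le: "e \<le> t - s" .
      have "\<phi> \<xi> \<le> exp (- (y\<^sup>2 * e powr (2 * H) / 4)) + y * (C * e)"
        using dec[rule_format, of "t - e" \<xi>] e_le e_pos by (simp add: y_def)
      also have "y\<^sup>2 * e powr (2 * H) = y powr \<gamma>"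
      proof -
        have "e = y powr (- (2 * real d + 2))"
        proof -
          have "y powr (- (2 * real d + 2)) = inverse (y powr (2 * real d + 2))" by (rule powr_minus)
          moreover have "y powr (2 * real d + 2) = y ^ (2 * d + 2)"
            using powr_realpow[of y "2 * d + 2"] y1 by (simp add: add.commute)
          ultimately have pw: "y powr (- (2 * real d + 2)) = inverse (y ^ (2 * d + 2))" by simp
          show ?thesis unfolding pw e_def by (simp only: power_one_over inverse_eq_divide)
        qed
        then have "e powr (2 * H) = y powr (- (2 * real d + 2) * (2 * H))" by (simp add: powr_powr)
        moreover have "y\<^sup>2 = y powr 2" using y1 by (simp add: powr_numeral)
        ultimately have "y\<^sup>2 * e powr (2 * H) = y powr (2 + - (2 * real d + 2) * (2 * H))" by (simp add: powr_add)
        then show ?thesis by (simp add: \<gamma>_def algebra_simps)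
      qed
      also have "exp (- (y powr \<gamma> / 4)) \<le> Q1 * (1 / y) ^ (2 * d)"
      proof -
        have "exp (- (y powr \<gamma> / 4)) \<le> (real k / (y powr \<gamma> / 4)) ^ k"
          using y1 by (intro exp_minus_le_inverse_power) auto
        also have "\<dots> = Q1 * (1 / (y powr \<gamma>) ^ k)"
          by (simp add: Q1_def power_divide power_mult_distrib field_simps)
        also have "(y powr \<gamma>) ^ k = y powr (real k * \<gamma>)"
          using y1 by (simp add: powr_powr powr_realpow[symmetric] mult.commute)
        also have "Q1 * (1 / y powr (real k * \<gamma>)) \<le> Q1 * (1 / y powr (2 * real d))"
          using k y1 Q10 by (intro mult_left_mono divide_left_mono powr_mono) auto
        also have "y powr (2 * real d) = y ^ (2 * d)"
          using y1 powr_realpow[of y "2 * d"] by simp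
        finally show ?thesis by (simp add: power_divide)
      qed
      also have "y * (C * e) \<le> C * (1 / y) ^ (2 * d)"
      proof -
        have "y * e = (1 / y) ^ (2 * d) * (1 / y)" using y1 by (simp add: e_def power_add power2_eq_square field_simps)
        also have "\<dots> \<le> (1 / y) ^ (2 * d) * 1" using y1 by (intro mult_left_mono) auto
        finally show ?thesis using C mult_left_mono[of "y * e" "(1 / y) ^ (2 * d)" C] by (simp add: mult_ac)
      qed
      finally have "\<phi> \<xi> \<le> (Q1 + C) * (1 / y) ^ (2 * d)" by (simp add: algebra_simps)
      then have "\<phi> \<xi> * P \<le> (Q1 + C) * (1 / y) ^ (2 * d) * P" using P0 by (rule mult_right_mono)
      also have "\<dots> \<le> (Q1 + C) * (1 / y) ^ (2 * d) * (2 ^ d * y ^ (2 * d))"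
      proof (rule mult_left_mono)
        have "P \<le> (2 * y\<^sup>2) ^ d"
        proof (rule order_trans[OF Py])
          have "1 \<le> y\<^sup>2" using y1 by simp
          then show "(1 + y\<^sup>2) ^ d \<le> (2 * y\<^sup>2) ^ d" by (intro power_mono) auto
        qed
        then show "P \<le> 2 ^ d * y ^ (2 * d)" by (simp add: power_mult_distrib power_mult)
      qed (use Q10 C y1 in auto)
      also have "\<dots> = (Q1 + C) * 2 ^ d" using y1 by (simp add: power_divide)
      also have "\<dots> \<le> Q" by (simp add: Q_def)
      finally show ?thesis by (simp add: P_def)
    qed
  qed
qed

lemma integrable_inverse_1_plus_square_UNIV: "integrable lborel (\<lambda>x::real. inverse (1 + x\<^sup>2))"
  using integrable_inverse_1_plus_square by (simp add: set_integrable_def)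

text \<open>The price per coordinate and unit of length for dominating the indicator of an interval by a Gaussian
  and integrating \<open>1 / (1 + x\<^sup>2)\<close>; the division by \<open>2\<close> accounts for side lengths \<open>2 \<rho>\<close>.\<close>

definition cube_const :: real where
  "cube_const = exp (1 / 2) * (\<integral>x. inverse (1 + x\<^sup>2) \<partial>lborel) / 2"

lemma std_normal_inverse_square_bound:
  assumes "0 < \<rho>"
  shows "integrable std_normal_distribution (\<lambda>\<theta>. inverse (1 + (\<theta> / \<rho>)\<^sup>2))"
    and "(\<integral>\<theta>. inverse (1 + (\<theta> / \<rho>)\<^sup>2) \<partial>std_normal_distribution) \<le> \<rho> * (\<integral>x. inverse (1 + x\<^sup>2) \<partial>lborel)"
proof -
  have sc: "integrable lborel (\<lambda>\<theta>. inverse (1 + (\<theta> / \<rho>)\<^sup>2))"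
    using lborel_integrable_real_affine[OF integrable_inverse_1_plus_square_UNIV, of "1 / \<rho>" 0] assms by simp
  have val: "(\<integral>\<theta>. inverse (1 + (\<theta> / \<rho>)\<^sup>2) \<partial>lborel) = \<rho> * (\<integral>x. inverse (1 + x\<^sup>2) \<partial>lborel)"
    using lborel_integral_real_affine[of "1 / \<rho>" "\<lambda>x. inverse (1 + x\<^sup>2)" 0] assms by simp
  have le1: "std_normal_density x \<le> 1" for x
  proof -
    have "1 \<le> sqrt (2 * pi)" using pi_gt3 by simp
    then have "1 / sqrt (2 * pi) \<le> 1" by simp
    moreover have "exp (- x\<^sup>2 / 2) \<le> 1" by simp
    ultimately have "(1 / sqrt (2 * pi)) * exp (- x\<^sup>2 / 2) \<le> 1 * 1" by (intro mult_mono) auto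
    then show ?thesis by (simp add: std_normal_density_def)
  qed
  have pos: "0 \<le> inverse (1 + (\<theta> / \<rho>)\<^sup>2)" for \<theta> by (simp add: add_nonneg_nonneg)
  have le: "std_normal_density \<theta> * inverse (1 + (\<theta> / \<rho>)\<^sup>2) \<le> inverse (1 + (\<theta> / \<rho>)\<^sup>2)" for \<theta>
    using mult_right_mono[OF le1 pos, of \<theta> \<theta>] by simp
  have dint: "integrable lborel (\<lambda>\<theta>. std_normal_density \<theta> * inverse (1 + (\<theta> / \<rho>)\<^sup>2))"
    by (rule Bochner_Integration.integrable_bound[OF sc]) (use le pos in \<open>auto simp: abs_mult intro!: AE_I2\<close>)
  show "integrable std_normal_distribution (\<lambda>\<theta>. inverse (1 + (\<theta> / \<rho>)\<^sup>2))"
    using dint by (subst integrable_density) auto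
  have "(\<integral>\<theta>. inverse (1 + (\<theta> / \<rho>)\<^sup>2) \<partial>std_normal_distribution) = (\<integral>\<theta>. std_normal_density \<theta> * inverse (1 + (\<theta> / \<rho>)\<^sup>2) \<partial>lborel)"
    by (subst integral_density) auto
  also have "\<dots> \<le> (\<integral>\<theta>. inverse (1 + (\<theta> / \<rho>)\<^sup>2) \<partial>lborel)" using dint sc le by (intro integral_mono) auto
  finally show "(\<integral>\<theta>. inverse (1 + (\<theta> / \<rho>)\<^sup>2) \<partial>std_normal_distribution) \<le> \<rho> * (\<integral>x. inverse (1 + x\<^sup>2) \<partial>lborel)"
    using val by simp
qed

text \<open>The indicator of the cube is at most \<open>exp (1/2) ^ d\<close> times a Gaussian in \<open>(X - x) / \<rho>\<close>, and a Gaussian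
  is itself the characteristic function of a standard normal vector \<open>\<theta>\<close>. By Fubini its expectation is the
  average over \<open>\<theta>\<close> of the characteristic function of \<open>X\<close> at \<open>\<theta> / \<rho>\<close>, and rescaling each coordinate
  costs a factor \<open>\<rho>\<close>.\<close>

lemma (in prob_space) cube_probability_le:
  fixes X :: "'a \<Rightarrow> real ^ 'd"
  assumes X[measurable]: "X \<in> borel_measurable M"
    and Q: "\<And>\<xi>. norm (\<integral>\<omega>. iexp (\<xi> \<bullet> X \<omega>) \<partial>M) * (\<Prod>i\<in>UNIV. 1 + (\<xi> $ i)\<^sup>2) \<le> Q" and \<rho>: "0 < \<rho>"
  shows "measure M {\<omega>\<in>space M. \<forall>i. \<bar>X \<omega> $ i - x $ i\<bar> \<le> \<rho>} \<le> Q * (cube_const * (2 * \<rho>)) ^ CARD('d)"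
proof -
  let ?S = "std_normal_distribution"
  interpret S: real_distribution ?S by (rule real_dist_normal_dist)
  interpret SP: product_prob_space "\<lambda>_::'d. ?S" UNIV by unfold_locales
  define N where "N = Pi\<^sub>M (UNIV :: 'd set) (\<lambda>_. ?S)"
  interpret N: prob_space N unfolding N_def by (rule SP.P.prob_space_axioms)
  interpret MN: pair_prob_space M N by unfold_locales
  have sN: "sets N = sets (Pi\<^sub>M (UNIV :: 'd set) (\<lambda>_. borel))" unfolding N_def by (intro sets_PiM_cong) auto
  have [measurable]: "(\<lambda>\<theta>. \<theta> i) \<in> borel_measurable N" for i
    unfolding measurable_cong_sets[OF sN refl] by (rule measurable_component_singleton) simp
  have [measurable]: "(\<lambda>\<omega>. X \<omega> $ i) \<in> borel_measurable M" for i
    using borel_measurable_inner[OF X, of "\<lambda>_. axis i 1"] by (simp add: inner_axis)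
  define y where "y \<omega> i = (X \<omega> $ i - x $ i) / \<rho>" for \<omega> i
  have [measurable]: "(\<lambda>\<omega>. y \<omega> i) \<in> borel_measurable M" for i unfolding y_def by measurable
  let ?A = "{\<omega>\<in>space M. \<forall>i. \<bar>X \<omega> $ i - x $ i\<bar> \<le> \<rho>}"
  have A_meas: "?A \<in> sets M" by measurable
  have gauss: "complex_of_real (\<Prod>i\<in>UNIV. exp (- (y \<omega> i)\<^sup>2 / 2)) = (\<integral>\<theta>. iexp (\<Sum>i\<in>UNIV. \<theta> i * y \<omega> i) \<partial>N)" for \<omega>
  proof -
    have "(\<integral>\<theta>. iexp (\<Sum>i\<in>UNIV. \<theta> i * y \<omega> i) \<partial>N) = (\<integral>\<theta>. (\<Prod>i\<in>UNIV. iexp (y \<omega> i * \<theta> i)) \<partial>N)"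
      by (simp add: exp_sum[symmetric] sum_distrib_left mult_ac)
    also have "\<dots> = (\<Prod>i\<in>UNIV. \<integral>\<theta>. iexp (y \<omega> i * \<theta>) \<partial>?S)"
      unfolding N_def by (rule SP.product_integral_prod) (auto intro!: S.integrable_const_bound[where B=1])
    also have "\<dots> = (\<Prod>i\<in>UNIV. char ?S (y \<omega> i))" by (simp add: char_def)
    finally show ?thesis by (simp add: char_std_normal_distribution)
  qed
  define g where "g \<omega> = (\<Prod>i\<in>UNIV. exp (- (y \<omega> i)\<^sup>2 / 2))" for \<omega>
  have g01: "0 \<le> g \<omega>" "g \<omega> \<le> 1" for \<omega> unfolding g_def by (auto intro!: prod_nonneg prod_le_1)
  have g_meas[measurable]: "g \<in> borel_measurable M" unfolding g_def by measurable
  have gint: "integrable M g" using g01 by (intro integrable_const_bound[where B=1]) auto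
  have ind: "indicator ?A \<omega> \<le> exp (1/2) ^ CARD('d) * g \<omega>" if "\<omega> \<in> space M" for \<omega>
  proof (cases "\<omega> \<in> ?A")
    case False then show ?thesis using g01 by simp
  next
    case True
    have "(1::real) \<le> (\<Prod>i\<in>(UNIV::'d set). exp (1/2) * exp (- (y \<omega> i)\<^sup>2 / 2))"
    proof (intro prod_ge_1)
      fix i
      have "\<bar>y \<omega> i\<bar> \<le> 1" using True \<rho> by (simp add: y_def)
      then have "(y \<omega> i)\<^sup>2 \<le> 1" by (simp add: abs_square_le_1)
      then show "1 \<le> exp (1/2) * exp (- (y \<omega> i)\<^sup>2 / 2)" by (simp flip: exp_add)
    qed
    then show ?thesis using True by (simp add: g_def prod.distrib)
  qed
  have "complex_of_real (\<integral>\<omega>. g \<omega> \<partial>M) = (\<integral>\<omega>. (\<integral>\<theta>. iexp (\<Sum>i\<in>UNIV. \<theta> i * y \<omega> i) \<partial>N) \<partial>M)"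
    unfolding gauss[symmetric] g_def[symmetric] by simp
  also have "\<dots> = (\<integral>\<theta>. (\<integral>\<omega>. iexp (\<Sum>i\<in>UNIV. \<theta> i * y \<omega> i) \<partial>M) \<partial>N)"
    by (intro MN.Fubini_integral[symmetric] MN.integrable_const_bound[where B=1]) (auto simp: split_beta)
  finally have eq: "complex_of_real (\<integral>\<omega>. g \<omega> \<partial>M) = (\<integral>\<theta>. (\<integral>\<omega>. iexp (\<Sum>i\<in>UNIV. \<theta> i * y \<omega> i) \<partial>M) \<partial>N)" .
  have inner: "norm (\<integral>\<omega>. iexp (\<Sum>i\<in>UNIV. \<theta> i * y \<omega> i) \<partial>M) \<le> Q * (\<Prod>i\<in>UNIV. inverse (1 + (\<theta> i / \<rho>)\<^sup>2))" for \<theta>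
  proof -
    define \<xi> :: "real ^ 'd" where "\<xi> = (\<chi> i. \<theta> i / \<rho>)"
    have "(\<integral>\<omega>. iexp (\<Sum>i\<in>UNIV. \<theta> i * y \<omega> i) \<partial>M) = (\<integral>\<omega>. iexp (- (\<xi> \<bullet> x)) * iexp (\<xi> \<bullet> X \<omega>) \<partial>M)"
    proof (intro Bochner_Integration.integral_cong refl)
      fix \<omega>
      have "(\<Sum>i\<in>UNIV. \<theta> i * y \<omega> i) = - (\<xi> \<bullet> x) + \<xi> \<bullet> X \<omega>"
        by (simp add: y_def \<xi>_def inner_vec_def sum_negf[symmetric] sum.distrib[symmetric] diff_divide_distrib algebra_simps)
      then show "iexp (\<Sum>i\<in>UNIV. \<theta> i * y \<omega> i) = iexp (- (\<xi> \<bullet> x)) * iexp (\<xi> \<bullet> X \<omega>)"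
        by (simp only: of_real_add distrib_left exp_add)
    qed
    then have "norm (\<integral>\<omega>. iexp (\<Sum>i\<in>UNIV. \<theta> i * y \<omega> i) \<partial>M) = norm (\<integral>\<omega>. iexp (\<xi> \<bullet> X \<omega>) \<partial>M)"
      by (simp add: norm_mult)
    also have "\<dots> \<le> Q / (\<Prod>i\<in>UNIV. 1 + (\<xi> $ i)\<^sup>2)"
    proof -
      have "0 < (\<Prod>i\<in>UNIV. 1 + (\<xi> $ i)\<^sup>2)" by (intro prod_pos) (auto intro: add_pos_nonneg)
      then show ?thesis using Q[of \<xi>] by (simp add: pos_le_divide_eq)
    qed
    also have "\<dots> = Q * (\<Prod>i\<in>UNIV. inverse (1 + (\<xi> $ i)\<^sup>2))"
      using prod_inversef[of "\<lambda>i. 1 + (\<xi> $ i)\<^sup>2" UNIV] by (simp add: o_def divide_inverse)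
    finally show ?thesis by (simp add: \<xi>_def)
  qed
  note sb = std_normal_inverse_square_bound[OF \<rho>]
  have bint: "integrable N (\<lambda>\<theta>. \<Prod>i\<in>UNIV. inverse (1 + (\<theta> i / \<rho>)\<^sup>2))"
    unfolding N_def by (rule SP.product_integrable_prod) (use sb in auto)
  have Q0: "0 \<le> Q" using Q[of 0] by (rule order_trans[rotated]) (auto intro!: mult_nonneg_nonneg prod_nonneg)
  have "(\<integral>\<omega>. g \<omega> \<partial>M) = norm (\<integral>\<theta>. (\<integral>\<omega>. iexp (\<Sum>i\<in>UNIV. \<theta> i * y \<omega> i) \<partial>M) \<partial>N)"
    unfolding eq[symmetric] using g01 by (simp add: integral_nonneg_AE)
  also have "\<dots> \<le> (\<integral>\<theta>. Q * (\<Prod>i\<in>UNIV. inverse (1 + (\<theta> i / \<rho>)\<^sup>2)) \<partial>N)"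
  proof (rule order_trans[OF integral_norm_bound], rule integral_mono')
    show "0 \<le> Q * (\<Prod>i\<in>UNIV. inverse (1 + (\<theta> i / \<rho>)\<^sup>2))" for \<theta> :: "'d \<Rightarrow> real"
      using Q0 by (auto intro!: mult_nonneg_nonneg prod_nonneg add_nonneg_nonneg)
  qed (use inner bint in auto)
  also have "\<dots> = Q * (\<Prod>i\<in>(UNIV::'d set). \<integral>\<theta>. inverse (1 + (\<theta> / \<rho>)\<^sup>2) \<partial>?S)"
    unfolding N_def using SP.product_integral_prod[of UNIV "\<lambda>_ \<theta>. inverse (1 + (\<theta> / \<rho>)\<^sup>2)"] sb by simp
  also have "\<dots> \<le> Q * (\<Prod>i\<in>(UNIV::'d set). \<rho> * (\<integral>x. inverse (1 + x\<^sup>2) \<partial>lborel))"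
    using sb Q0 by (intro mult_left_mono prod_mono) (auto intro!: integral_nonneg_AE)
  finally have Eg: "(\<integral>\<omega>. g \<omega> \<partial>M) \<le> Q * (\<rho> * (\<integral>x. inverse (1 + x\<^sup>2) \<partial>lborel)) ^ CARD('d)" by simp
  have "measure M ?A = (\<integral>\<omega>. indicator ?A \<omega> \<partial>M)" using A_meas by simp
  also have "\<dots> \<le> (\<integral>\<omega>. exp (1/2) ^ CARD('d) * g \<omega> \<partial>M)"
    using gint A_meas ind by (intro integral_mono) (auto simp: emeasure_eq_measure)
  also have "\<dots> = exp (1/2) ^ CARD('d) * (\<integral>\<omega>. g \<omega> \<partial>M)" by simp
  also have "\<dots> \<le> exp (1/2) ^ CARD('d) * (Q * (\<rho> * (\<integral>x. inverse (1 + x\<^sup>2) \<partial>lborel)) ^ CARD('d))"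
    using Eg by (intro mult_left_mono) auto
  also have "\<dots> = Q * (cube_const * (2 * \<rho>)) ^ CARD('d)"
    by (simp add: cube_const_def power_mult_distrib[symmetric] mult_ac)
  finally show ?thesis .
qed

text \<open>The bound on cubes is extended by covering a bounded set, up to small Lebesgue measure, with
  nonoverlapping dyadic cubes.\<close>

lemma (in prob_space) law_le_lebesgue:
  fixes X :: "'a \<Rightarrow> real ^ 'd"
  assumes X[measurable]: "X \<in> borel_measurable M"
    and Q: "\<And>\<xi>. norm (\<integral>\<omega>. iexp (\<xi> \<bullet> X \<omega>) \<partial>M) * (\<Prod>i\<in>UNIV. 1 + (\<xi> $ i)\<^sup>2) \<le> Q"
    and A: "A \<in> sets borel"
  shows "emeasure (distr M borel X) A \<le> ennreal (Q * cube_const ^ CARD('d)) * emeasure lborel A"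
proof -
  define D where "D = Q * cube_const ^ CARD('d)"
  let ?\<nu> = "distr M borel X"
  interpret \<nu>: prob_space ?\<nu> by (rule prob_space_distr) simp
  have Q0: "0 \<le> Q" using Q[of 0] by (rule order_trans[rotated]) (auto intro!: mult_nonneg_nonneg prod_nonneg)
  have cc: "0 \<le> cube_const" by (simp add: cube_const_def add_nonneg_nonneg)
  have D0: "0 \<le> D" using Q0 cc by (simp add: D_def)
  have cube: "emeasure ?\<nu> (cbox c d) \<le> ennreal D * emeasure lborel (box c d)"
    if h: "\<And>i. d $ i - c $ i = h" "0 < h" for c d :: "real ^ 'd" and h
  proof -
    have "c $ i \<le> y \<and> y \<le> d $ i \<longleftrightarrow> \<bar>y - ((c + d) /\<^sub>R 2) $ i\<bar> \<le> h / 2" for y i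
    proof -
      have "d $ i = c $ i + h" using h(1)[of i] by simp
      then show ?thesis by (auto simp: abs_le_iff field_simps)
    qed
    then have "cbox c d = {y. \<forall>i. \<bar>y $ i - ((c + d) /\<^sub>R 2) $ i\<bar> \<le> h / 2}"
      by (simp add: set_eq_iff mem_box_cart)
    then have "X -` cbox c d \<inter> space M = {\<omega>\<in>space M. \<forall>i. \<bar>X \<omega> $ i - ((c + d) /\<^sub>R 2) $ i\<bar> \<le> h / 2}"
      by auto
    then have "measure ?\<nu> (cbox c d) \<le> Q * (cube_const * (2 * (h / 2))) ^ CARD('d)"
      using cube_probability_le[OF X Q, of "h / 2" "(c + d) /\<^sub>R 2"] h by (simp add: measure_distr)
    also have "\<dots> = D * h ^ CARD('d)" by (simp add: D_def power_mult_distrib)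
    finally have "emeasure ?\<nu> (cbox c d) \<le> ennreal (D * h ^ CARD('d))"
      by (simp add: \<nu>.emeasure_eq_measure ennreal_leI)
    also have "ennreal (D * h ^ CARD('d)) = ennreal D * emeasure lborel (box c d)"
    proof -
      have cd: "c \<bullet> b \<le> d \<bullet> b" "(d - c) \<bullet> b = h" if bB: "b \<in> Basis" for b
      proof -
        obtain i where "b = axis i 1" using bB by (auto simp: Basis_vec_def)
        then show "c \<bullet> b \<le> d \<bullet> b" "(d - c) \<bullet> b = h" using h(1)[of i] h(2) by (auto simp: inner_axis)
      qed
      have "emeasure lborel (box c d) = ennreal (\<Prod>b\<in>Basis. (d - c) \<bullet> b)"
        using cd by (intro emeasure_lborel_box) auto
      also have "(\<Prod>b\<in>Basis. (d - c) \<bullet> b) = h ^ CARD('d)" using cd by simp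
      finally show ?thesis using D0 h by (simp add: ennreal_mult)
    qed
    finally show ?thesis .
  qed
  have bounded_le: "emeasure ?\<nu> S \<le> ennreal D * emeasure lborel S"
    if S: "S \<in> sets borel" "S \<subseteq> cbox (\<chi> i. - n) (\<chi> i. n)" and n: "0 < n" for S and n :: real
  proof (rule ennreal_le_epsilon)
    fix e :: real assume e: "0 < e"
    let ?a = "(\<chi> i. - n) :: real ^ 'd" and ?b = "(\<chi> i. n) :: real ^ 'd"
    define e' where "e' = e / (D + 1)"
    have e': "0 < e'" "D * e' \<le> e" using e D0 by (auto simp: e'_def field_simps)
    have Sl: "S \<in> lmeasurable"
      using S by (meson bounded_cbox bounded_set_imp_lmeasurable bounded_subset lborelD sets_completionI_sets)
    obtain \<D> where \<D>: "countable \<D>"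
        "\<And>K. K \<in> \<D> \<Longrightarrow> K \<subseteq> cbox ?a ?b \<and> K \<noteq> {} \<and> (\<exists>c d. K = cbox c d)"
        "pairwise (\<lambda>A B. interior A \<inter> interior B = {}) \<D>"
        "\<And>u v. cbox u v \<in> \<D> \<Longrightarrow> \<exists>n. \<forall>i \<in> Basis. v \<bullet> i - u \<bullet> i = (?b \<bullet> i - ?a \<bullet> i)/2^n"
        "S \<subseteq> \<Union>\<D>" "\<Union>\<D> \<in> lmeasurable" "measure lebesgue (\<Union>\<D>) \<le> measure lebesgue S + e'"
      by (rule measurable_outer_intervals_bounded[OF Sl S(2) e'(1)]) blast
    \<comment> \<open>An enumeration of the cubes, padded with the empty set when there are finitely many.\<close>
    define K where "K m = (if m \<in> to_nat_on \<D> ` \<D> then from_nat_into \<D> m else {})" for m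
    have KD: "K m \<in> insert {} \<D>" for m
      using \<D>(1) by (auto simp: K_def)
    have UK: "(\<Union>m. K m) = \<Union>\<D>"
    proof
      show "(\<Union>m. K m) \<subseteq> \<Union>\<D>" using KD by blast
      show "\<Union>\<D> \<subseteq> (\<Union>m. K m)"
      proof
        fix x assume "x \<in> \<Union>\<D>"
        then obtain L where L: "L \<in> \<D>" "x \<in> L" by auto
        then have "K (to_nat_on \<D> L) = L" using \<D>(1) by (simp add: K_def)
        then show "x \<in> (\<Union>m. K m)" using L by blast
      qed
    qed
    have disj: "disjoint_family (\<lambda>m. interior (K m))"
      unfolding disjoint_family_on_def
    proof (intro ballI impI)
      fix m m' :: nat assume "m \<noteq> m'"
      show "interior (K m) \<inter> interior (K m') = {}"
      proof (cases "m \<in> to_nat_on \<D> ` \<D> \<and> m' \<in> to_nat_on \<D> ` \<D>")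
        case True
        then obtain L L' where "L \<in> \<D>" "L' \<in> \<D>" "m = to_nat_on \<D> L" "m' = to_nat_on \<D> L'" by auto
        then show ?thesis using \<D>(1) \<D>(3) \<open>m \<noteq> m'\<close> by (auto simp: K_def pairwise_def)
      qed (auto simp: K_def)
    qed
    have Kb: "emeasure ?\<nu> (K m) \<le> ennreal D * emeasure lborel (interior (K m))" "K m \<in> sets borel" for m
    proof -
      consider "K m = {}" | "K m \<in> \<D>" using KD[of m] by auto
      then have "emeasure ?\<nu> (K m) \<le> ennreal D * emeasure lborel (interior (K m)) \<and> K m \<in> sets borel"
      proof cases
        case 2
        then obtain c d where cd: "K m = cbox c d" using \<D>(2) by blast
        then obtain k where k: "\<forall>i\<in>Basis. d \<bullet> i - c \<bullet> i = (?b \<bullet> i - ?a \<bullet> i) / 2 ^ k" using \<D>(4) 2 by metis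
        have hh: "d $ i - c $ i = (2 * n) / 2 ^ k" for i
          using k[rule_format, of "axis i 1"] by (simp add: inner_axis axis_in_Basis_iff)
        have "emeasure ?\<nu> (cbox c d) \<le> ennreal D * emeasure lborel (box c d)"
          using n cube[OF hh] by simp
        then show ?thesis by (simp add: cd interior_cbox)
      qed auto
      then show "emeasure ?\<nu> (K m) \<le> ennreal D * emeasure lborel (interior (K m))" "K m \<in> sets borel" by auto
    qed
    have UD: "\<Union>\<D> \<in> sets borel" unfolding UK[symmetric] using Kb(2) by auto
    have "emeasure ?\<nu> S \<le> emeasure ?\<nu> (\<Union>m. K m)"
      using \<D>(5) UD unfolding UK by (intro emeasure_mono) auto
    also have "\<dots> \<le> (\<Sum>m. emeasure ?\<nu> (K m))"
      using Kb(2) by (intro emeasure_subadditive_countably) auto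
    also have "\<dots> \<le> (\<Sum>m. ennreal D * emeasure lborel (interior (K m)))"
      using Kb(1) by (intro suminf_le) auto
    also have "\<dots> = ennreal D * (\<Sum>m. emeasure lborel (interior (K m)))" by simp
    also have "\<dots> \<le> ennreal D * ennreal (measure lebesgue S + e')"
    proof (rule mult_left_mono)
      have "(\<Sum>m. emeasure lborel (interior (K m))) = emeasure lborel (\<Union>m. interior (K m))"
        using disj by (intro suminf_emeasure) auto
      also have "\<dots> \<le> emeasure lborel (\<Union>\<D>)"
        using UD interior_subset unfolding UK[symmetric] by (intro emeasure_mono UN_mono) auto
      also have "\<dots> = emeasure lebesgue (\<Union>\<D>)" using UD by simp
      also have "\<dots> = ennreal (measure lebesgue (\<Union>\<D>))" by (rule emeasure_eq_measure2[OF \<D>(6)])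
      also have "\<dots> \<le> ennreal (measure lebesgue S + e')" using \<D>(7) by (rule ennreal_leI)
      finally show "(\<Sum>m. emeasure lborel (interior (K m))) \<le> ennreal (measure lebesgue S + e')" .
    qed simp
    also have "\<dots> = ennreal D * ennreal (measure lebesgue S) + ennreal (D * e')"
      using e' D0 by (simp add: ennreal_mult distrib_left)
    also have "ennreal (measure lebesgue S) = emeasure lebesgue S"
      by (rule emeasure_eq_measure2[OF Sl, symmetric])
    also have "emeasure lebesgue S = emeasure lborel S" using S by simp
    also have "ennreal D * emeasure lborel S + ennreal (D * e') \<le> ennreal D * emeasure lborel S + ennreal e"
      using e' by (intro add_left_mono ennreal_leI) simp
    finally show "emeasure ?\<nu> S \<le> ennreal D * emeasure lborel S + ennreal e" .
  qed
  define S where "S k = A \<inter> cbox (\<chi> i. - real (Suc k)) (\<chi> i. real (Suc k))" for k :: nat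
  have inc: "incseq S"
    unfolding S_def incseq_def by (auto simp: mem_box_cart) (smt (verit) of_nat_mono)+
  have US: "(\<Union>k. S k) = A"
  proof -
    have "\<exists>k. x \<in> cbox (\<chi> i. - real (Suc k)) (\<chi> i. real (Suc k))" for x :: "real ^ 'd"
    proof -
      obtain k where k: "norm x \<le> real k" using real_arch_simple by blast
      have "- real (Suc k) \<le> x $ i \<and> x $ i \<le> real (Suc k)" for i
        using component_le_norm_cart[of x i] k by (auto simp: abs_le_iff)
      then show ?thesis by (intro exI[of _ k]) (simp add: mem_box_cart)
    qed
    then show ?thesis by (auto simp: S_def)
  qed
  have Sm: "S k \<in> sets borel" for k using A by (simp add: S_def)
  have "emeasure ?\<nu> (S k) \<le> ennreal D * emeasure lborel A" for k
  proof -
    have "emeasure ?\<nu> (S k) \<le> ennreal D * emeasure lborel (S k)"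
      by (rule bounded_le[OF Sm, of _ "real (Suc k)"]) (auto simp: S_def)
    also have "\<dots> \<le> ennreal D * emeasure lborel A"
      using A by (intro mult_left_mono emeasure_mono) (auto simp: S_def)
    finally show ?thesis .
  qed
  then have "(SUP k. emeasure ?\<nu> (S k)) \<le> ennreal D * emeasure lborel A" by (rule SUP_least)
  moreover have "(SUP k. emeasure ?\<nu> (S k)) = emeasure ?\<nu> (\<Union>k. S k)"
    by (rule SUP_emeasure_incseq[OF _ inc]) (use Sm in auto)
  ultimately show ?thesis by (simp add: US D_def)
qed

context fbm_driver
begin

lemma B_adapted:
  assumes "0 \<le> r" "r \<le> u" "u \<le> T"
  shows "B r \<in> borel_measurable (augmented_filtration M B u)"
proof (rule measurableI)
  have sp: "space (augmented_filtration M B u) = space M"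
    by (simp add: augmented_filtration_def space_measure_of_conv)
  fix A :: "(real ^ 'd) set" assume "A \<in> sets borel"
  then show "B r -` A \<inter> space (augmented_filtration M B u) \<in> sets (augmented_filtration M B u)"
    unfolding sp sets_augmented_filtration[OF assms(3)] using assms by (intro sigma_sets.Basic) auto
qed auto

text \<open>Between \<open>u\<close> and \<open>t\<close> the drift moves the solution by at most \<open>C (t - u)\<close>. Up to that error \<open>X t\<close> is
  \<open>(X u - B u) + B t\<close>, whose first summand belongs to the past of \<open>u\<close>.\<close>

lemma solution_char_decay:
  assumes X: "strong_solution M T B b s x X" and s: "0 \<le> s"
    and b: "\<And>r y. r \<in> {s..T} \<Longrightarrow> norm (b r y) \<le> C" and u: "s \<le> u" "u < t" "t \<le> T"
  shows "norm (\<integral>\<omega>. iexp (\<xi> \<bullet> X t \<omega>) \<partial>M) \<le> exp (- ((norm \<xi>)\<^sup>2 * (t - u) powr (2 * H) / 4)) + norm \<xi> * (C * (t - u))"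
proof -
  have C0: "0 \<le> C" using b[of s 0] u by (auto intro: order_trans[OF norm_ge_zero])
  have Xu: "X u \<in> borel_measurable (augmented_filtration M B u)" "X t \<in> borel_measurable (augmented_filtration M B t)"
    using X u by (auto simp: strong_solution_def)
  have [measurable]: "X t \<in> borel_measurable M" "B t \<in> borel_measurable M"
    using measurable_from_subalg[OF subalgebra_augmented_filtration Xu(2)] B_measurable[of t] u s by auto
  define \<Psi> where "\<Psi> \<omega> = iexp (\<xi> \<bullet> (X u \<omega> - B u \<omega>))" for \<omega>
  have \<Psi>1: "norm (\<Psi> \<omega>) = 1" for \<omega> by (simp add: \<Psi>_def)
  have Bu: "B u \<in> borel_measurable (augmented_filtration M B u)" using u s by (intro B_adapted) auto
  have \<Psi>: "\<Psi> \<in> borel_measurable (augmented_filtration M B u)"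
    unfolding \<Psi>_def[abs_def] using Xu(1) Bu by measurable
  have uT: "u \<le> T" using u by simp
  note [measurable] = measurable_from_subalg[OF subalgebra_augmented_filtration[OF uT] \<Psi>]
  have ae: "AE \<omega> in M. norm (iexp (\<xi> \<bullet> X t \<omega>) - \<Psi> \<omega> * iexp (\<xi> \<bullet> B t \<omega>)) \<le> norm \<xi> * (C * (t - u))"
  proof -
    have "AE \<omega> in M. \<forall>t\<in>{s..T}. integrable (lebesgue_on {s..t}) (\<lambda>u. b u (X u \<omega>)) \<and>
        X t \<omega> = x + (\<integral>u. b u (X u \<omega>) \<partial>lebesgue_on {s..t}) + B t \<omega> - B s \<omega>"
      using X by (simp add: strong_solution_def)
    then show ?thesis
    proof eventually_elim
      case (elim \<omega>)
      let ?I = "\<lambda>t. \<integral>u. b u (X u \<omega>) \<partial>lebesgue_on {s..t}"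
      have 1: "integrable (lebesgue_on {s..t}) (\<lambda>u. b u (X u \<omega>))" "X t \<omega> = x + ?I t + B t \<omega> - B s \<omega>"
        "X u \<omega> = x + ?I u + B u \<omega> - B s \<omega>"
        using elim u by auto
      have le: "norm (?I t - ?I u) \<le> C * (t - u)"
        using u b C0 by (intro norm_lebesgue_integral_diff_le[OF 1(1)]) auto
      have "\<Psi> \<omega> * iexp (\<xi> \<bullet> B t \<omega>) = iexp (\<xi> \<bullet> (X u \<omega> - B u \<omega>) + \<xi> \<bullet> B t \<omega>)"
        by (simp add: \<Psi>_def exp_add[symmetric] distrib_left)
      then have "norm (iexp (\<xi> \<bullet> X t \<omega>) - \<Psi> \<omega> * iexp (\<xi> \<bullet> B t \<omega>))
         \<le> \<bar>\<xi> \<bullet> X t \<omega> - (\<xi> \<bullet> (X u \<omega> - B u \<omega>) + \<xi> \<bullet> B t \<omega>)\<bar>"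
        by (simp only: norm_iexp_diff_le)
      also have "\<xi> \<bullet> X t \<omega> - (\<xi> \<bullet> (X u \<omega> - B u \<omega>) + \<xi> \<bullet> B t \<omega>) = \<xi> \<bullet> (?I t - ?I u)"
        unfolding 1(2,3) by (simp add: inner_simps)
      also have "\<bar>\<xi> \<bullet> (?I t - ?I u)\<bar> \<le> norm \<xi> * norm (?I t - ?I u)" by (rule Cauchy_Schwarz_ineq2)
      also have "\<dots> \<le> norm \<xi> * (C * (t - u))" using le by (intro mult_left_mono) auto
      finally show ?case .
    qed
  qed
  have i1: "integrable M (\<lambda>\<omega>. iexp (\<xi> \<bullet> X t \<omega>))" by (intro integrable_const_bound[where B=1]) auto
  have i2: "integrable M (\<lambda>\<omega>. \<Psi> \<omega> * iexp (\<xi> \<bullet> B t \<omega>))"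
    using \<Psi>1 by (intro integrable_const_bound[where B=1]) (auto simp: norm_mult)
  have "(\<integral>\<omega>. iexp (\<xi> \<bullet> X t \<omega>) \<partial>M) = (\<integral>\<omega>. \<Psi> \<omega> * iexp (\<xi> \<bullet> B t \<omega>) \<partial>M)
     + (\<integral>\<omega>. iexp (\<xi> \<bullet> X t \<omega>) - \<Psi> \<omega> * iexp (\<xi> \<bullet> B t \<omega>) \<partial>M)"
    using i1 i2 by simp
  also have "norm \<dots> \<le> norm (\<integral>\<omega>. \<Psi> \<omega> * iexp (\<xi> \<bullet> B t \<omega>) \<partial>M)
     + norm (\<integral>\<omega>. iexp (\<xi> \<bullet> X t \<omega>) - \<Psi> \<omega> * iexp (\<xi> \<bullet> B t \<omega>) \<partial>M)" by (rule norm_triangle_ineq)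
  also have "\<dots> \<le> exp (- ((norm \<xi>)\<^sup>2 * (t - u) powr (2 * H) / 4)) + norm \<xi> * (C * (t - u))"
  proof (rule add_mono)
    show "norm (\<integral>\<omega>. \<Psi> \<omega> * iexp (\<xi> \<bullet> B t \<omega>) \<partial>M) \<le> exp (- ((norm \<xi>)\<^sup>2 * (t - u) powr (2 * H) / 4))"
      using u s by (intro conditional_char_decay \<Psi>) (auto simp: \<Psi>_def)
    have "norm (\<integral>\<omega>. iexp (\<xi> \<bullet> X t \<omega>) - \<Psi> \<omega> * iexp (\<xi> \<bullet> B t \<omega>) \<partial>M)
       \<le> (\<integral>\<omega>. norm (iexp (\<xi> \<bullet> X t \<omega>) - \<Psi> \<omega> * iexp (\<xi> \<bullet> B t \<omega>)) \<partial>M)" by (rule integral_norm_bound)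
    also have "\<dots> \<le> (\<integral>\<omega>. norm \<xi> * (C * (t - u)) \<partial>M)"
      using ae i1 i2 by (intro integral_mono_AE) auto
    finally show "norm (\<integral>\<omega>. iexp (\<xi> \<bullet> X t \<omega>) - \<Psi> \<omega> * iexp (\<xi> \<bullet> B t \<omega>) \<partial>M) \<le> norm \<xi> * (C * (t - u))"
      by (simp add: prob_space)
  qed
  finally show ?thesis .
qed

lemma uniform_solution_char_bound:
  assumes s: "0 \<le> s" "s < t" "t \<le> T" and C: "0 \<le> C" and H': "H < 1 / (2 * (real CARD('d) + 3))"
  obtains Q where "\<And>b x X \<xi>. strong_solution M T B b s x X \<Longrightarrow> (\<And>r y. r \<in> {s..T} \<Longrightarrow> norm (b r y) \<le> C) \<Longrightarrow>
     norm (\<integral>\<omega>. iexp (\<xi> \<bullet> X t \<omega>) \<partial>M) * (\<Prod>i\<in>UNIV. 1 + (\<xi> $ i)\<^sup>2) \<le> Q"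
proof -
  obtain Q where Q: "\<forall>\<phi> :: real ^ 'd \<Rightarrow> real.
     (\<forall>\<xi>. \<phi> \<xi> \<le> 1) \<longrightarrow>
     (\<forall>\<xi> u. s \<le> u \<and> u < t \<longrightarrow> \<phi> \<xi> \<le> exp (- ((norm \<xi>)\<^sup>2 * (t - u) powr (2 * H) / 4)) + norm \<xi> * (C * (t - u))) \<longrightarrow>
     (\<forall>\<xi>. \<phi> \<xi> * (\<Prod>i\<in>UNIV. 1 + (\<xi> $ i)\<^sup>2) \<le> Q)"
    using char_decay_optimised[OF H(1) H' C s(2)] by (elim exE conjE)
  show thesis
  proof (rule that[of Q])
    fix b x X \<xi>
    assume X: "strong_solution M T B b s x X" and b: "\<And>r y. r \<in> {s..T} \<Longrightarrow> norm (b r y) \<le> C"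
    show "norm (\<integral>\<omega>. iexp (\<xi> \<bullet> X t \<omega>) \<partial>M) * (\<Prod>i\<in>UNIV. 1 + (\<xi> $ i)\<^sup>2) \<le> Q"
    proof (rule Q[rule_format, of "\<lambda>\<xi>. norm (\<integral>\<omega>. iexp (\<xi> \<bullet> X t \<omega>) \<partial>M)"])
      fix \<xi> :: "real ^ 'd"
      have "norm (\<integral>\<omega>. iexp (\<xi> \<bullet> X t \<omega>) \<partial>M) \<le> (\<integral>\<omega>. norm (iexp (\<xi> \<bullet> X t \<omega>)) \<partial>M)" by (rule integral_norm_bound)
      then show "norm (\<integral>\<omega>. iexp (\<xi> \<bullet> X t \<omega>) \<partial>M) \<le> 1" by (simp add: prob_space)
    next
      fix \<xi> :: "real ^ 'd" and u assume "s \<le> u \<and> u < t"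
      then show "norm (\<integral>\<omega>. iexp (\<xi> \<bullet> X t \<omega>) \<partial>M) \<le> exp (- ((norm \<xi>)\<^sup>2 * (t - u) powr (2 * H) / 4)) + norm \<xi> * (C * (t - u))"
        using X b s by (intro solution_char_decay) auto
    qed
  qed
qed

end

section \<open>Jointly measurable modifications\<close>

text \<open>The parameter \<open>p\<close> is approximated by the first member \<open>q (j n p)\<close> of a dense sequence within
  \<open>1 / (n + 1)\<close> of \<open>p\<close>. This choice is measurable with countably many values, so each approximation is
  jointly measurable.\<close>

lemma caratheodory_borel_measurable:
  fixes F :: "'p::{metric_space, second_countable_topology} \<Rightarrow> 'w \<Rightarrow> 'b::{metric_space, second_countable_topology}"
  assumes meas: "\<And>p. F p \<in> borel_measurable N"
    and cont: "\<And>w. w \<in> space N \<Longrightarrow> continuous_on UNIV (\<lambda>p. F p w)"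
  shows "(\<lambda>(p, w). F p w) \<in> borel_measurable (borel \<Otimes>\<^sub>M N)"
proof -
  obtain D :: "'p set" where D: "countable D" "\<And>X. open X \<Longrightarrow> X \<noteq> {} \<Longrightarrow> \<exists>d\<in>D. d \<in> X"
    by (rule countable_dense_setE) blast
  have "D \<noteq> {}" using D(2)[of UNIV] by auto
  define q where "q = from_nat_into D"
  define j where "j n p = (LEAST m. dist (q m) p < 1 / real (Suc n))" for n :: nat and p
  have q: "\<exists>m. dist (q m) p < e" if e: "0 < e" for p e
  proof -
    obtain d where "d \<in> D" "d \<in> ball p e" using D(2)[of "ball p e"] e by auto
    then show ?thesis using D(1) unfolding q_def
      by (metis dist_commute from_nat_into_surj mem_ball)
  qed
  have j: "dist (q (j n p)) p < 1 / real (Suc n)" for n p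
    unfolding j_def by (rule LeastI_ex, rule q) simp
  have [measurable]: "j n \<in> measurable borel (count_space UNIV)" for n
  proof -
    have [measurable]: "(\<lambda>p. dist (q m) p < 1 / real (Suc n)) \<in> measurable borel (count_space UNIV)" for m
      by measurable
    show ?thesis unfolding j_def[abs_def] by measurable
  qed
  show ?thesis
  proof (rule borel_measurable_LIMSEQ_metric)
    fix n
    have "(\<lambda>x. F (q m) (snd x)) \<in> borel_measurable (borel \<Otimes>\<^sub>M N)" for m
      using meas[of "q m"] by measurable
    then show "(\<lambda>x. F (q (j n (fst x))) (snd x)) \<in> borel_measurable (borel \<Otimes>\<^sub>M N)"
      by (rule measurable_compose_countable) measurable
  next
    fix x :: "'p \<times> 'w" assume x: "x \<in> space (borel \<Otimes>\<^sub>M N)"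
    obtain p w where pw: "x = (p, w)" by fastforce
    then have w: "w \<in> space N" using x by (simp add: space_pair_measure)
    have "(\<lambda>n. q (j n p)) \<longlonglongrightarrow> p"
    proof (rule metric_LIMSEQ_I)
      fix e :: real assume "0 < e"
      then obtain N0 :: nat where N0: "1 / real (Suc N0) < e" by (metis nat_approx_posE)
      show "\<exists>no. \<forall>n\<ge>no. dist (q (j n p)) p < e"
      proof (intro exI[of _ N0] allI impI)
        fix n assume "N0 \<le> n"
        then have "1 / real (Suc n) \<le> 1 / real (Suc N0)" by (simp add: frac_le)
        then show "dist (q (j n p)) p < e" using j[of n p] N0 by linarith
      qed
    qed
    moreover have "isCont (\<lambda>p. F p w) p" using cont[OF w] by (simp add: continuous_on_eq_continuous_at)
    ultimately show "(\<lambda>n. F (q (j n (fst x))) (snd x)) \<longlonglongrightarrow> (case x of (p, w) \<Rightarrow> F p w)"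
      unfolding pw using isCont_tendsto_compose[of p "\<lambda>p. F p w"] by auto
  qed
qed

lemma continuous_modification:
  fixes F :: "'p::{metric_space, second_countable_topology} \<Rightarrow> 'w \<Rightarrow> 'b::{real_normed_vector, second_countable_topology}"
  assumes meas: "\<And>p. F p \<in> borel_measurable N"
    and cont: "AE w in N. continuous_on UNIV (\<lambda>p. F p w)"
  obtains F' where "\<And>w. continuous_on UNIV (\<lambda>p. F' p w)" "(\<lambda>(p, w). F' p w) \<in> borel_measurable (borel \<Otimes>\<^sub>M N)"
    "\<And>p. F' p \<in> borel_measurable N" "AE w in N. \<forall>p. F' p w = F p w"
proof -
  obtain N0 where N0: "N0 \<in> null_sets N" "{w \<in> space N. \<not> continuous_on UNIV (\<lambda>p. F p w)} \<subseteq> N0"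
    using cont by (auto elim!: AE_E simp: null_sets_def)
  define F' where "F' p w = (if w \<in> N0 \<union> (- space N) then 0 else F p w)" for p w
  have [measurable]: "N0 \<in> sets N" using N0 by auto
  have c: "continuous_on UNIV (\<lambda>p. F' p w)" for w
    using N0(2) by (cases "w \<in> N0 \<union> - space N") (auto simp: F'_def)
  have m: "F' p \<in> borel_measurable N" for p
  proof -
    have "(\<lambda>w. if w \<in> N0 then 0 else F p w) \<in> borel_measurable N" using meas[of p] by measurable
    then show ?thesis by (rule measurable_cong[THEN iffD1, rotated]) (auto simp: F'_def)
  qed
  have ae: "AE w in N. \<forall>p. F' p w = F p w"
    using AE_not_in[OF N0(1)] AE_space by eventually_elim (auto simp: F'_def)
  show thesis by (rule that[OF c caratheodory_borel_measurable[OF m c] m ae])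
qed

text \<open>The retraction \<open>clamp\<close> extends the field continuously to all parameters.\<close>

lemma continuous_modification_cbox:
  fixes F :: "'p::euclidean_space \<Rightarrow> 'w \<Rightarrow> 'b::{real_normed_vector, second_countable_topology}"
  assumes ne: "cbox a b \<noteq> {}"
    and meas: "\<And>p. p \<in> cbox a b \<Longrightarrow> F p \<in> borel_measurable N"
    and cont: "AE w in N. continuous_on (cbox a b) (\<lambda>p. F p w)"
  obtains F' where "\<And>w. continuous_on UNIV (\<lambda>p. F' p w)" "(\<lambda>(p, w). F' p w) \<in> borel_measurable (borel \<Otimes>\<^sub>M N)"
    "\<And>p. F' p \<in> borel_measurable N" "AE w in N. \<forall>p\<in>cbox a b. F' p w = F p w"
proof -
  have ab: "\<And>i. i \<in> Basis \<Longrightarrow> a \<bullet> i \<le> b \<bullet> i" using ne by (simp add: box_ne_empty)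
  obtain F' where F': "\<And>w. continuous_on UNIV (\<lambda>p. F' p w)" "(\<lambda>(p, w). F' p w) \<in> borel_measurable (borel \<Otimes>\<^sub>M N)"
    "\<And>p. F' p \<in> borel_measurable N" "AE w in N. \<forall>p. F' p w = F (clamp a b p) w"
  proof (rule continuous_modification[of "\<lambda>p. F (clamp a b p)" N])
    show "F (clamp a b p) \<in> borel_measurable N" for p
      using ab by (intro meas clamp_in_interval) auto
    show "AE w in N. continuous_on UNIV (\<lambda>p. F (clamp a b p) w)"
      using cont by eventually_elim (rule clamp_continuous_on)
  qed (rule that; assumption)
  have "AE w in N. \<forall>p\<in>cbox a b. F' p w = F p w"
    using F'(4)
  proof eventually_elim
    case (elim w)
    then show ?case using ab clamp_cancel_cbox by fastforce
  qed
  then show thesis by (rule that[OF F'(1-3)])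
qed

section \<open>Stability of the equation under convergence of the drift\<close>

lemma (in prob_space) expectation_le_lebesgue:
  fixes X :: "'a \<Rightarrow> 'b::euclidean_space" and h :: "'b \<Rightarrow> real"
  assumes X[measurable]: "X \<in> borel_measurable M"
    and law: "\<And>A. A \<in> sets borel \<Longrightarrow> emeasure (distr M borel X) A \<le> ennreal D * emeasure lborel A"
    and D: "0 \<le> D" and h: "integrable lborel h" "\<And>y. 0 \<le> h y"
  shows "integrable M (\<lambda>\<omega>. h (X \<omega>))" "(\<integral>\<omega>. h (X \<omega>) \<partial>M) \<le> D * (\<integral>y. h y \<partial>lborel)"
proof -
  have [measurable]: "h \<in> borel_measurable borel" using h by (auto dest: borel_measurable_integrable)
  have le: "distr M borel X \<le> scale_measure (ennreal D) lborel"
    by (subst le_measure) (auto intro: law)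
  have "(\<integral>\<^sup>+\<omega>. ennreal (h (X \<omega>)) \<partial>M) = (\<integral>\<^sup>+y. ennreal (h y) \<partial>distr M borel X)"
    by (subst nn_integral_distr) auto
  also have "\<dots> \<le> (\<integral>\<^sup>+y. ennreal (h y) \<partial>scale_measure (ennreal D) lborel)"
    using le by (intro nn_integral_mono_measure) auto
  also have "\<dots> = ennreal D * (\<integral>\<^sup>+y. ennreal (h y) \<partial>lborel)"
    by (rule nn_integral_scale_measure) simp
  also have "\<dots> = ennreal (D * (\<integral>y. h y \<partial>lborel))"
    using h D by (simp add: nn_integral_eq_integral ennreal_mult)
  finally have *: "(\<integral>\<^sup>+\<omega>. ennreal (h (X \<omega>)) \<partial>M) \<le> ennreal (D * (\<integral>y. h y \<partial>lborel))" .
  show int: "integrable M (\<lambda>\<omega>. h (X \<omega>))"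
    unfolding integrable_iff_bounded using * h by (auto simp: le_less_trans[OF _ ennreal_less_top])
  have "ennreal (\<integral>\<omega>. h (X \<omega>) \<partial>M) \<le> ennreal (D * (\<integral>y. h y \<partial>lborel))"
    using * int h by (simp add: nn_integral_eq_integral)
  then show "(\<integral>\<omega>. h (X \<omega>) \<partial>M) \<le> D * (\<integral>y. h y \<partial>lborel)"
    using D h by (subst (asm) ennreal_le_iff) (auto intro: integral_nonneg_AE)
qed

text \<open>The functions \<open>f k\<close> and their arguments \<open>\<xi> k\<close> vary simultaneously. For a fixed index \<open>j\<close> the difference
  is split as \<open>f k (\<xi> k) - f j (\<xi> k)\<close>, \<open>f j (\<xi> k) - f j \<zeta>\<close> and \<open>f j \<zeta> - g \<zeta>\<close>. On a ball of radius \<open>R\<close>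
  the domination of the laws turns the first and the last part into Lebesgue integrals \<open>h R\<close> of
  \<open>|f - g|\<close>, and the middle one is governed by uniform continuity of \<open>f j\<close>.\<close>

lemma (in prob_space) drift_convergence_fixed_time:
  fixes f :: "nat \<Rightarrow> 'b::euclidean_space \<Rightarrow> 'b" and g :: "'b \<Rightarrow> 'b" and \<xi> :: "nat \<Rightarrow> 'a \<Rightarrow> 'b" and \<zeta> :: "'a \<Rightarrow> 'b"
  assumes f: "\<And>k. continuous_on UNIV (f k)" and g[measurable]: "g \<in> borel_measurable borel"
    and C: "\<And>k y. norm (f k y) \<le> C" "\<And>y. norm (g y) \<le> C"
    and conv: "AE y in lborel. (\<lambda>k. f k y) \<longlonglongrightarrow> g y"
    and \<xi>[measurable]: "\<And>k. \<xi> k \<in> borel_measurable M" and \<zeta>[measurable]: "\<zeta> \<in> borel_measurable M"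
    and law: "\<And>k A. A \<in> sets borel \<Longrightarrow> emeasure (distr M borel (\<xi> k)) A \<le> ennreal D * emeasure lborel A"
      "\<And>A. A \<in> sets borel \<Longrightarrow> emeasure (distr M borel \<zeta>) A \<le> ennreal D * emeasure lborel A" and D: "0 \<le> D"
    and int: "integrable M \<zeta>" "\<And>k. integrable M (\<lambda>\<omega>. \<xi> k \<omega> - \<zeta> \<omega>)"
    and L1: "(\<lambda>k. \<integral>\<omega>. norm (\<xi> k \<omega> - \<zeta> \<omega>) \<partial>M) \<longlonglongrightarrow> 0"
  shows "(\<lambda>k. \<integral>\<omega>. norm (f k (\<xi> k \<omega>) - g (\<zeta> \<omega>)) \<partial>M) \<longlonglongrightarrow> 0"
proof -
  have [measurable]: "f k \<in> borel_measurable borel" for k using f by (rule borel_measurable_continuous_onI)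
  have C0: "0 \<le> C" using C(2)[of 0] norm_ge_zero order_trans by blast
  define h where "h R j y = indicator (cball 0 R) y * norm (f j y - g y)" for R :: real and j y
  have h0: "0 \<le> h R j y" for R j y by (simp add: h_def)
  have diff: "norm (f j y - g z) \<le> 2 * C" for j y z
    using C(1)[of j y] C(2)[of z] norm_triangle_ineq4[of "f j y" "g z"] by linarith
  have wint: "integrable lborel (\<lambda>y::'b. indicator (cball 0 R) y * (2 * C))" for R
    by (intro integrable_mult_left integrable_real_indicator emeasure_bounded_finite) auto
  have hint: "integrable lborel (h R j)" for R j
    by (rule Bochner_Integration.integrable_bound[OF wint[of R]])
       (use diff C0 in \<open>auto simp: h_def[abs_def] indicator_def intro!: AE_I2\<close>)
  have a0: "(\<lambda>j. \<integral>y. h R j y \<partial>lborel) \<longlonglongrightarrow> 0" for R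
  proof -
    have "(\<lambda>j. \<integral>y. h R j y \<partial>lborel) \<longlonglongrightarrow> integral\<^sup>L lborel (\<lambda>y::'b. 0)"
    proof (rule integral_dominated_convergence[OF _ _ wint[of R]])
      show "AE y in lborel. (\<lambda>j. h R j y) \<longlonglongrightarrow> 0"
        using conv
      proof eventually_elim
        case (elim y)
        then have "(\<lambda>k. norm (f k y - g y)) \<longlonglongrightarrow> 0" by (simp add: tendsto_norm_zero LIM_zero)
        then show ?case unfolding h_def by (rule tendsto_mult_right_zero)
      qed
      show "AE y in lborel. norm (h R j y) \<le> indicator (cball 0 R) y * (2 * C)" for j
        using diff by (intro AE_I2) (auto simp: h_def indicator_def)
    qed (use hint in \<open>auto dest: borel_measurable_integrable\<close>)
    then show ?thesis by simp
  qed
  have int\<xi>: "integrable M (\<xi> k)" for k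
    using Bochner_Integration.integrable_add[OF int(2)[of k] int(1)] by simp
  obtain m0 where m0: "\<And>k. (\<integral>\<omega>. norm (\<xi> k \<omega> - \<zeta> \<omega>) \<partial>M) \<le> m0"
  proof -
    have "Bseq (\<lambda>k. \<integral>\<omega>. norm (\<xi> k \<omega> - \<zeta> \<omega>) \<partial>M)" using L1 by (intro convergent_imp_Bseq convergentI)
    then obtain K where K: "\<And>k. norm (\<integral>\<omega>. norm (\<xi> k \<omega> - \<zeta> \<omega>) \<partial>M) \<le> K" unfolding Bseq_def by blast
    have "(\<integral>\<omega>. norm (\<xi> k \<omega> - \<zeta> \<omega>) \<partial>M) \<le> K" for k using K[of k] by (simp add: abs_le_iff)
    then show thesis by (rule that)
  qed
  define m where "m = m0 + 2 * (\<integral>\<omega>. norm (\<zeta> \<omega>) \<partial>M)"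
  have m_le: "(\<integral>\<omega>. norm (\<xi> k \<omega>) \<partial>M) + (\<integral>\<omega>. norm (\<zeta> \<omega>) \<partial>M) \<le> m" for k
  proof -
    have "(\<integral>\<omega>. norm (\<xi> k \<omega>) \<partial>M) \<le> (\<integral>\<omega>. norm (\<xi> k \<omega> - \<zeta> \<omega>) + norm (\<zeta> \<omega>) \<partial>M)"
      using int int\<xi> by (intro integral_mono) (auto intro: norm_triangle_sub[THEN order_trans] simp: add.commute)
    also have "\<dots> = (\<integral>\<omega>. norm (\<xi> k \<omega> - \<zeta> \<omega>) \<partial>M) + (\<integral>\<omega>. norm (\<zeta> \<omega>) \<partial>M)" using int by simp
    finally show ?thesis using m0[of k] by (simp add: m_def)
  qed
  have m_nonneg: "0 \<le> m"
    using order_trans[OF _ m_le[of 0]] by (simp add: integral_nonneg_AE)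
  have key: "(\<integral>\<omega>. norm (f k (\<xi> k \<omega>) - g (\<zeta> \<omega>)) \<partial>M)
     \<le> D * (\<integral>y. h R k y \<partial>lborel) + 2 * (D * (\<integral>y. h R j y \<partial>lborel)) + e
       + (2 * C / \<delta>) * (\<integral>\<omega>. norm (\<xi> k \<omega> - \<zeta> \<omega>) \<partial>M) + (2 * C / R) * m"
    if R: "0 < R" and \<delta>: "0 < \<delta>" and e: "0 < e"
      and uc: "\<And>y z. y \<in> cball 0 R \<Longrightarrow> z \<in> cball 0 R \<Longrightarrow> norm (y - z) < \<delta> \<Longrightarrow> norm (f j y - f j z) < e"
    for R \<delta> e j k
  proof -
    \<comment> \<open>In the manner of Markov's inequality, the bound \<open>2 C\<close> is charged to \<open>|y - z| / \<delta>\<close> when the points are far apart, and to \<open>(|y| + |z|) / R\<close> when one of them leaves the ball.\<close>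
    have pt: "norm (f k y - g z) \<le> h R k y + h R j y + h R j z + e + (2 * C / \<delta>) * norm (y - z) + (2 * C / R) * (norm y + norm z)"
      for y z
    proof (cases "y \<in> cball 0 R \<and> z \<in> cball 0 R")
      case True
      have fj: "norm (f j y - f j z) \<le> e + (2 * C / \<delta>) * norm (y - z)"
      proof (cases "norm (y - z) < \<delta>")
        case True
        have "norm (f j y - f j z) \<le> e" using uc[of y z] True \<open>y \<in> cball 0 R \<and> z \<in> cball 0 R\<close> by simp
        moreover have "0 \<le> (2 * C / \<delta>) * norm (y - z)" using C0 \<delta> by simp
        ultimately show ?thesis by linarith
      next
        case False
        have "norm (f j y - f j z) \<le> 2 * C"
          using C(1)[of j y] C(1)[of j z] norm_triangle_ineq4[of "f j y" "f j z"] by linarith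
        also have "2 * C = (2 * C / \<delta>) * \<delta>" using \<delta> by simp
        also have "\<dots> \<le> (2 * C / \<delta>) * norm (y - z)" using False C0 \<delta> by (intro mult_left_mono) auto
        finally show ?thesis using e by linarith
      qed
      have "f k y - g z = (f k y - g y) - (f j y - g y) + (f j y - f j z) + (f j z - g z)" by simp
      then have "norm (f k y - g z) \<le> norm (f k y - g y) + norm (f j y - g y) + norm (f j y - f j z) + norm (f j z - g z)"
        by (metis (no_types, opaque_lifting) norm_add_rule_thm norm_triangle_ineq4 norm_triangle_mono order_refl)
      moreover have "norm (f k y - g y) = h R k y" "norm (f j y - g y) = h R j y" "norm (f j z - g z) = h R j z"
        using True by (auto simp: h_def)
      moreover have "0 \<le> (2 * C / R) * (norm y + norm z)" using C0 R by simp
      ultimately show ?thesis using fj by linarith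
    next
      case False
      then have "R \<le> norm y + norm z"
        using norm_ge_zero[of y] norm_ge_zero[of z] by (auto simp: not_le intro: less_imp_le add_increasing add_increasing2)
      then have "(2 * C / R) * R \<le> (2 * C / R) * (norm y + norm z)" using C0 R by (intro mult_left_mono) auto
      then have "2 * C \<le> (2 * C / R) * (norm y + norm z)" using R by simp
      moreover have "0 \<le> (2 * C / \<delta>) * norm (y - z)" using C0 \<delta> by simp
      ultimately show ?thesis using diff[of k y z] h0[of R k y] h0[of R j y] h0[of R j z] e by linarith
    qed
    note H1 = expectation_le_lebesgue[OF \<xi>[of k] law(1)[of _ k] D hint[of R k] h0[of R k]]
    note H2 = expectation_le_lebesgue[OF \<xi>[of k] law(1)[of _ k] D hint[of R j] h0[of R j]]
    note H3 = expectation_le_lebesgue[OF \<zeta> law(2) D hint[of R j] h0[of R j]]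
    have "(\<integral>\<omega>. norm (f k (\<xi> k \<omega>) - g (\<zeta> \<omega>)) \<partial>M)
      \<le> (\<integral>\<omega>. h R k (\<xi> k \<omega>) + h R j (\<xi> k \<omega>) + h R j (\<zeta> \<omega>) + e + (2 * C / \<delta>) * norm (\<xi> k \<omega> - \<zeta> \<omega>)
          + (2 * C / R) * (norm (\<xi> k \<omega>) + norm (\<zeta> \<omega>)) \<partial>M)"
    proof (rule integral_mono)
      show "integrable M (\<lambda>\<omega>. norm (f k (\<xi> k \<omega>) - g (\<zeta> \<omega>)))"
        using diff by (intro integrable_const_bound[where B="2 * C"]) auto
      show "integrable M (\<lambda>\<omega>. h R k (\<xi> k \<omega>) + h R j (\<xi> k \<omega>) + h R j (\<zeta> \<omega>) + e + (2 * C / \<delta>) * norm (\<xi> k \<omega> - \<zeta> \<omega>)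
          + (2 * C / R) * (norm (\<xi> k \<omega>) + norm (\<zeta> \<omega>)))"
        using H1 H2 H3 int int\<xi> by (intro Bochner_Integration.integrable_add integrable_mult_right integrable_norm) auto
    qed (rule pt)
    also have "\<dots> = (\<integral>\<omega>. h R k (\<xi> k \<omega>) \<partial>M) + (\<integral>\<omega>. h R j (\<xi> k \<omega>) \<partial>M) + (\<integral>\<omega>. h R j (\<zeta> \<omega>) \<partial>M) + e
       + (2 * C / \<delta>) * (\<integral>\<omega>. norm (\<xi> k \<omega> - \<zeta> \<omega>) \<partial>M) + (2 * C / R) * ((\<integral>\<omega>. norm (\<xi> k \<omega>) \<partial>M) + (\<integral>\<omega>. norm (\<zeta> \<omega>) \<partial>M))"
      using H1 H2 H3 int int\<xi> by (simp add: prob_space)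
    also have "\<dots> \<le> D * (\<integral>y. h R k y \<partial>lborel) + D * (\<integral>y. h R j y \<partial>lborel) + D * (\<integral>y. h R j y \<partial>lborel) + e
       + (2 * C / \<delta>) * (\<integral>\<omega>. norm (\<xi> k \<omega> - \<zeta> \<omega>) \<partial>M) + (2 * C / R) * m"
      using H1(2) H2(2) H3(2) m_le[of k] C0 R by (intro add_mono mult_left_mono order_refl) auto
    finally show ?thesis by simp
  qed
  show ?thesis
  proof (rule tendstoI)
    fix \<epsilon> :: real assume \<epsilon>: "0 < \<epsilon>"
    \<comment> \<open>First \<open>R\<close>, then \<open>j\<close>, then \<open>\<delta>\<close> are fixed before \<open>k\<close> tends to infinity.\<close>
    define R where "R = 10 * (2 * C * m + 1) / \<epsilon>"
    have R0: "0 < R" using C0 m_nonneg \<epsilon> by (auto simp: R_def intro!: divide_pos_pos add_nonneg_pos)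
    have Rm: "(2 * C / R) * m \<le> \<epsilon> / 10"
    proof -
      have "2 * C * m \<le> (\<epsilon> / 10) * R" using \<epsilon> by (simp add: R_def)
      then show ?thesis using R0 by (simp add: pos_divide_le_eq)
    qed
    have "(\<lambda>j. 2 * (D * (\<integral>y. h R j y \<partial>lborel))) \<longlonglongrightarrow> 0"
      by (intro tendsto_mult_right_zero a0)
    then have "\<forall>\<^sub>F j in sequentially. 2 * (D * (\<integral>y. h R j y \<partial>lborel)) < \<epsilon> / 10"
      by (rule order_tendstoD(2)) (use \<epsilon> in simp)
    then obtain j where j: "2 * (D * (\<integral>y. h R j y \<partial>lborel)) < \<epsilon> / 10" by (auto simp: eventually_sequentially)
    have "uniformly_continuous_on (cball 0 R) (f j)"
      using f by (intro compact_uniformly_continuous) (auto intro: continuous_on_subset)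
    then obtain \<delta> where \<delta>: "0 < \<delta>" "\<And>y z. y \<in> cball 0 R \<Longrightarrow> z \<in> cball 0 R \<Longrightarrow> norm (y - z) < \<delta> \<Longrightarrow> norm (f j y - f j z) < \<epsilon> / 10"
      using \<epsilon> unfolding uniformly_continuous_on_def dist_norm by (metis (no_types) divide_pos_pos zero_less_numeral norm_minus_commute)
    have "(\<lambda>k. D * (\<integral>y. h R k y \<partial>lborel)) \<longlonglongrightarrow> 0" by (intro tendsto_mult_right_zero a0)
    then have e1: "\<forall>\<^sub>F k in sequentially. D * (\<integral>y. h R k y \<partial>lborel) < \<epsilon> / 10"
      by (rule order_tendstoD(2)) (use \<epsilon> in simp)
    have "(\<lambda>k. (2 * C / \<delta>) * (\<integral>\<omega>. norm (\<xi> k \<omega> - \<zeta> \<omega>) \<partial>M)) \<longlonglongrightarrow> 0" by (intro tendsto_mult_right_zero L1)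
    then have e2: "\<forall>\<^sub>F k in sequentially. (2 * C / \<delta>) * (\<integral>\<omega>. norm (\<xi> k \<omega> - \<zeta> \<omega>) \<partial>M) < \<epsilon> / 10"
      by (rule order_tendstoD(2)) (use \<epsilon> in simp)
    show "\<forall>\<^sub>F k in sequentially. dist (\<integral>\<omega>. norm (f k (\<xi> k \<omega>) - g (\<zeta> \<omega>)) \<partial>M) 0 < \<epsilon>"
      using e1 e2
    proof eventually_elim
      case (elim k)
      have "(\<integral>\<omega>. norm (f k (\<xi> k \<omega>) - g (\<zeta> \<omega>)) \<partial>M)
         \<le> D * (\<integral>y. h R k y \<partial>lborel) + 2 * (D * (\<integral>y. h R j y \<partial>lborel)) + \<epsilon> / 10
       + (2 * C / \<delta>) * (\<integral>\<omega>. norm (\<xi> k \<omega> - \<zeta> \<omega>) \<partial>M) + (2 * C / R) * m"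
        using \<epsilon> by (intro key R0 \<delta>) auto
      also have "\<dots> < \<epsilon>" using elim j Rm \<epsilon> by argo
      finally show ?case by (simp add: integral_nonneg_AE)
    qed
  qed
qed

lemma (in prob_space) char_tendsto_of_L1:
  fixes f :: "nat \<Rightarrow> 'a \<Rightarrow> 'b::euclidean_space"
  assumes [measurable]: "\<And>k. f k \<in> borel_measurable M" "g \<in> borel_measurable M"
    and int: "\<And>k. integrable M (\<lambda>\<omega>. f k \<omega> - g \<omega>)"
    and L1: "(\<lambda>k. \<integral>\<omega>. norm (f k \<omega> - g \<omega>) \<partial>M) \<longlonglongrightarrow> 0"
  shows "(\<lambda>k. \<integral>\<omega>. iexp (\<xi> \<bullet> f k \<omega>) \<partial>M) \<longlonglongrightarrow> (\<integral>\<omega>. iexp (\<xi> \<bullet> g \<omega>) \<partial>M)"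
proof (rule LIM_zero_cancel, rule Lim_null_comparison)
  show "(\<lambda>k. norm \<xi> * (\<integral>\<omega>. norm (f k \<omega> - g \<omega>) \<partial>M)) \<longlonglongrightarrow> 0"
    by (intro tendsto_mult_right_zero L1)
  show "\<forall>\<^sub>F k in sequentially. norm ((\<integral>\<omega>. iexp (\<xi> \<bullet> f k \<omega>) \<partial>M) - (\<integral>\<omega>. iexp (\<xi> \<bullet> g \<omega>) \<partial>M))
     \<le> norm \<xi> * (\<integral>\<omega>. norm (f k \<omega> - g \<omega>) \<partial>M)"
  proof (intro always_eventually allI)
    fix k
    have "integrable M (\<lambda>\<omega>. iexp (\<xi> \<bullet> f k \<omega>))" "integrable M (\<lambda>\<omega>. iexp (\<xi> \<bullet> g \<omega>))"
      by (intro integrable_const_bound[where B=1]; auto)+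
    then have "norm ((\<integral>\<omega>. iexp (\<xi> \<bullet> f k \<omega>) \<partial>M) - (\<integral>\<omega>. iexp (\<xi> \<bullet> g \<omega>) \<partial>M))
       = norm (\<integral>\<omega>. iexp (\<xi> \<bullet> f k \<omega>) - iexp (\<xi> \<bullet> g \<omega>) \<partial>M)" by simp
    also have "\<dots> \<le> (\<integral>\<omega>. norm \<xi> * norm (f k \<omega> - g \<omega>) \<partial>M)"
    proof (rule order_trans[OF integral_norm_bound], rule integral_mono')
      show "integrable M (\<lambda>\<omega>. norm \<xi> * norm (f k \<omega> - g \<omega>))" using int[of k] by auto
      fix \<omega>
      have "norm (iexp (\<xi> \<bullet> f k \<omega>) - iexp (\<xi> \<bullet> g \<omega>)) \<le> \<bar>\<xi> \<bullet> f k \<omega> - \<xi> \<bullet> g \<omega>\<bar>"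
        by (rule norm_iexp_diff_le)
      also have "\<dots> = \<bar>\<xi> \<bullet> (f k \<omega> - g \<omega>)\<bar>" by (simp add: inner_diff_right)
      also have "\<dots> \<le> norm \<xi> * norm (f k \<omega> - g \<omega>)" by (rule Cauchy_Schwarz_ineq2)
      finally show "norm (iexp (\<xi> \<bullet> f k \<omega>) - iexp (\<xi> \<bullet> g \<omega>)) \<le> norm \<xi> * norm (f k \<omega> - g \<omega>)" .
    qed simp
    finally show "norm ((\<integral>\<omega>. iexp (\<xi> \<bullet> f k \<omega>) \<partial>M) - (\<integral>\<omega>. iexp (\<xi> \<bullet> g \<omega>) \<partial>M))
       \<le> norm \<xi> * (\<integral>\<omega>. norm (f k \<omega> - g \<omega>) \<partial>M)" by simp
  qed
qed

text \<open>A subsequence converges almost surely, and the exceptional null event belongs to \<open>F\<close>.\<close>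

lemma measurable_of_L1_limit:
  fixes f :: "nat \<Rightarrow> 'w \<Rightarrow> 'b::euclidean_space"
  assumes F: "subalgebra M F" "null_sets M \<subseteq> sets F"
    and f: "\<And>k. f k \<in> borel_measurable F" and g[measurable]: "g \<in> borel_measurable M"
    and int: "\<And>k. integrable M (\<lambda>\<omega>. f k \<omega> - g \<omega>)" and L1: "(\<lambda>k. \<integral>\<omega>. norm (f k \<omega> - g \<omega>) \<partial>M) \<longlonglongrightarrow> 0"
  shows "g \<in> borel_measurable F"
proof -
  have sp: "space F = space M" using F by (simp add: subalgebra_def)
  obtain r where r: "strict_mono r" "AE \<omega> in M. (\<lambda>n. f (r n) \<omega> - g \<omega>) \<longlonglongrightarrow> 0"
    using tendsto_L1_AE_subseq[OF int L1] by blast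
  define G where "G \<omega> = lim (\<lambda>n. f (r n) \<omega>)" for \<omega>
  have G[measurable]: "G \<in> borel_measurable F"
    unfolding G_def[abs_def] using f by (intro borel_measurable_lim_metric) auto
  have "AE \<omega> in M. g \<omega> = G \<omega>"
    using r(2)
  proof eventually_elim
    case (elim \<omega>)
    then have "(\<lambda>n. f (r n) \<omega>) \<longlonglongrightarrow> g \<omega>" by (simp add: LIM_zero_iff)
    then show ?case by (simp add: G_def limI)
  qed
  then obtain N where N: "N \<in> null_sets M" "{\<omega> \<in> space M. g \<omega> \<noteq> G \<omega>} \<subseteq> N"
    by (auto elim!: AE_E simp: null_sets_def)
  show ?thesis
  proof (rule measurableI)
    fix A :: "'b set" assume A: "A \<in> sets borel"
    have "g -` A \<inter> space F = (G -` A \<inter> space F - N) \<union> (g -` A \<inter> space M \<inter> N)"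
      using N(2) sp by auto
    moreover have "G -` A \<inter> space F - N \<in> sets F"
      using measurable_sets[OF G A] N F by auto
    moreover have "g -` A \<inter> space M \<inter> N \<in> null_sets M"
      using N(1) measurable_sets[OF g A] by (rule null_set_Int1[THEN back_subst[of "\<lambda>S. S \<in> null_sets M"]]) auto
    ultimately show "g -` A \<inter> space F \<in> sets F" using F(2) by auto
  qed simp
qed

text \<open>Along a path the drift is only Lebesgue measurable in time. Replacing it by a Borel function \<open>F\<close> makes
  Fubini's theorem available.\<close>

lemma lebesgue_on_integral_Borel:
  fixes f F :: "real \<Rightarrow> 'b::euclidean_space"
  assumes [measurable]: "F \<in> borel_measurable borel" and eq: "AE u in lborel. u \<in> {s..t} \<longrightarrow> f u = F u"
    and C: "AE u in lborel. u \<in> {s..t} \<longrightarrow> norm (F u) \<le> C"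
  shows "integrable (lebesgue_on {s..t}) f"
    "(\<integral>u. f u \<partial>lebesgue_on {s..t}) = (\<integral>u. indicator {s..t} u *\<^sub>R F u \<partial>lborel)"
    "integrable lborel (\<lambda>u. indicator {s..t} u *\<^sub>R F u)"
proof -
  show Fi: "integrable lborel (\<lambda>u. indicator {s..t} u *\<^sub>R F u)"
  proof (rule Bochner_Integration.integrable_bound)
    show "integrable lborel (\<lambda>u. indicator {s..t} u * C)"
      by (intro integrable_mult_left integrable_real_indicator emeasure_bounded_finite) auto
    show "AE u in lborel. norm (indicator {s..t} u *\<^sub>R F u) \<le> norm (indicator {s..t} u * C)"
      using C by eventually_elim (auto simp: indicator_def)
  qed simp
  have ae: "AE u in lebesgue. indicator {s..t} u *\<^sub>R F u = indicator {s..t} u *\<^sub>R f u"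
    using eq by (intro AE_completion) (auto elim!: eventually_mono simp: indicator_def)
  have Fm: "(\<lambda>u. indicator {s..t} u *\<^sub>R F u) \<in> borel_measurable lborel" by simp
  have Fl: "integrable lebesgue (\<lambda>u. indicator {s..t} u *\<^sub>R F u)"
    using Fi integrable_completion[OF Fm] by simp
  have fm: "(\<lambda>u. indicator {s..t} u *\<^sub>R f u) \<in> borel_measurable lebesgue"
    by (rule borel_measurable_AE[OF borel_measurable_integrable[OF Fl] ae])
  have fl: "integrable lebesgue (\<lambda>u. indicator {s..t} u *\<^sub>R f u)"
    by (rule integrable_cong_AE_imp[OF Fl fm]) (use ae in auto)
  then show "integrable (lebesgue_on {s..t}) f" by (simp add: integrable_restrict_space)
  have "(\<integral>u. f u \<partial>lebesgue_on {s..t}) = (\<integral>u. indicator {s..t} u *\<^sub>R f u \<partial>lebesgue)"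
    by (simp add: integral_restrict_space)
  also have "\<dots> = (\<integral>u. indicator {s..t} u *\<^sub>R F u \<partial>lebesgue)"
    using ae fm Fl by (intro integral_cong_AE) (auto dest: borel_measurable_integrable)
  also have "\<dots> = (\<integral>u. indicator {s..t} u *\<^sub>R F u \<partial>lborel)" by (rule integral_completion[OF Fm])
  finally show "(\<integral>u. f u \<partial>lebesgue_on {s..t}) = (\<integral>u. indicator {s..t} u *\<^sub>R F u \<partial>lborel)" .
qed

lemma (in pair_sigma_finite) AE_swap_measurable:
  assumes "Measurable.pred (M1 \<Otimes>\<^sub>M M2) (\<lambda>p. P (fst p) (snd p))" and "AE x in M1. AE y in M2. P x y"
  shows "AE y in M2. AE x in M1. P x y"
  using AE_commute[of P] assms by (simp add: pred_def)

context fbm_driver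
begin

text \<open>Both sides of the approximating equations converge in mean at every time: the solutions by assumption,
  the drift integrals because \<open>drift_convergence_fixed_time\<close> applies at almost every time and all drifts
  are bounded by \<open>C\<close>. Since both sides of the limiting equation are continuous in time, it holds almost
  surely for all times.\<close>

lemma limit_solves_sde:
  fixes g :: "nat \<Rightarrow> real \<times> (real ^ 'd) \<Rightarrow> real ^ 'd" and b :: "real \<Rightarrow> real ^ 'd \<Rightarrow> real ^ 'd"
    and X :: "nat \<Rightarrow> real \<Rightarrow> 'w \<Rightarrow> real ^ 'd" and Z :: "real \<Rightarrow> 'w \<Rightarrow> real ^ 'd"
  assumes s: "0 \<le> s" "s < T" and H': "H < 1 / (2 * (real CARD('d) + 3))"
    and g: "\<And>n. continuous_on UNIV (g n)"
    and C: "\<And>n u y. u \<in> {0..T} \<Longrightarrow> norm (g n (u, y)) \<le> C"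
    and conv: "AE p in lborel. fst p \<in> {0..T} \<longrightarrow> (\<lambda>n. g n p) \<longlonglongrightarrow> b (fst p) (snd p)"
    and X: "\<And>k. strong_solution M T B (\<lambda>u y. g k (u, y)) s x (X k)"
    and Z: "\<And>t. t \<in> {s..T} \<Longrightarrow> Z t \<in> borel_measurable M" "AE \<omega> in M. continuous_on {s..T} (\<lambda>t. Z t \<omega>)"
    and int: "\<And>t. t \<in> {s..T} \<Longrightarrow> integrable M (Z t)" "\<And>t k. t \<in> {s..T} \<Longrightarrow> integrable M (\<lambda>\<omega>. X k t \<omega> - Z t \<omega>)"
    and L1: "\<And>t. t \<in> {s..T} \<Longrightarrow> (\<lambda>k. \<integral>\<omega>. norm (X k t \<omega> - Z t \<omega>) \<partial>M) \<longlonglongrightarrow> 0"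
  shows "strong_solution M T B b s x Z"
proof -
  interpret L: pair_sigma_finite lborel M by unfold_locales
  have C0: "0 \<le> C" using C[of 0 0 0] s by (auto intro: order_trans[OF norm_ge_zero])
  have ne: "cbox s T \<noteq> {}" using s by simp
  have XM: "X k t \<in> borel_measurable (augmented_filtration M B t)" "X k t \<in> borel_measurable M" if "t \<in> {s..T}" for k t
  proof -
    show "X k t \<in> borel_measurable (augmented_filtration M B t)" using X[of k] that by (simp add: strong_solution_def)
    then show "X k t \<in> borel_measurable M"
      using that by (intro measurable_from_subalg[OF subalgebra_augmented_filtration]) auto
  qed
  have adapted: "Z t \<in> borel_measurable (augmented_filtration M B t)" if t: "t \<in> {s..T}" for t
  proof (rule measurable_of_L1_limit[OF subalgebra_augmented_filtration _ XM(1)[OF t] Z(1)[OF t] int(2)[OF t] L1[OF t]])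
    show "t \<le> T" using t by simp
    then show "null_sets M \<subseteq> sets (augmented_filtration M B t)" by (subst sets_augmented_filtration) auto
  qed
  have "\<forall>k. \<exists>X'. (\<forall>w. continuous_on UNIV (\<lambda>p. X' p w)) \<and> (\<lambda>(p, w). X' p w) \<in> borel_measurable (borel \<Otimes>\<^sub>M M) \<and>
    (\<forall>p. X' p \<in> borel_measurable M) \<and> (AE w in M. \<forall>p\<in>{s..T}. X' p w = X k p w)"
  proof
    fix k
    show "\<exists>X'. (\<forall>w. continuous_on UNIV (\<lambda>p. X' p w)) \<and> (\<lambda>(p, w). X' p w) \<in> borel_measurable (borel \<Otimes>\<^sub>M M) \<and>
      (\<forall>p. X' p \<in> borel_measurable M) \<and> (AE w in M. \<forall>p\<in>{s..T}. X' p w = X k p w)"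
  proof (rule continuous_modification_cbox[OF ne, of "X k" M])
    show "X k p \<in> borel_measurable M" if "p \<in> cbox s T" for p using that by (intro XM(2)) simp
    show "AE w in M. continuous_on (cbox s T) (\<lambda>p. X k p w)" using X[of k] by (simp add: strong_solution_def)
  next
    fix F' assume "\<And>w. continuous_on UNIV (\<lambda>p. F' p w)" "(\<lambda>(p, w). F' p w) \<in> borel_measurable (borel \<Otimes>\<^sub>M M)"
      "\<And>p. F' p \<in> borel_measurable M" "AE w in M. \<forall>p\<in>cbox s T. F' p w = X k p w"
    then show ?thesis by (intro exI[of _ F']) simp
  qed
  qed
  from choice[OF this] obtain X' where X'_all: "\<forall>k. (\<forall>w. continuous_on UNIV (\<lambda>p. X' k p w)) \<and>
    (\<lambda>(p, w). X' k p w) \<in> borel_measurable (borel \<Otimes>\<^sub>M M) \<and>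
    (\<forall>p. X' k p \<in> borel_measurable M) \<and> (AE w in M. \<forall>p\<in>{s..T}. X' k p w = X k p w)" by (elim exE)
  then have X': "\<And>k w. continuous_on UNIV (\<lambda>p. X' k p w)" "\<And>k. (\<lambda>(p, w). X' k p w) \<in> borel_measurable (borel \<Otimes>\<^sub>M M)"
    "\<And>k p. X' k p \<in> borel_measurable M" "\<And>k. AE w in M. \<forall>p\<in>{s..T}. X' k p w = X k p w" by simp_all
  obtain Z' where Z': "\<And>w. continuous_on UNIV (\<lambda>p. Z' p w)" "(\<lambda>(p, w). Z' p w) \<in> borel_measurable (borel \<Otimes>\<^sub>M M)"
    "\<And>p. Z' p \<in> borel_measurable M" "AE w in M. \<forall>p\<in>{s..T}. Z' p w = Z p w"
  proof (rule continuous_modification_cbox[OF ne, of Z M])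
    show "Z p \<in> borel_measurable M" if "p \<in> cbox s T" for p using that by (intro Z(1)) simp
    show "AE w in M. continuous_on (cbox s T) (\<lambda>p. Z p w)" using Z(2) by simp
  qed (rule that; simp)
  have sets_eq: "sets (lborel \<Otimes>\<^sub>M M) = sets (borel \<Otimes>\<^sub>M M)" by (intro sets_pair_measure_cong) auto
  have [measurable]: "(\<lambda>p. X' k (fst p) (snd p)) \<in> borel_measurable (lborel \<Otimes>\<^sub>M M)"
    "(\<lambda>p. Z' (fst p) (snd p)) \<in> borel_measurable (lborel \<Otimes>\<^sub>M M)" for k
    using X'(2)[of k] Z'(2) by (simp_all add: split_beta' cong: measurable_cong_sets[OF sets_eq refl])
  have X'X: "AE \<omega> in M. X' k t \<omega> = X k t \<omega>" if "t \<in> {s..T}" for k t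
    using X'(4)[of k] by eventually_elim (use that in auto)
  have Z'Z: "AE \<omega> in M. Z' t \<omega> = Z t \<omega>" if "t \<in> {s..T}" for t
    using Z'(4) by eventually_elim (use that in auto)
  have Z'int: "integrable M (Z' t)" if "t \<in> {s..T}" for t
    by (rule integrable_cong_AE_imp[OF int(1)[OF that] Z'(3)]) (use Z'Z[OF that] in \<open>auto elim: eventually_mono\<close>)
  have XZ: "AE \<omega> in M. X' k t \<omega> - Z' t \<omega> = X k t \<omega> - Z t \<omega>" if "t \<in> {s..T}" for k t
    using X'X[OF that, of k] Z'Z[OF that] by eventually_elim simp
  have X'int: "integrable M (\<lambda>\<omega>. X' k t \<omega> - Z' t \<omega>)" if t: "t \<in> {s..T}" for t k
  proof (rule integrable_cong_AE_imp[OF int(2)[OF t, of k]])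
    show "(\<lambda>\<omega>. X' k t \<omega> - Z' t \<omega>) \<in> borel_measurable M" using X'(3) Z'(3) by measurable
    show "AE \<omega> in M. X k t \<omega> - Z t \<omega> = X' k t \<omega> - Z' t \<omega>" using XZ[OF t, of k] by (auto elim: eventually_mono)
  qed
  have X'L1: "(\<lambda>k. \<integral>\<omega>. norm (X' k t \<omega> - Z' t \<omega>) \<partial>M) \<longlonglongrightarrow> 0" if t: "t \<in> {s..T}" for t
  proof -
    have "(\<integral>\<omega>. norm (X' k t \<omega> - Z' t \<omega>) \<partial>M) = (\<integral>\<omega>. norm (X k t \<omega> - Z t \<omega>) \<partial>M)" for k
      using X'int[OF t, of k] int(2)[OF t, of k] XZ[OF t, of k]
      by (intro integral_cong_AE) (auto dest: borel_measurable_integrable elim: eventually_mono)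
    then show ?thesis using L1[OF t] by simp
  qed
  \<comment> \<open>The time \<open>s\<close> is excluded, because the law of the solution is a point mass there.\<close>
  have laws: "\<exists>D\<ge>0. (\<forall>k. \<forall>A\<in>sets borel. emeasure (distr M borel (X' k t)) A \<le> ennreal D * emeasure lborel A) \<and>
     (\<forall>A\<in>sets borel. emeasure (distr M borel (Z' t)) A \<le> ennreal D * emeasure lborel A)" if t: "s < t" "t \<le> T" for t
  proof -
    have tT: "t \<in> {s..T}" using t by auto
    note [measurable] = X'(3) Z'(3) XM(2)[OF tT]
    obtain Q where Q: "\<And>b x X \<xi>. strong_solution M T B b s x X \<Longrightarrow> (\<And>r y. r \<in> {s..T} \<Longrightarrow> norm (b r y) \<le> C) \<Longrightarrow>
       norm (\<integral>\<omega>. iexp (\<xi> \<bullet> X t \<omega>) \<partial>M) * (\<Prod>i\<in>UNIV. 1 + (\<xi> $ i)\<^sup>2) \<le> Q"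
      using uniform_solution_char_bound[OF s(1) t C0 H'] by blast
    have QX: "norm (\<integral>\<omega>. iexp (\<xi> \<bullet> X' k t \<omega>) \<partial>M) * (\<Prod>i\<in>UNIV. 1 + (\<xi> $ i)\<^sup>2) \<le> Q" for k \<xi>
    proof -
      have "(\<integral>\<omega>. iexp (\<xi> \<bullet> X' k t \<omega>) \<partial>M) = (\<integral>\<omega>. iexp (\<xi> \<bullet> X k t \<omega>) \<partial>M)"
        using X'X[OF tT, of k] by (intro integral_cong_AE) (auto elim: eventually_mono)
      then show ?thesis using Q[OF X, of k \<xi>] C s by simp
    qed
    have QZ: "norm (\<integral>\<omega>. iexp (\<xi> \<bullet> Z' t \<omega>) \<partial>M) * (\<Prod>i\<in>UNIV. 1 + (\<xi> $ i)\<^sup>2) \<le> Q" for \<xi>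
    proof (rule LIMSEQ_le_const2)
      show "(\<lambda>k. norm (\<integral>\<omega>. iexp (\<xi> \<bullet> X' k t \<omega>) \<partial>M) * (\<Prod>i\<in>UNIV. 1 + (\<xi> $ i)\<^sup>2))
         \<longlonglongrightarrow> norm (\<integral>\<omega>. iexp (\<xi> \<bullet> Z' t \<omega>) \<partial>M) * (\<Prod>i\<in>UNIV. 1 + (\<xi> $ i)\<^sup>2)"
        by (intro tendsto_intros char_tendsto_of_L1 X'(3) Z'(3) X'int X'L1 tT)
    qed (use QX in auto)
    have D: "0 \<le> Q * cube_const ^ CARD('d)"
    proof -
      have "0 \<le> Q" using QZ[of 0] by (rule order_trans[rotated]) (auto intro!: mult_nonneg_nonneg prod_nonneg)
      then show ?thesis by (simp add: cube_const_def add_nonneg_nonneg)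
    qed
    show ?thesis
      by (intro exI[of _ "Q * cube_const ^ CARD('d)"] conjI D allI ballI law_le_lebesgue X'(3) Z'(3) QX QZ)
  qed
  \<comment> \<open>\<open>bt\<close> is a Borel representative of the drift \<open>b\<close>, which agrees with it outside the null set \<open>N\<close>.\<close>
  obtain N where N: "N \<in> null_sets lborel" "{p. \<not> (fst p \<in> {0..T} \<longrightarrow> (\<lambda>n. g n p) \<longlonglongrightarrow> b (fst p) (snd p))} \<subseteq> N"
    using conv by (auto elim!: AE_E simp: null_sets_def)
  have [measurable]: "N \<in> sets borel" using N(1) by auto
  have [measurable]: "g n \<in> borel_measurable borel" for n using g by (rule borel_measurable_continuous_onI)
  define bt where "bt p = (if p \<in> N \<or> fst p \<notin> {0..T} then 0 else lim (\<lambda>n. g n p))" for p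
  have [measurable]: "bt \<in> borel_measurable borel"
  proof -
    have "(\<lambda>p::real \<times> (real ^ 'd). fst p) \<in> borel_measurable borel" by (intro borel_measurable_continuous_onI continuous_intros)
    then have [measurable]: "{p::real \<times> (real ^ 'd). fst p \<notin> {0..T}} \<in> sets borel" by measurable
    have "(\<lambda>p. if p \<in> N \<union> {p. fst p \<notin> {0..T}} then 0 else lim (\<lambda>n. g n p)) \<in> borel_measurable borel"
      by (intro measurable_If_set borel_measurable_lim_metric) measurable
    then show ?thesis by (simp add: bt_def[abs_def])
  qed
  have bt_lim: "(\<lambda>n. g n p) \<longlonglongrightarrow> bt p" "bt p = b (fst p) (snd p)" if "p \<notin> N" "fst p \<in> {0..T}" for p
  proof -
    have l: "(\<lambda>n. g n p) \<longlonglongrightarrow> b (fst p) (snd p)" using N(2) that by auto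
    then show "bt p = b (fst p) (snd p)" using that by (simp add: bt_def limI)
    with l show "(\<lambda>n. g n p) \<longlonglongrightarrow> bt p" by simp
  qed
  have bt_C: "norm (bt p) \<le> C" for p
  proof (cases "p \<in> N \<or> fst p \<notin> {0..T}")
    case False
    then have "(\<lambda>n. norm (g n p)) \<longlonglongrightarrow> norm (bt p)" using bt_lim by (intro tendsto_norm) auto
    moreover have "norm (g n p) \<le> C" for n using C[of "fst p" n "snd p"] False by simp
    ultimately show ?thesis by (intro LIMSEQ_le_const2) auto
  qed (use C0 in \<open>auto simp: bt_def\<close>)
  have Nsec: "AE u in lborel. AE y in lborel. (u, y) \<notin> N"
  proof -
    have "AE p in lborel \<Otimes>\<^sub>M lborel. p \<notin> N" by (subst lborel_prod) (rule AE_not_in[OF N(1)])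
    then show ?thesis by (rule lborel_pair.AE_pair)
  qed
  have u_ne: "AE u in lborel. u \<noteq> s" by (rule AE_lborel_singleton)
  \<comment> \<open>The mean error of the drift at time \<open>u\<close>; it tends to \<open>0\<close> for almost every \<open>u\<close>.\<close>
  define e where "e k u = (\<integral>\<omega>. norm (g k (u, X' k u \<omega>) - bt (u, Z' u \<omega>)) \<partial>M)" for k u
  have jm[measurable]: "(\<lambda>p. g k (fst p, X' k (fst p) (snd p))) \<in> borel_measurable (lborel \<Otimes>\<^sub>M M)"
    "(\<lambda>p. bt (fst p, Z' (fst p) (snd p))) \<in> borel_measurable (lborel \<Otimes>\<^sub>M M)" for k
    by (rule measurable_compose[where N=borel]; simp add: borel_prod[symmetric]; measurable)+
  have e_meas[measurable]: "e k \<in> borel_measurable lborel" for k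
    unfolding e_def[abs_def] by (rule borel_measurable_lebesgue_integral) (simp add: split_beta')
  have bd: "norm (g k (u, y) - bt (u, z)) \<le> 2 * C" if "u \<in> {0..T}" for k u y z
    using C[OF that, of k y] bt_C[of "(u, z)"] norm_triangle_ineq4[of "g k (u, y)" "bt (u, z)"] by linarith
  have e_bd: "0 \<le> e k u" "u \<in> {s..T} \<Longrightarrow> e k u \<le> 2 * C" for k u
  proof -
    show "0 \<le> e k u" unfolding e_def by (rule integral_nonneg_AE) auto
    assume u: "u \<in> {s..T}"
    have "e k u \<le> (\<integral>\<omega>. 2 * C \<partial>M)"
      unfolding e_def using u s C0 by (intro integral_mono') (auto intro!: bd)
    then show "e k u \<le> 2 * C" by (simp add: prob_space)
  qed
  have e_abs: "e k u \<le> \<bar>2 * C\<bar>" if "s \<le> u" "u \<le> T" for k u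
    using e_bd(2)[of u k] that C0 by simp
  have e_conv: "AE u in lborel. u \<in> {s..T} \<longrightarrow> (\<lambda>k. e k u) \<longlonglongrightarrow> 0"
    using Nsec u_ne
  proof eventually_elim
    case (elim u)
    show ?case
    proof
      assume u: "u \<in> {s..T}"
      then have su: "s < u" "u \<le> T" using elim by auto
      obtain D where D: "0 \<le> D" "\<And>k A. A \<in> sets borel \<Longrightarrow> emeasure (distr M borel (X' k u)) A \<le> ennreal D * emeasure lborel A"
        "\<And>A. A \<in> sets borel \<Longrightarrow> emeasure (distr M borel (Z' u)) A \<le> ennreal D * emeasure lborel A"
        using laws[OF su] by blast
      have u0: "u \<in> {0..T}" using u s by auto
      show "(\<lambda>k. e k u) \<longlonglongrightarrow> 0"
        unfolding e_def
      proof (rule drift_convergence_fixed_time[where f="\<lambda>k y. g k (u, y)" and g="\<lambda>y. bt (u, y)" and C=C and D=D])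
        show "continuous_on UNIV (\<lambda>y. g k (u, y))" for k
          by (rule continuous_on_compose2[OF g]) (auto intro!: continuous_intros)
        show "(\<lambda>y. bt (u, y)) \<in> borel_measurable borel"
        proof -
          have "(\<lambda>y::real ^ 'd. (u, y)) \<in> borel_measurable borel" by (intro borel_measurable_continuous_onI continuous_intros)
          then show ?thesis by (rule measurable_compose) simp
        qed
        show "AE y in lborel. (\<lambda>k. g k (u, y)) \<longlonglongrightarrow> bt (u, y)"
          using elim(1) by eventually_elim (use u0 in \<open>auto intro!: bt_lim\<close>)
      qed (use u u0 X'(3) Z'(3) D C bt_C Z'int X'int X'L1 in auto)
    qed
  qed
  define I where "I k = (\<integral>u. indicator {s..T} u * e k u \<partial>lborel)" for k
  have indint: "integrable lborel (\<lambda>u. indicator {s..T} u * (2 * C))"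
    by (intro integrable_mult_left integrable_real_indicator emeasure_bounded_finite) auto
  have I0: "I \<longlonglongrightarrow> 0"
  proof -
    have "I \<longlonglongrightarrow> integral\<^sup>L lborel (\<lambda>u::real. 0)"
      unfolding I_def[abs_def]
    proof (rule integral_dominated_convergence[OF _ _ indint])
      show "AE u in lborel. (\<lambda>k. indicator {s..T} u * e k u) \<longlonglongrightarrow> 0"
        using e_conv by eventually_elim (auto simp: indicator_def)
      show "AE u in lborel. norm (indicator {s..T} u * e k u) \<le> indicator {s..T} u * (2 * C)" for k
        using e_bd by (intro AE_I2) (auto simp: indicator_def)
    qed auto
    then show ?thesis by simp
  qed
  have sec1: "(\<lambda>u. g k (u, X' k u \<omega>)) \<in> borel_measurable borel" if "\<omega> \<in> space M" for k \<omega>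
    using measurable_compose[OF measurable_Pair2'[OF that] jm(1)[of k]] by simp
  have sec2: "(\<lambda>u. bt (u, Z' u \<omega>)) \<in> borel_measurable borel" if "\<omega> \<in> space M" for \<omega>
    using measurable_compose[OF measurable_Pair2'[OF that] jm(2)] by simp
  \<comment> \<open>The drift integrals in Borel form, which are jointly measurable and hence subject to Fubini.\<close>
  define Jk where "Jk k t \<omega> = (\<integral>u. indicator {s..t} u *\<^sub>R g k (u, X' k u \<omega>) \<partial>lborel)" for k t \<omega>
  define J where "J t \<omega> = (\<integral>u. indicator {s..t} u *\<^sub>R bt (u, Z' u \<omega>) \<partial>lborel)" for t \<omega>
  have jms[measurable]: "(\<lambda>p. g k (snd p, X' k (snd p) (fst p))) \<in> borel_measurable (M \<Otimes>\<^sub>M lborel)"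
    "(\<lambda>p. bt (snd p, Z' (snd p) (fst p))) \<in> borel_measurable (M \<Otimes>\<^sub>M lborel)" for k
    using measurable_compose[OF measurable_pair_swap' jm(1)[of k]] measurable_compose[OF measurable_pair_swap' jm(2)]
    by (simp_all add: split_beta')
  have Jk_meas[measurable]: "Jk k t \<in> borel_measurable M" for k t
    unfolding Jk_def[abs_def] by (rule lborel.borel_measurable_lebesgue_integral) (unfold split_beta', measurable)
  have J_meas[measurable]: "J t \<in> borel_measurable M" for t
    unfolding J_def[abs_def] by (rule lborel.borel_measurable_lebesgue_integral) (unfold split_beta', measurable)
  have JJ: "integrable M (\<lambda>\<omega>. norm (Jk k t \<omega> - J t \<omega>))" "(\<integral>\<omega>. norm (Jk k t \<omega> - J t \<omega>) \<partial>M) \<le> I k" if t: "t \<in> {s..T}" for k t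
  proof -
    let ?h = "\<lambda>p. indicator {s..t} (fst p) * norm (g k (fst p, X' k (fst p) (snd p)) - bt (fst p, Z' (fst p) (snd p)))"
    have bint: "integrable (lborel \<Otimes>\<^sub>M M) (\<lambda>p. indicator ({s..T} \<times> space M) p * (2 * C))"
      using s by (intro integrable_mult_left integrable_real_indicator)
        (auto simp: emeasure_pair_measure_Times emeasure_space_1)
    have hint: "integrable (lborel \<Otimes>\<^sub>M M) ?h"
    proof (rule Bochner_Integration.integrable_bound[OF bint])
      show "AE p in lborel \<Otimes>\<^sub>M M. norm (?h p) \<le> norm (indicator ({s..T} \<times> space M) p * (2 * C))"
        using t s bd C0 by (intro AE_I2) (auto simp: indicator_def space_pair_measure)
    qed measurable
    have le: "norm (Jk k t \<omega> - J t \<omega>) \<le> (\<integral>u. ?h (u, \<omega>) \<partial>lborel)" if \<omega>: "\<omega> \<in> space M" for \<omega>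
    proof -
      have "integrable lborel (\<lambda>u. indicator {s..t} u *\<^sub>R g k (u, X' k u \<omega>))"
        using sec1[OF \<omega>, of k] C t s by (intro lebesgue_on_integral_Borel(3)[where f="\<lambda>u. g k (u, X' k u \<omega>)" and C=C]) auto
      moreover have "integrable lborel (\<lambda>u. indicator {s..t} u *\<^sub>R bt (u, Z' u \<omega>))"
        using sec2[OF \<omega>] bt_C by (intro lebesgue_on_integral_Borel(3)[where f="\<lambda>u. bt (u, Z' u \<omega>)" and C=C]) auto
      ultimately have "Jk k t \<omega> - J t \<omega> = (\<integral>u. indicator {s..t} u *\<^sub>R g k (u, X' k u \<omega>) - indicator {s..t} u *\<^sub>R bt (u, Z' u \<omega>) \<partial>lborel)"
        by (simp add: Jk_def J_def)
      also have "norm \<dots> \<le> (\<integral>u. norm (indicator {s..t} u *\<^sub>R g k (u, X' k u \<omega>) - indicator {s..t} u *\<^sub>R bt (u, Z' u \<omega>)) \<partial>lborel)"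
        by (rule integral_norm_bound)
      also have "\<dots> = (\<integral>u. ?h (u, \<omega>) \<partial>lborel)"
        by (intro Bochner_Integration.integral_cong refl) (auto simp: indicator_def)
      finally show ?thesis .
    qed
    have hint2: "integrable M (\<lambda>\<omega>. \<integral>u. ?h (u, \<omega>) \<partial>lborel)"
      using L.integrable_snd[of "\<lambda>u \<omega>. ?h (u, \<omega>)"] hint by (simp add: split_beta')
    show int1: "integrable M (\<lambda>\<omega>. norm (Jk k t \<omega> - J t \<omega>))"
      by (rule Bochner_Integration.integrable_bound[OF hint2]) (use le in \<open>auto intro!: AE_I2 order_trans[OF le]\<close>)
    have "(\<integral>\<omega>. norm (Jk k t \<omega> - J t \<omega>) \<partial>M) \<le> (\<integral>\<omega>. (\<integral>u. ?h (u, \<omega>) \<partial>lborel) \<partial>M)"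
      using int1 hint2 le by (intro integral_mono) auto
    also have "\<dots> = (\<integral>u. (\<integral>\<omega>. ?h (u, \<omega>) \<partial>M) \<partial>lborel)"
      using L.Fubini_integral[of "\<lambda>u \<omega>. ?h (u, \<omega>)"] hint by (simp add: split_beta')
    also have "\<dots> = (\<integral>u. indicator {s..t} u * e k u \<partial>lborel)" by (simp add: e_def)
    also have "\<dots> \<le> I k"
      unfolding I_def
    proof (rule integral_mono')
      show "integrable lborel (\<lambda>u. indicator {s..T} u * e k u)"
        by (rule Bochner_Integration.integrable_bound[OF indint]) (use e_bd e_abs in \<open>auto simp: indicator_def intro!: AE_I2\<close>)
    qed (use e_bd t in \<open>auto simp: indicator_def\<close>)
    finally show "(\<integral>\<omega>. norm (Jk k t \<omega> - J t \<omega>) \<partial>M) \<le> I k" .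
  qed
  have Xeq: "AE \<omega> in M. X k t \<omega> = x + Jk k t \<omega> + B t \<omega> - B s \<omega>" if t: "t \<in> {s..T}" for k t
  proof -
    have "AE \<omega> in M. \<forall>t\<in>{s..T}. integrable (lebesgue_on {s..t}) (\<lambda>u. g k (u, X k u \<omega>)) \<and>
        X k t \<omega> = x + (\<integral>u. g k (u, X k u \<omega>) \<partial>lebesgue_on {s..t}) + B t \<omega> - B s \<omega>"
      using X[of k] by (simp add: strong_solution_def)
    then show ?thesis
      using X'(4)[of k] AE_space
    proof eventually_elim
      case (elim \<omega>)
      have "(\<integral>u. g k (u, X k u \<omega>) \<partial>lebesgue_on {s..t}) = Jk k t \<omega>"
        unfolding Jk_def using sec1[OF elim(3), of k] C t s elim(2)
        by (intro lebesgue_on_integral_Borel(2)[where C=C]) auto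
      then show ?case using elim(1) t by auto
    qed
  qed
  have Zeq: "AE \<omega> in M. Z t \<omega> = x + J t \<omega> + B t \<omega> - B s \<omega>" if t: "t \<in> {s..T}" for t
  proof -
    have BM: "B t \<in> borel_measurable M" "B s \<in> borel_measurable M" using t s by (auto intro!: B_measurable)
    note [measurable] = BM Z(1)[OF t]
    let ?W = "\<lambda>\<omega>. Z t \<omega> - (x + J t \<omega> + B t \<omega> - B s \<omega>)"
    have le: "AE \<omega> in M. norm (?W \<omega>) \<le> norm (X k t \<omega> - Z t \<omega>) + norm (Jk k t \<omega> - J t \<omega>)" for k
      using Xeq[OF t, of k]
    proof eventually_elim
      case (elim \<omega>)
      have Weq: "?W \<omega> = (Jk k t \<omega> - J t \<omega>) - (X k t \<omega> - Z t \<omega>)" unfolding elim by simp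
      have "norm (?W \<omega>) \<le> norm (Jk k t \<omega> - J t \<omega>) + norm (X k t \<omega> - Z t \<omega>)"
        unfolding Weq by (rule norm_triangle_ineq4)
      then show ?case by linarith
    qed
    have bi: "integrable M (\<lambda>\<omega>. norm (X k t \<omega> - Z t \<omega>) + norm (Jk k t \<omega> - J t \<omega>))" for k
      using int(2)[OF t, of k] JJ(1)[OF t, of k] by auto
    have Wi: "integrable M ?W"
      by (rule Bochner_Integration.integrable_bound[OF bi[of 0]]) (use le[of 0] in auto)
    have "(\<integral>\<omega>. norm (?W \<omega>) \<partial>M) \<le> (\<integral>\<omega>. norm (X k t \<omega> - Z t \<omega>) \<partial>M) + I k" for k
    proof -
      have "(\<integral>\<omega>. norm (?W \<omega>) \<partial>M) \<le> (\<integral>\<omega>. norm (X k t \<omega> - Z t \<omega>) + norm (Jk k t \<omega> - J t \<omega>) \<partial>M)"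
        using Wi bi le by (intro integral_mono_AE) auto
      also have "\<dots> = (\<integral>\<omega>. norm (X k t \<omega> - Z t \<omega>) \<partial>M) + (\<integral>\<omega>. norm (Jk k t \<omega> - J t \<omega>) \<partial>M)"
        using int(2)[OF t, of k] JJ(1)[OF t, of k] by (intro Bochner_Integration.integral_add) auto
      finally show ?thesis using JJ(2)[OF t, of k] by simp
    qed
    moreover have "(\<lambda>k. (\<integral>\<omega>. norm (X k t \<omega> - Z t \<omega>) \<partial>M) + I k) \<longlonglongrightarrow> 0"
      by (intro tendsto_add_zero L1[OF t] I0)
    ultimately have "(\<integral>\<omega>. norm (?W \<omega>) \<partial>M) \<le> 0" by (intro LIMSEQ_le_const) auto
    then have "(\<integral>\<omega>. norm (?W \<omega>) \<partial>M) = 0" by (intro antisym) (auto intro: integral_nonneg_AE)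
    then have "AE \<omega> in M. norm (?W \<omega>) = 0"
      using integral_nonneg_eq_0_iff_AE[of M "\<lambda>\<omega>. norm (?W \<omega>)"] Wi by auto
    then show ?thesis by eventually_elim simp
  qed
  obtain QS where QS: "countable QS" "QS \<subseteq> {s..T}" and clQS: "{s..T} \<subseteq> closure QS" by (rule separable)
  have "AE \<omega> in M. \<forall>t\<in>QS. Z t \<omega> = x + J t \<omega> + B t \<omega> - B s \<omega>"
    using QS Zeq by (subst AE_ball_countable) auto
  moreover have Bc: "AE \<omega> in M. continuous_on {0..T} (\<lambda>t. B t \<omega>)" using fbm by (simp add: fractional_brownian_motion_def)
  \<comment> \<open>Almost every path avoids \<open>N\<close> at almost every time, as the law of \<open>Z' u\<close> does not charge Lebesgue null sets.\<close>
  moreover have "AE \<omega> in M. AE u in lborel. u \<in> {s..T} \<longrightarrow> (u, Z' u \<omega>) \<notin> N"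
  proof (rule L.AE_swap_measurable)
    have [measurable]: "(\<lambda>p. (fst p, Z' (fst p) (snd p))) \<in> borel_measurable (lborel \<Otimes>\<^sub>M M)"
      by (simp add: borel_prod[symmetric])
    show "Measurable.pred (lborel \<Otimes>\<^sub>M M) (\<lambda>p. fst p \<in> {s..T} \<longrightarrow> (fst p, Z' (fst p) (snd p)) \<notin> N)" by measurable
    show "AE u in lborel. AE \<omega> in M. u \<in> {s..T} \<longrightarrow> (u, Z' u \<omega>) \<notin> N"
      using Nsec u_ne
    proof eventually_elim
      case (elim u)
      show ?case
      proof (cases "u \<in> {s..T}")
        case True
        then have su: "s < u" "u \<le> T" using elim by auto
        obtain D where D: "0 \<le> D" "\<And>A. A \<in> sets borel \<Longrightarrow> emeasure (distr M borel (Z' u)) A \<le> ennreal D * emeasure lborel A"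
          using laws[OF su] by blast
        define A where "A = {y. (u, y) \<in> N}"
        have A[measurable]: "A \<in> sets borel"
        proof -
          have "(\<lambda>y::real ^ 'd. (u, y)) \<in> borel_measurable borel" by (intro borel_measurable_continuous_onI continuous_intros)
          from measurable_sets[OF this, of N] show ?thesis by (simp add: A_def vimage_def)
        qed
        have "AE y in lborel. y \<notin> A" using elim(1) by (simp add: A_def)
        then have "emeasure lborel A = 0" by (subst (asm) AE_iff_measurable[OF _ refl]) auto
        then have "emeasure (distr M borel (Z' u)) A = 0" using D(2)[OF A] by simp
        then have "AE y in distr M borel (Z' u). y \<notin> A" by (intro AE_not_in) (auto simp: null_sets_def)
        then have "AE \<omega> in M. Z' u \<omega> \<notin> A" by (subst (asm) AE_distr_iff) (use Z'(3) in auto)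
        then show ?thesis by eventually_elim (simp add: A_def)
      next
        case False
        then show ?thesis by (intro AE_I2) auto
      qed
    qed
  qed
  ultimately have "AE \<omega> in M. \<forall>t\<in>{s..T}. integrable (lebesgue_on {s..t}) (\<lambda>u. b u (Z u \<omega>)) \<and>
        Z t \<omega> = x + (\<integral>u. b u (Z u \<omega>) \<partial>lebesgue_on {s..t}) + B t \<omega> - B s \<omega>"
    using Z(2) Z'(4) AE_space
  proof eventually_elim
    case (elim \<omega>)
    have beq: "AE u in lborel. u \<in> {s..t} \<longrightarrow> b u (Z u \<omega>) = bt (u, Z' u \<omega>)" if "t \<in> {s..T}" for t
      using elim(3) by eventually_elim (use elim(5) that s in \<open>auto simp: bt_lim(2)\<close>)
    have J: "integrable (lebesgue_on {s..t}) (\<lambda>u. b u (Z u \<omega>))" "(\<integral>u. b u (Z u \<omega>) \<partial>lebesgue_on {s..t}) = J t \<omega>" if t: "t \<in> {s..T}" for t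
      unfolding J_def using sec2[OF elim(6)] beq[OF t] bt_C by (auto intro!: lebesgue_on_integral_Borel(1,2)[where C=C])
    have Jlip: "norm (J t \<omega> - J u \<omega>) \<le> C * \<bar>t - u\<bar>" if tu: "t \<in> {s..T}" "u \<in> {s..T}" for t u
    proof -
      have *: "norm (J t \<omega> - J u \<omega>) \<le> C * (t - u)" if tu: "t \<in> {s..T}" "u \<in> {s..T}" "u \<le> t" for t u
      proof -
        have bi: "integrable (lebesgue_on {s..t}) (\<lambda>u. bt (u, Z' u \<omega>))" "J t \<omega> = (\<integral>u. bt (u, Z' u \<omega>) \<partial>lebesgue_on {s..t})" for t
          using lebesgue_on_integral_Borel(1,2)[OF sec2[OF elim(6)], of s t "\<lambda>u. bt (u, Z' u \<omega>)" C] bt_C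
          by (simp_all add: J_def)
        show ?thesis unfolding bi(2) using tu bt_C C0 by (intro norm_lebesgue_integral_diff_le[OF bi(1)]) auto
      qed
      show ?thesis using *[of t u] *[of u t] tu by (cases "u \<le> t") (auto simp: norm_minus_commute abs_real_def)
    qed
    have "continuous_on {s..T} (\<lambda>t. J t \<omega>)"
    proof (rule continuous_onI)
      fix u e :: real assume "u \<in> {s..T}" "0 < e"
      show "\<exists>d>0. \<forall>t\<in>{s..T}. dist t u < d \<longrightarrow> dist (J t \<omega>) (J u \<omega>) \<le> e"
      proof (intro exI[of _ "e / (C + 1)"] conjI ballI impI)
        show "0 < e / (C + 1)" using \<open>0 < e\<close> C0 by simp
        fix t assume t: "t \<in> {s..T}" "dist t u < e / (C + 1)"
        have "dist (J t \<omega>) (J u \<omega>) \<le> C * \<bar>t - u\<bar>" using Jlip[OF t(1) \<open>u \<in> {s..T}\<close>] by (simp add: dist_norm)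
        also have "\<dots> \<le> (C + 1) * \<bar>t - u\<bar>" by (intro mult_right_mono) auto
        also have "\<dots> \<le> e" using t(2) C0 by (simp add: dist_real_def pos_less_divide_eq mult.commute less_imp_le)
        finally show "dist (J t \<omega>) (J u \<omega>) \<le> e" .
      qed
    qed
    moreover have "continuous_on {s..T} (\<lambda>t. B t \<omega>)" using elim(2) by (rule continuous_on_subset) (use s in auto)
    ultimately have cont: "continuous_on {s..T} (\<lambda>t. Z t \<omega> - (x + J t \<omega> + B t \<omega> - B s \<omega>))"
      using elim(4) by (intro continuous_intros) auto
    have clo: "closure QS = {s..T}" using clQS QS(2) closure_minimal[of QS "{s..T}"] by auto
    have "Z t \<omega> - (x + J t \<omega> + B t \<omega> - B s \<omega>) = 0" if "t \<in> {s..T}" for t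
      by (rule continuous_constant_on_closure[of QS "\<lambda>t. Z t \<omega> - (x + J t \<omega> + B t \<omega> - B s \<omega>)"]) (use cont clo elim(1) that in auto)
    then show ?case using J by auto
  qed
  then show ?thesis using adapted Z(2) by (auto simp: strong_solution_def)
qed

end

section \<open>Integration by parts\<close>

lemma C_infinity_cD:
  fixes \<phi> :: "'a::euclidean_space \<Rightarrow> real"
  assumes "C_infinity_c \<phi>"
  shows "\<phi> differentiable (at x)" "continuous_on UNIV \<phi>"
    "e \<in> Basis \<Longrightarrow> continuous_on UNIV (\<lambda>x. frechet_derivative \<phi> (at x) e)"
    "compact (closure {x. \<phi> x \<noteq> 0})"
proof -
  have "C_order 0 \<phi>" "C_order (Suc 0) \<phi>" using assms by (auto simp: C_infinity_c_def)
  then show "\<phi> differentiable (at x)" "continuous_on UNIV \<phi>"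
    "e \<in> Basis \<Longrightarrow> continuous_on UNIV (\<lambda>x. frechet_derivative \<phi> (at x) e)" by auto
  show "compact (closure {x. \<phi> x \<noteq> 0})" using assms by (auto simp: C_infinity_c_def)
qed

lemma integrable_continuous_compact_support:
  fixes f :: "'a::euclidean_space \<Rightarrow> real"
  assumes "continuous_on UNIV f" "compact S" "\<And>x. x \<notin> S \<Longrightarrow> f x = 0"
  shows "integrable lborel f"
proof -
  have "integrable lborel (\<lambda>x. indicator S x *\<^sub>R f x)"
    using assms by (intro borel_integrable_compact) (auto intro: continuous_on_subset)
  moreover have "(\<lambda>x. indicator S x *\<^sub>R f x) = f" using assms(3) by (auto simp: indicator_def fun_eq_iff)
  ultimately show ?thesis by simp
qed

lemma lborel_integral_translate:
  fixes f :: "'a::euclidean_space \<Rightarrow> real"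
  assumes [measurable]: "f \<in> borel_measurable borel"
  shows "(\<integral>x. f (x + c) \<partial>lborel) = (\<integral>x. f x \<partial>lborel)" "integrable lborel f \<Longrightarrow> integrable lborel (\<lambda>x. f (x + c))"
proof -
  have d: "distr lborel borel (\<lambda>x. x + c) = lborel"
    using lborel_distr_plus[of c] by (simp add: add.commute[of _ c] fun_eq_iff[symmetric])
  have "(\<integral>x. f x \<partial>lborel) = (\<integral>x. f x \<partial>distr lborel borel (\<lambda>x. x + c))" by (simp only: d)
  then show "(\<integral>x. f (x + c) \<partial>lborel) = (\<integral>x. f x \<partial>lborel)" by (simp add: integral_distr)
  show "integrable lborel (\<lambda>x. f (x + c))" if "integrable lborel f"
  proof -
    have "integrable (distr lborel borel (\<lambda>x. x + c)) f" using that by (simp only: d)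
    then show ?thesis by (simp add: integrable_distr_eq)
  qed
qed

text \<open>By translation invariance \<open>p (x + e) - p x\<close> integrates to zero. It is also the integral of \<open>q\<close> over the
  segment from \<open>x\<close> to \<open>x + e\<close>, and Fubini with another translation leaves the integral of \<open>q\<close>.\<close>

lemma integral_directional_derivative_zero:
  fixes p q :: "'a::euclidean_space \<Rightarrow> real"
  assumes S: "compact S" "\<And>x. x \<notin> S \<Longrightarrow> p x = 0" "\<And>x. x \<notin> S \<Longrightarrow> q x = 0"
    and cont: "continuous_on UNIV p" "continuous_on UNIV q"
    and deriv: "\<And>x. ((\<lambda>r. p (x + r *\<^sub>R e)) has_real_derivative q x) (at 0)"
  shows "(\<integral>x. q x \<partial>lborel) = 0"
proof -
  have pi: "integrable lborel p" and qi: "integrable lborel q"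
    using integrable_continuous_compact_support[OF _ S(1)] S cont by auto
  have [measurable]: "p \<in> borel_measurable borel" "q \<in> borel_measurable borel"
    using cont by (auto intro: borel_measurable_continuous_onI)
  have line: "p (x + e) - p x = (\<integral>r. indicator {0..1} r * q (x + r *\<^sub>R e) \<partial>lborel)" for x
  proof -
    have "((\<lambda>r. p (x + r *\<^sub>R e)) has_vector_derivative q (x + r *\<^sub>R e)) (at r within {0..1})" for r
    proof -
      have "((\<lambda>h. p ((x + r *\<^sub>R e) + h *\<^sub>R e)) has_real_derivative q (x + r *\<^sub>R e)) (at 0)" by (rule deriv)
      then have "((\<lambda>h. (\<lambda>r. p (x + r *\<^sub>R e)) (h + r)) has_real_derivative q (x + r *\<^sub>R e)) (at 0)"
        by (simp add: algebra_simps)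
      then have "((\<lambda>r. p (x + r *\<^sub>R e)) has_real_derivative q (x + r *\<^sub>R e)) (at (0 + r))"
        by (simp only: DERIV_shift)
      then show ?thesis
        by (simp add: has_real_derivative_iff_has_vector_derivative has_vector_derivative_at_within)
    qed
    moreover have "continuous_on {0..1} (\<lambda>r. q (x + r *\<^sub>R e))"
      by (rule continuous_on_compose2[OF cont(2)]) (auto intro!: continuous_intros)
    ultimately have "(\<integral>r. indicator {0..1} r *\<^sub>R q (x + r *\<^sub>R e) \<partial>lborel) = p (x + 1 *\<^sub>R e) - p (x + 0 *\<^sub>R e)"
      by (intro integral_FTC_Icc[where F="\<lambda>r. p (x + r *\<^sub>R e)"]) auto
    then show ?thesis by simp
  qed
  let ?h = "\<lambda>z. indicator {0..1} (fst z) * q (snd z + fst z *\<^sub>R e)"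
  have m[measurable]: "?h \<in> borel_measurable (lborel \<Otimes>\<^sub>M lborel)" by measurable
  have hi: "integrable (lborel \<Otimes>\<^sub>M lborel) ?h"
  proof (rule lborel_pair.Fubini_integrable[OF m])
    have "(\<integral>x. norm (?h (r, x)) \<partial>lborel) = indicator {0..1} r * (\<integral>x. \<bar>q x\<bar> \<partial>lborel)" for r :: real
      using lborel_integral_translate(1)[of "\<lambda>x. \<bar>q x\<bar>" "r *\<^sub>R e"] by (simp add: abs_mult)
    then show "integrable lborel (\<lambda>r. \<integral>x. norm (?h (r, x)) \<partial>lborel)"
      by (simp add: emeasure_lborel_Icc integrable_mult_left integrable_real_indicator)
    show "AE r in lborel. integrable lborel (\<lambda>x. ?h (r, x))"
      using lborel_integral_translate(2)[OF _ qi] by (intro AE_I2) (auto intro!: integrable_mult_right)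
  qed
  have "0 = (\<integral>x. p (x + e) - p x \<partial>lborel)"
    using lborel_integral_translate[of p e] pi by simp
  also have "\<dots> = (\<integral>x. (\<integral>r. ?h (r, x) \<partial>lborel) \<partial>lborel)" by (simp add: line)
  also have "\<dots> = (\<integral>r. (\<integral>x. ?h (r, x) \<partial>lborel) \<partial>lborel)"
    using lborel_pair.Fubini_integral[of "\<lambda>r x. ?h (r, x)"] hi by (simp add: split_beta')
  also have "\<dots> = (\<integral>r. indicator {0..1::real} r * (\<integral>x. q x \<partial>lborel) \<partial>lborel)"
    using lborel_integral_translate(1)[of q] by simp
  also have "\<dots> = (\<integral>x. q x \<partial>lborel)" by simp
  finally show ?thesis by simp
qed

lemma continuous_product_extend_zero:
  fixes g \<psi> :: "'a::euclidean_space \<Rightarrow> real"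
  assumes "open U" "closed S" "S \<subseteq> U" "continuous_on U g" "continuous_on UNIV \<psi>" "\<And>x. x \<notin> S \<Longrightarrow> \<psi> x = 0"
  shows "continuous_on UNIV (\<lambda>x. if x \<in> U then g x * \<psi> x else 0)"
proof -
  have "continuous_on U (\<lambda>x. if x \<in> U then g x * \<psi> x else 0) = continuous_on U (\<lambda>x. g x * \<psi> x)"
    by (rule continuous_on_cong) auto
  then have 1: "continuous_on U (\<lambda>x. if x \<in> U then g x * \<psi> x else 0)"
    using assms by (auto intro!: continuous_intros intro: continuous_on_subset)
  have "continuous_on (- S) (\<lambda>x. if x \<in> U then g x * \<psi> x else 0) = continuous_on (- S) (\<lambda>x. 0 :: real)"
    using assms(6) by (intro continuous_on_cong) auto
  then have 2: "continuous_on (- S) (\<lambda>x. if x \<in> U then g x * \<psi> x else 0)" by simp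
  have "U \<union> - S = UNIV" using assms(3) by auto
  then show ?thesis using continuous_on_open_Un[OF assms(1) _ 1 2] assms(2) by auto
qed

text \<open>The product \<open>f \<phi>\<close>, extended by zero outside \<open>U\<close>, has the compactly supported directional derivative
  \<open>f' \<phi> + f \<psi>\<close>, whose integral vanishes.\<close>

lemma weak_derivative_of_line_derivative:
  fixes f f' \<phi> :: "'a::euclidean_space \<Rightarrow> real"
  assumes U: "open U" and f: "continuous_on U f" "continuous_on U f'" and e: "e \<in> Basis"
    and deriv: "\<And>x. x \<in> U \<Longrightarrow> ((\<lambda>r. f (x + r *\<^sub>R e)) has_real_derivative f' x) (at 0)"
    and \<phi>: "C_infinity_c \<phi>" "closure {x. \<phi> x \<noteq> 0} \<subseteq> U"
  shows "(\<integral>x. f x * frechet_derivative \<phi> (at x) e \<partial>lebesgue_on U) = - (\<integral>x. f' x * \<phi> x \<partial>lebesgue_on U)"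
proof -
  define S where "S = closure {x. \<phi> x \<noteq> 0}"
  define \<psi> where "\<psi> x = frechet_derivative \<phi> (at x) e" for x
  have S: "compact S" "closed S" "S \<subseteq> U" using C_infinity_cD(4)[OF \<phi>(1)] \<phi>(2) by (auto simp: S_def)
  have \<phi>0: "\<phi> x = 0" if "x \<notin> S" for x using that closure_subset[of "{x. \<phi> x \<noteq> 0}"] by (auto simp: S_def)
  have \<psi>0: "\<psi> x = 0" if "x \<notin> S" for x
  proof -
    have "(\<phi> has_derivative (\<lambda>_. 0)) (at x)"
      using \<phi>0 S that by (intro has_derivative_transform_within_open[of "\<lambda>_. 0" "\<lambda>_. 0" x UNIV "- S" \<phi>]) auto
    from frechet_derivative_at[OF this] show ?thesis by (simp add: \<psi>_def flip: fun_eq_iff) (metis)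
  qed
  define p where "p x = (if x \<in> U then f x * \<phi> x else 0)" for x
  define q1 where "q1 x = (if x \<in> U then f' x * \<phi> x else 0)" for x
  define q2 where "q2 x = (if x \<in> U then f x * \<psi> x else 0)" for x
  have c: "continuous_on UNIV p" "continuous_on UNIV q1" "continuous_on UNIV q2"
    unfolding p_def[abs_def] q1_def[abs_def] q2_def[abs_def]
    using C_infinity_cD(2)[OF \<phi>(1)] C_infinity_cD(3)[OF \<phi>(1) e] \<phi>0 \<psi>0
    by (auto intro!: continuous_product_extend_zero[OF U S(2,3)] f simp: \<psi>_def[abs_def])
  have z: "p x = 0" "q1 x = 0" "q2 x = 0" if "x \<notin> S" for x
    using that \<phi>0 \<psi>0 by (auto simp: p_def q1_def q2_def)
  have i: "integrable lborel q1" "integrable lborel q2"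
    using integrable_continuous_compact_support[OF _ S(1)] c z by auto
  have "(\<integral>x. q1 x + q2 x \<partial>lborel) = 0"
  proof (rule integral_directional_derivative_zero[OF S(1)])
    fix x
    show "((\<lambda>r. p (x + r *\<^sub>R e)) has_real_derivative q1 x + q2 x) (at 0)"
    proof (cases "x \<in> S")
      case True
      then have xU: "x \<in> U" using S by auto
      have "(\<phi> has_derivative frechet_derivative \<phi> (at x)) (at x)"
        using C_infinity_cD(1)[OF \<phi>(1)] by (simp add: frechet_derivative_works)
      then have \<phi>d: "(\<phi> has_derivative frechet_derivative \<phi> (at x)) (at (x + 0 *\<^sub>R e))" by simp
      have "((\<lambda>r. x + r *\<^sub>R e) has_derivative (\<lambda>h. h *\<^sub>R e)) (at 0)" by (auto intro!: derivative_eq_intros)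
      from has_derivative_compose[OF this \<phi>d]
      have "((\<lambda>r. \<phi> (x + r *\<^sub>R e)) has_derivative (\<lambda>h. frechet_derivative \<phi> (at x) (h *\<^sub>R e))) (at 0)" .
      moreover have "frechet_derivative \<phi> (at x) (h *\<^sub>R e) = h * \<psi> x" for h
        using linear_frechet_derivative[OF C_infinity_cD(1)[OF \<phi>(1)], of x] by (simp add: \<psi>_def linear_scale)
      ultimately have "((\<lambda>r. \<phi> (x + r *\<^sub>R e)) has_real_derivative \<psi> x) (at 0)"
        by (simp add: has_field_derivative_def mult_commute_abs)
      from DERIV_mult[OF deriv[OF xU] this]
      have d: "((\<lambda>r. f (x + r *\<^sub>R e) * \<phi> (x + r *\<^sub>R e)) has_real_derivative q1 x + q2 x) (at 0)"
        using xU by (simp add: q1_def q2_def mult.commute)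
      have o: "open ((\<lambda>r. x + r *\<^sub>R e) -` U)"
        using U by (intro open_vimage) (auto intro!: continuous_intros)
      show ?thesis
        by (rule has_field_derivative_transform_within_open[OF d o]) (use xU in \<open>auto simp: p_def\<close>)
    next
      case False
      have o: "open ((\<lambda>r. x + r *\<^sub>R e) -` (- S))"
        using S by (intro open_vimage) (auto intro!: continuous_intros)
      have "((\<lambda>r. 0) has_real_derivative q1 x + q2 x) (at 0)" using z[OF False] by simp
      then show ?thesis
        by (rule has_field_derivative_transform_within_open[OF _ o]) (use False z in auto)
    qed
  qed (use c z in \<open>auto intro!: continuous_intros\<close>)
  then have eq: "(\<integral>x. q2 x \<partial>lborel) = - (\<integral>x. q1 x \<partial>lborel)" using i by simp
  have Um: "U \<in> sets lebesgue" using U by auto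
  have "(\<integral>x. g x \<partial>lebesgue_on U) = (\<integral>x. (if x \<in> U then g x else 0) \<partial>lborel)"
    if "continuous_on UNIV (\<lambda>x. if x \<in> U then g x else 0)" for g :: "'a \<Rightarrow> real"
  proof -
    have "(\<integral>x. g x \<partial>lebesgue_on U) = (\<integral>x. indicator U x *\<^sub>R g x \<partial>lebesgue)"
      using Um by (intro integral_restrict_space) auto
    also have "(\<lambda>x. indicator U x *\<^sub>R g x) = (\<lambda>x. if x \<in> U then g x else 0)" by (auto simp: indicator_def)
    also have "(\<integral>x. (if x \<in> U then g x else 0) \<partial>lebesgue) = (\<integral>x. (if x \<in> U then g x else 0) \<partial>lborel)"
      using that by (intro integral_completion) (auto intro: borel_measurable_continuous_onI)
    finally show ?thesis .
  qed
  then have "(\<integral>x. f x * \<psi> x \<partial>lebesgue_on U) = - (\<integral>x. f' x * \<phi> x \<partial>lebesgue_on U)"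
    using eq c by (simp add: q1_def[abs_def] q2_def[abs_def])
  then show ?thesis by (simp only: \<psi>_def)
qed

section \<open>Test functions determine integrable functions\<close>

text \<open>The span of this family is closed under differentiation, so that a single formula shows that
  \<open>flat 0\<close>, that is \<open>exp (- 1 / x)\<close> for positive \<open>x\<close>, is smooth.\<close>

definition flat :: "nat \<Rightarrow> real \<Rightarrow> real" where
  "flat k x = (if 0 < x then (1 / x) ^ k * exp (- 1 / x) else 0)"

lemma flat_has_derivative: "(flat k has_real_derivative (flat (k + 2) x - real k * flat (k + 1) x)) (at x)"
proof (cases "x = 0")
  case False
  show ?thesis
  proof (cases "0 < x")
    case True
    have "((\<lambda>x. (1 / x) ^ k * exp (- 1 / x)) has_real_derivative
        real k * (1 / x) ^ (k - 1) * (- (1 / x\<^sup>2)) * exp (- 1 / x) + (1 / x) ^ k * (exp (- 1 / x) * (1 / x\<^sup>2))) (at x)"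
      using True by (auto intro!: derivative_eq_intros simp: power2_eq_square)
    also have "real k * (1 / x) ^ (k - 1) * (- (1 / x\<^sup>2)) * exp (- 1 / x) + (1 / x) ^ k * (exp (- 1 / x) * (1 / x\<^sup>2))
        = flat (k + 2) x - real k * flat (k + 1) x"
      using True by (cases k) (auto simp: flat_def power2_eq_square field_simps)
    finally have d: "((\<lambda>x. (1 / x) ^ k * exp (- 1 / x)) has_real_derivative (flat (k + 2) x - real k * flat (k + 1) x)) (at x)" .
    show ?thesis by (rule has_field_derivative_transform_within_open[OF d, of "{0<..}"]) (use True in \<open>auto simp: flat_def\<close>)
  next
    case False2: False
    then have x: "x < 0" using False by simp
    have d: "((\<lambda>x. 0) has_real_derivative (flat (k + 2) x - real k * flat (k + 1) x)) (at x)" using x by (simp add: flat_def)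
    show ?thesis by (rule has_field_derivative_transform_within_open[OF d, of "{..<0}"]) (use x in \<open>auto simp: flat_def\<close>)
  qed
next
  case True
  have "((\<lambda>h. (flat k (0 + h) - flat k 0) / h) \<longlongrightarrow> 0) (at 0)"
  proof (rule filterlim_split_at)
    have "((\<lambda>h. flat (Suc k) h) \<longlongrightarrow> 0) (at_right 0)"
    proof -
      have "((\<lambda>h::real. inverse h ^ (Suc k) / exp (inverse h)) \<longlongrightarrow> 0) (at_right 0)"
        by (rule filterlim_compose[OF tendsto_power_div_exp_0 filterlim_inverse_at_top_right])
      then show ?thesis
      proof (rule Lim_transform_eventually)
        show "\<forall>\<^sub>F h in at_right (0::real). inverse h ^ (Suc k) / exp (inverse h) = flat (Suc k) h"
          using eventually_at_right_less[of "0::real"]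
          by eventually_elim (simp add: flat_def exp_minus divide_inverse)
      qed
    qed
    then show "((\<lambda>h. (flat k (0 + h) - flat k 0) / h) \<longlongrightarrow> 0) (at_right 0)"
    proof (rule Lim_transform_eventually)
      show "\<forall>\<^sub>F h in at_right (0::real). flat (Suc k) h = (flat k (0 + h) - flat k 0) / h"
        using eventually_at_right_less[of "0::real"] by eventually_elim (simp add: flat_def)
    qed
    have "((\<lambda>h::real. 0) \<longlongrightarrow> 0) (at_left (0::real))" by simp
    then show "((\<lambda>h. (flat k (0 + h) - flat k 0) / h) \<longlongrightarrow> (0::real)) (at_left 0)"
    proof (rule Lim_transform_eventually)
      have "\<forall>\<^sub>F h in at_left (0::real). h < 0" by (simp add: eventually_at_filter)
      then show "\<forall>\<^sub>F h in at_left (0::real). 0 = (flat k (0 + h) - flat k 0) / h"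
        by eventually_elim (simp add: flat_def)
    qed
  qed
  then show ?thesis using True by (simp add: DERIV_def flat_def)
qed

text \<open>An algebra of functions that is closed under directional derivatives. Its elements are smooth of every
  order by induction, without computing higher derivatives.\<close>

inductive smooth_gen :: "('a::euclidean_space \<Rightarrow> real) \<Rightarrow> bool" where
  flat: "smooth_gen (\<lambda>x. flat k (c + v \<bullet> x))"
| const: "smooth_gen (\<lambda>x. c)"
| add: "smooth_gen f \<Longrightarrow> smooth_gen g \<Longrightarrow> smooth_gen (\<lambda>x. f x + g x)"
| mult: "smooth_gen f \<Longrightarrow> smooth_gen g \<Longrightarrow> smooth_gen (\<lambda>x. f x * g x)"

lemma smooth_gen_derivative:
  "smooth_gen f \<Longrightarrow> \<exists>f'. (\<forall>x. (f has_derivative f' x) (at x)) \<and> (\<forall>e. smooth_gen (\<lambda>x. f' x e))"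
proof (induction rule: smooth_gen.induct)
  case (flat k c v)
  let ?d = "\<lambda>x h. (v \<bullet> h) * (flat (k + 2) (c + v \<bullet> x) + (- real k) * flat (k + 1) (c + v \<bullet> x))"
  have "((\<lambda>x. flat k (c + v \<bullet> x)) has_derivative ?d x) (at x)" for x
  proof -
    have 1: "((\<lambda>x. c + v \<bullet> x) has_derivative (\<lambda>h. v \<bullet> h)) (at x)" by (auto intro!: derivative_eq_intros)
    have 2: "(flat k has_derivative (\<lambda>h. h * (flat (k + 2) (c + v \<bullet> x) - real k * flat (k + 1) (c + v \<bullet> x)))) (at (c + v \<bullet> x))"
      using flat_has_derivative[of k "c + v \<bullet> x"] by (simp add: has_field_derivative_def mult.commute[of _ "_ - _"])
    show ?thesis using has_derivative_compose[OF 1 2] by simp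
  qed
  moreover have "smooth_gen (\<lambda>x. ?d x e)" for e by (intro smooth_gen.intros)
  ultimately show ?case by (intro exI[of _ ?d]) simp
next
  case (const c)
  have "\<forall>x. ((\<lambda>x. c) has_derivative (\<lambda>_. 0)) (at x)" by simp
  then show ?case by (intro exI[of _ "\<lambda>_ _. 0"]) (auto intro: smooth_gen.intros)
next
  case (add f g)
  then obtain f' g' where "\<forall>x. (f has_derivative f' x) (at x)" "\<forall>e. smooth_gen (\<lambda>x. f' x e)"
    "\<forall>x. (g has_derivative g' x) (at x)" "\<forall>e. smooth_gen (\<lambda>x. g' x e)" by blast
  then show ?case
    by (intro exI[of _ "\<lambda>x h. f' x h + g' x h"]) (auto intro!: smooth_gen.intros has_derivative_add)
next
  case (mult f g)
  then obtain f' g' where "\<forall>x. (f has_derivative f' x) (at x)" "\<forall>e. smooth_gen (\<lambda>x. f' x e)"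
    "\<forall>x. (g has_derivative g' x) (at x)" "\<forall>e. smooth_gen (\<lambda>x. g' x e)" by blast
  then show ?case using mult.hyps
    by (intro exI[of _ "\<lambda>x h. f x * g' x h + f' x h * g x"]) (auto intro!: smooth_gen.intros has_derivative_mult)
qed

lemma smooth_gen_C_order: "smooth_gen f \<Longrightarrow> C_order k f"
proof (induction k arbitrary: f)
  case 0
  from smooth_gen_derivative[OF this] obtain f' where "\<And>x. (f has_derivative f' x) (at x)" by blast
  then show ?case
    by (auto simp: continuous_on_eq_continuous_at intro: has_derivative_continuous)
next
  case (Suc k)
  from smooth_gen_derivative[OF Suc.prems] obtain f' where
    f': "\<And>x. (f has_derivative f' x) (at x)" "\<And>e. smooth_gen (\<lambda>x. f' x e)" by blast
  have "frechet_derivative f (at x) = f' x" for x using frechet_derivative_at[OF f'(1)] by simp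
  then show ?case using f' Suc.IH by (auto simp: differentiable_def)
qed

lemma smooth_gen_prod: "finite I \<Longrightarrow> (\<And>i. i \<in> I \<Longrightarrow> smooth_gen (f i)) \<Longrightarrow> smooth_gen (\<lambda>x. \<Prod>i\<in>I. f i x)"
  by (induction I rule: finite_induct) (auto intro: smooth_gen.intros)

text \<open>As \<open>m\<close> grows, these smooth functions supported in the box converge to its indicator.\<close>

definition box_bump :: "nat \<Rightarrow> 'a::euclidean_space \<Rightarrow> 'a \<Rightarrow> 'a \<Rightarrow> real" where
  "box_bump m c d x = (\<Prod>i\<in>Basis. flat 0 (real (Suc m) * ((x - c) \<bullet> i)) * flat 0 (real (Suc m) * ((d - x) \<bullet> i)))"

lemma flat_0_bounds: "0 \<le> flat 0 x" "flat 0 x \<le> 1" "flat 0 x = 0 \<longleftrightarrow> x \<le> 0"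
  by (auto simp: flat_def)

lemma box_bump_zero: "x \<notin> box c d \<Longrightarrow> box_bump m c d x = 0"
proof -
  assume "x \<notin> box c d"
  then obtain i where i: "i \<in> Basis" "x \<bullet> i \<le> c \<bullet> i \<or> d \<bullet> i \<le> x \<bullet> i" by (auto simp: mem_box not_less)
  then have "flat 0 (real (Suc m) * ((x - c) \<bullet> i)) * flat 0 (real (Suc m) * ((d - x) \<bullet> i)) = 0"
    by (auto simp: flat_0_bounds(3) inner_diff_left mult_le_0_iff simp del: of_nat_Suc)
  then show ?thesis unfolding box_bump_def using i(1) by (intro prod_zero) auto
qed

lemma box_bump_C_infinity_c: "C_infinity_c (box_bump m c d)" "closure {x. box_bump m c d x \<noteq> 0} \<subseteq> cbox c d"
proof -
  show cl: "closure {x. box_bump m c d x \<noteq> 0} \<subseteq> cbox c d"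
  proof (rule closure_minimal)
    have "{x. box_bump m c d x \<noteq> 0} \<subseteq> box c d" using box_bump_zero[of _ c d m] by blast
    then show "{x. box_bump m c d x \<noteq> 0} \<subseteq> cbox c d" using box_subset_cbox by blast
  qed (rule closed_cbox)
  have "smooth_gen (\<lambda>x. flat 0 (real (Suc m) * ((x - c) \<bullet> i)) * flat 0 (real (Suc m) * ((d - x) \<bullet> i)))" for i
  proof -
    have "smooth_gen (\<lambda>x. flat 0 (- (real (Suc m) * (c \<bullet> i)) + (real (Suc m) *\<^sub>R i) \<bullet> x) *
        flat 0 (real (Suc m) * (d \<bullet> i) + (- (real (Suc m) *\<^sub>R i)) \<bullet> x))"
      by (intro smooth_gen.intros)
    then show ?thesis by (rule back_subst[of smooth_gen]) (simp add: fun_eq_iff algebra_simps inner_commute)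
  qed
  then have "smooth_gen (box_bump m c d)" unfolding box_bump_def[abs_def] by (intro smooth_gen_prod) auto
  then have "\<forall>k. C_order k (box_bump m c d)" by (simp add: smooth_gen_C_order)
  moreover have "compact (closure {x. box_bump m c d x \<noteq> 0})"
    using cl by (meson bounded_cbox bounded_subset closed_closure compact_eq_bounded_closed)
  ultimately show "C_infinity_c (box_bump m c d)" by (simp add: C_infinity_c_def)
qed

lemma box_bump_bounds: "0 \<le> box_bump m c d x" "box_bump m c d x \<le> 1"
  unfolding box_bump_def
  by (rule prod_nonneg, simp only: flat_0_bounds mult_nonneg_nonneg,
      rule prod_le_1, simp only: flat_0_bounds mult_nonneg_nonneg mult_le_one simp_thms)

lemma box_bump_tendsto: "(\<lambda>m. box_bump m c d x) \<longlonglongrightarrow> indicator (box c d) x"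
proof (cases "x \<in> box c d")
  case False
  then show ?thesis by (simp add: box_bump_zero)
next
  case True
  have "(\<lambda>m. flat 0 (real (Suc m) * y)) \<longlonglongrightarrow> 1" if "0 < y" for y
  proof -
    have "(\<lambda>m. exp (- ((1 / y) * inverse (real (Suc m))))) \<longlonglongrightarrow> exp (- ((1 / y) * 0))"
      by (intro tendsto_intros LIMSEQ_inverse_real_of_nat)
    then show ?thesis using that by (simp add: flat_def divide_inverse mult.commute)
  qed
  then have "(\<lambda>m. box_bump m c d x) \<longlonglongrightarrow> (\<Prod>i\<in>(Basis::'a set). 1 * 1)"
    unfolding box_bump_def using True by (intro tendsto_prod tendsto_mult) (auto simp: mem_box inner_diff_left)
  then show ?thesis using True by simp
qed

text \<open>The positive and the negative part of \<open>w\<close> are densities of measures that agree on boxes, hence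
  everywhere.\<close>

lemma AE_zero_of_box_integrals:
  fixes w :: "'a::euclidean_space \<Rightarrow> real"
  assumes w: "integrable lborel w" and zero: "\<And>c d. (\<integral>x. indicator (box c d) x * w x \<partial>lborel) = 0"
  shows "AE x in lborel. w x = 0"
proof -
  have [measurable]: "w \<in> borel_measurable borel" using w by (auto dest: borel_measurable_integrable)
  define wp where "wp x = max 0 (w x)" for x
  define wn where "wn x = max 0 (- w x)" for x
  have wpn: "w x = wp x - wn x" "0 \<le> wp x" "0 \<le> wn x" for x by (auto simp: wp_def wn_def)
  have ip: "integrable lborel wp" and in': "integrable lborel wn"
    using w by (auto simp: wp_def[abs_def] wn_def[abs_def] intro!: integrable_max)
  have [measurable]: "wp \<in> borel_measurable borel" "wn \<in> borel_measurable borel"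
    by (auto simp: wp_def[abs_def] wn_def[abs_def])
  have em: "emeasure (density lborel (\<lambda>x. ennreal (v x))) A = ennreal (\<integral>x. indicator A x * v x \<partial>lborel)"
    if v: "integrable lborel v" "\<And>x. 0 \<le> v x" and A[measurable]: "A \<in> sets borel" for v :: "'a \<Rightarrow> real" and A
  proof -
    have [measurable]: "v \<in> borel_measurable borel" using v by (auto dest: borel_measurable_integrable)
    have "integrable lborel (\<lambda>x. indicator A x * v x)"
      by (rule Bochner_Integration.integrable_bound[OF v(1)]) (auto simp: indicator_def)
    moreover have "emeasure (density lborel (\<lambda>x. ennreal (v x))) A = (\<integral>\<^sup>+x. ennreal (indicator A x * v x) \<partial>lborel)"
      by (subst emeasure_density) (auto intro!: nn_integral_cong simp: indicator_def)
    ultimately show ?thesis using v(2) by (simp add: nn_integral_eq_integral)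
  qed
  let ?E = "range (\<lambda>(a, b). box a b :: 'a set)"
  have "density lborel (\<lambda>x. ennreal (wp x)) = density lborel (\<lambda>x. ennreal (wn x))"
  proof (rule measure_eqI_generator_eq[where E="?E" and \<Omega>=UNIV])
    show "Int_stable ?E" by (auto simp: Int_stable_def box_Int_box)
    show "sets (density lborel (\<lambda>x. ennreal (wp x))) = sigma_sets UNIV ?E"
      "sets (density lborel (\<lambda>x. ennreal (wn x))) = sigma_sets UNIV ?E" by (simp_all add: borel_eq_box)
    let ?A = "\<lambda>n::nat. box (- (real n *\<^sub>R One)) (real n *\<^sub>R One) :: 'a set"
    show "range ?A \<subseteq> ?E" "(\<Union>i. ?A i) = UNIV" by (auto simp: UN_box_eq_UNIV)
    show "emeasure (density lborel (\<lambda>x. ennreal (wp x))) (?A i) \<noteq> \<infinity>" for i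
      using em[OF ip wpn(2), of "?A i"] by simp
    fix X assume "X \<in> ?E"
    then obtain c d where X: "X = box c d" by auto
    have "integrable lborel (\<lambda>x. indicator X x * v x)" if "integrable lborel v" for v :: "'a \<Rightarrow> real"
      by (rule Bochner_Integration.integrable_bound[OF that]) (use that in \<open>auto simp: X indicator_def dest: borel_measurable_integrable\<close>)
    from this[OF ip] this[OF in'] have "(\<integral>x. indicator X x * w x \<partial>lborel) = (\<integral>x. indicator X x * wp x \<partial>lborel) - (\<integral>x. indicator X x * wn x \<partial>lborel)"
      by (simp add: wpn(1) right_diff_distrib)
    then show "emeasure (density lborel (\<lambda>x. ennreal (wp x))) X = emeasure (density lborel (\<lambda>x. ennreal (wn x))) X"
      using zero[of c d] by (simp add: em[OF ip wpn(2)] em[OF in' wpn(3)] X)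
  qed auto
  then have "AE x in lborel. ennreal (wp x) = ennreal (wn x)"
    by (intro sigma_finite_measure.density_unique[OF lborel.sigma_finite_measure_axioms]) auto
  then show ?thesis by eventually_elim (auto simp: wpn)
qed

text \<open>Bump functions show that \<open>w\<close> integrates to zero over every box whose closure lies in \<open>U\<close>, and \<open>U\<close> is a
  countable union of closed boxes, whose boundaries are null sets.\<close>

lemma AE_zero_of_test_functions:
  fixes w :: "'a::euclidean_space \<Rightarrow> real"
  assumes U: "open U" and w: "integrable (lebesgue_on U) w"
    and zero: "\<And>\<phi>. C_infinity_c \<phi> \<Longrightarrow> closure {x. \<phi> x \<noteq> 0} \<subseteq> U \<Longrightarrow> (\<integral>x. w x * \<phi> x \<partial>lebesgue_on U) = 0"
  shows "AE x in lebesgue_on U. w x = 0"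
proof -
  have Um: "U \<in> sets lebesgue" using U by auto
  have wl: "integrable lebesgue (\<lambda>x. indicator U x * w x)" using w Um by (simp add: integrable_restrict_space)
  then obtain v where v[measurable]: "v \<in> borel_measurable lborel" and wv: "AE x in lborel. indicator U x * w x = v x"
    using completion_ex_borel_measurable_real[of "\<lambda>x. indicator U x * w x" lborel] by (auto dest: borel_measurable_integrable)
  have wv': "AE x in lebesgue. indicator U x * w x = v x" using wv by (rule AE_completion)
  have "integrable lebesgue v"
    by (rule integrable_cong_AE_imp[OF wl]) (use wv' in \<open>auto intro: measurable_completion\<close>)
  then have vi: "integrable lborel v" by (simp add: integrable_completion)
  have box0: "(\<integral>x. indicator (box c d) x * v x \<partial>lborel) = 0" if cd: "cbox c d \<subseteq> U" for c d
  proof -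
    have "(\<integral>x. box_bump m c d x * v x \<partial>lborel) = 0" for m
    proof -
      have bm: "box_bump m c d \<in> borel_measurable borel"
        using C_infinity_cD(2)[OF box_bump_C_infinity_c(1)] by (rule borel_measurable_continuous_onI)
      have bl: "box_bump m c d \<in> borel_measurable lebesgue" using bm by (intro measurable_completion) simp
      have vb: "(\<lambda>x. box_bump m c d x * v x) \<in> borel_measurable lborel" using bm by simp
      have "(\<integral>x. box_bump m c d x * v x \<partial>lborel) = (\<integral>x. box_bump m c d x * v x \<partial>lebesgue)"
        by (rule integral_completion[OF vb, symmetric])
      also have "\<dots> = (\<integral>x. indicator U x *\<^sub>R (w x * box_bump m c d x) \<partial>lebesgue)"
      proof (rule integral_cong_AE)
        show "(\<lambda>x. box_bump m c d x * v x) \<in> borel_measurable lebesgue" using vb by (rule measurable_completion)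
        have "(\<lambda>x. (indicator U x * w x) * box_bump m c d x) \<in> borel_measurable lebesgue"
          by (rule borel_measurable_times[OF borel_measurable_integrable[OF wl] bl])
        then show "(\<lambda>x. indicator U x *\<^sub>R (w x * box_bump m c d x)) \<in> borel_measurable lebesgue" by (simp add: mult.assoc)
        show "AE x in lebesgue. box_bump m c d x * v x = indicator U x *\<^sub>R (w x * box_bump m c d x)"
          using wv' by eventually_elim (simp add: mult_ac flip: mult.assoc)
      qed
      also have "\<dots> = (\<integral>x. w x * box_bump m c d x \<partial>lebesgue_on U)"
        using Um by (intro integral_restrict_space[symmetric]) auto
      also have "\<dots> = 0" using box_bump_C_infinity_c[of m c d] cd by (intro zero) auto
      finally show ?thesis .
    qed
    moreover have "(\<lambda>m. \<integral>x. box_bump m c d x * v x \<partial>lborel) \<longlonglongrightarrow> (\<integral>x. indicator (box c d) x * v x \<partial>lborel)"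
    proof (rule integral_dominated_convergence)
      show "integrable lborel (\<lambda>x. \<bar>v x\<bar>)" using vi by simp
      show "AE x in lborel. (\<lambda>m. box_bump m c d x * v x) \<longlonglongrightarrow> indicator (box c d) x * v x"
        by (intro AE_I2 tendsto_mult box_bump_tendsto tendsto_const)
      show "AE x in lborel. norm (box_bump m c d x * v x) \<le> \<bar>v x\<bar>" for m
        using box_bump_bounds[of m c d] by (intro AE_I2) (auto simp: abs_mult intro!: mult_left_le_one_le)
      show "(\<lambda>x. box_bump m c d x * v x) \<in> borel_measurable lborel" for m
        using C_infinity_cD(2)[OF box_bump_C_infinity_c(1), THEN borel_measurable_continuous_onI, of m c d] by simp
    qed simp
    ultimately show ?thesis by (simp add: LIMSEQ_const_iff)
  qed
  obtain \<D> where \<D>: "countable \<D>" "\<And>X. X \<in> \<D> \<Longrightarrow> \<exists>a b. X = cbox a b" "\<Union>\<D> = U"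
    using open_countable_Union_open_cbox[OF U] by metis
  have "AE x in lborel. \<forall>X\<in>\<D>. x \<in> X \<longrightarrow> v x = 0"
  proof (subst AE_ball_countable[OF \<D>(1)], intro ballI)
    fix X assume X: "X \<in> \<D>"
    then obtain a b where ab: "X = cbox a b" using \<D>(2) by blast
    have abU: "cbox a b \<subseteq> U" using X ab \<D>(3) by auto
    have "AE x in lborel. indicator (box a b) x * v x = 0"
    proof (rule AE_zero_of_box_integrals)
      show "integrable lborel (\<lambda>x. indicator (box a b) x * v x)"
        by (rule Bochner_Integration.integrable_bound[OF vi]) (auto simp: indicator_def)
      fix c d
      obtain c' d' where cd: "box a b \<inter> box c d = box c' d'" "cbox c' d' \<subseteq> cbox a b \<or> box c' d' = {}"
      proof -
        let ?c = "\<Sum>i\<in>Basis. max (a \<bullet> i) (c \<bullet> i) *\<^sub>R i" and ?d = "\<Sum>i\<in>Basis. min (b \<bullet> i) (d \<bullet> i) *\<^sub>R i"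
        have "box a b \<inter> box c d = box ?c ?d" by (rule box_Int_box)
        moreover have "cbox ?c ?d \<subseteq> cbox a b" by (auto simp: mem_box)
        ultimately show thesis using that by blast
      qed
      have "(\<integral>x. indicator (box c d) x * (indicator (box a b) x * v x) \<partial>lborel) = (\<integral>x. indicator (box c' d') x * v x \<partial>lborel)"
        by (intro Bochner_Integration.integral_cong refl) (auto simp: cd(1)[symmetric] indicator_def)
      also have "\<dots> = 0" using cd(2) box0 abU by auto
      finally show "(\<integral>x. indicator (box c d) x * (indicator (box a b) x * v x) \<partial>lborel) = 0" .
    qed
    moreover have "AE x in lborel. x \<notin> cbox a b - box a b"
      by (rule AE_not_in) (simp add: null_sets_def emeasure_lborel_cbox_eq emeasure_Diff box_subset_cbox emeasure_lborel_box_eq)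
    ultimately show "AE x in lborel. x \<in> X \<longrightarrow> v x = 0" by eventually_elim (auto simp: ab indicator_def split: if_splits)
  qed
  then have "AE x in lborel. x \<in> U \<longrightarrow> w x = 0"
    using wv by eventually_elim (use \<D>(3) in \<open>auto simp: indicator_def\<close>)
  then have "AE x in lebesgue. x \<in> U \<longrightarrow> w x = 0" by (rule AE_completion)
  then show ?thesis using Um by (simp add: AE_restrict_space_iff)
qed

section \<open>Integrals of Jacobians along segments in the limit\<close>

lemma norm_matrix_vector_le:
  fixes A :: "real ^ 'n ^ 'm"
  shows "norm (A *v v) \<le> norm A * norm v"
proof -
  have "norm (A *v v) = L2_set (\<lambda>i. norm ((A *v v) $ i)) UNIV" by (simp add: norm_vec_def)
  also have "\<dots> \<le> L2_set (\<lambda>i. norm v * norm (A $ i)) UNIV"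
  proof (rule L2_set_mono)
    fix i
    show "norm ((A *v v) $ i) \<le> norm v * norm (A $ i)"
      using Cauchy_Schwarz_ineq2[of "A $ i" v] by (simp add: matrix_vector_mul_component mult.commute)
  qed simp
  also have "\<dots> = norm v * L2_set (\<lambda>i. norm (A $ i)) UNIV" by (rule L2_set_right_distrib[symmetric]) simp
  finally show ?thesis by (simp add: norm_vec_def[of A] mult.commute)
qed

lemma continuous_on_matrix_vector_mult:
  fixes A :: "'a::topological_space \<Rightarrow> real ^ 'n ^ 'm"
  assumes "continuous_on S A" "continuous_on S v"
  shows "continuous_on S (\<lambda>x. A x *v v x)"
proof -
  have eq: "(\<lambda>x. A x *v v x) = (\<lambda>x. \<chi> i. (A x $ i) \<bullet> v x)"
    by (simp add: fun_eq_iff vec_eq_iff matrix_vector_mul_component)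
  show ?thesis unfolding eq using assms by (intro continuous_on_vec_lambda continuous_intros)
qed

lemma differentiable_line_derivative:
  fixes f :: "real ^ 'd \<Rightarrow> real ^ 'd"
  assumes "\<And>y. f differentiable (at y)"
  shows "((\<lambda>\<rho>. f (x + \<rho> *\<^sub>R v)) has_vector_derivative jacobian f (at (x + \<rho> *\<^sub>R v)) *v v) (at \<rho> within S)"
proof -
  have 1: "((\<lambda>\<rho>. x + \<rho> *\<^sub>R v) has_derivative (\<lambda>h. h *\<^sub>R v)) (at \<rho> within S)" by (auto intro!: derivative_eq_intros)
  have 2: "(f has_derivative (\<lambda>h. jacobian f (at (x + \<rho> *\<^sub>R v)) *v h)) (at (x + \<rho> *\<^sub>R v))"
    using assms jacobian_works by blast
  show ?thesis using has_derivative_compose[OF 1 2] by (simp add: has_vector_derivative_def matrix_vector_mult_scaleR)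
qed

text \<open>Along the segment the increment of \<open>F k\<close> is the integral of its Jacobian. The bound \<open>\<epsilon> k\<close> is uniform
  along the segment, so by Fubini replacing the Jacobian by \<open>G'\<close> costs at most \<open>\<epsilon> k * norm v\<close> in mean.\<close>

lemma (in prob_space) limit_line_integral:
  fixes F :: "nat \<Rightarrow> real ^ 'd \<Rightarrow> 'a \<Rightarrow> real ^ 'd" and G :: "real ^ 'd \<Rightarrow> 'a \<Rightarrow> real ^ 'd"
    and G' :: "real ^ 'd \<Rightarrow> 'a \<Rightarrow> real ^ 'd ^ 'd"
  assumes Fm: "\<And>k y. F k y \<in> borel_measurable M"
    and Fd: "\<And>k. AE \<omega> in M. \<forall>y. (\<lambda>y. F k y \<omega>) differentiable (at y)"
    and Gm: "\<And>y. y \<in> K \<Longrightarrow> G y \<in> borel_measurable M"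
    and G'c: "\<And>\<omega>. continuous_on UNIV (\<lambda>y. G' y \<omega>)"
    and G'm: "(\<lambda>(y, \<omega>). G' y \<omega>) \<in> borel_measurable (borel \<Otimes>\<^sub>M M)"
    and seg: "\<And>\<rho>. \<rho> \<in> {0..1} \<Longrightarrow> x + \<rho> *\<^sub>R v \<in> K"
    and i1: "\<And>k y. y \<in> K \<Longrightarrow> integrable M (\<lambda>\<omega>. F k y \<omega> - G y \<omega>)"
    and c1: "\<And>y. y \<in> K \<Longrightarrow> (\<lambda>k. \<integral>\<omega>. norm (F k y \<omega> - G y \<omega>) \<partial>M) \<longlonglongrightarrow> 0"
    and i2: "\<And>k y. y \<in> K \<Longrightarrow> integrable M (\<lambda>\<omega>. jacobian (\<lambda>y. F k y \<omega>) (at y) - G' y \<omega>)"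
    and c2: "\<And>k y. y \<in> K \<Longrightarrow> (\<integral>\<omega>. norm (jacobian (\<lambda>y. F k y \<omega>) (at y) - G' y \<omega>) \<partial>M) \<le> \<epsilon> k" "\<epsilon> \<longlonglongrightarrow> 0"
  shows "AE \<omega> in M. G (x + v) \<omega> - G x \<omega> = integral {0..1} (\<lambda>\<rho>. G' (x + \<rho> *\<^sub>R v) \<omega> *v v)"
proof -
  interpret L: pair_sigma_finite lborel M by unfold_locales
  have xK: "x \<in> K" "x + v \<in> K" using seg[of 0] seg[of 1] by auto
  let ?g = "\<lambda>\<rho> \<omega>. G' (x + \<rho> *\<^sub>R v) \<omega> *v v"
  have gcont: "continuous_on S (\<lambda>\<rho>. ?g \<rho> \<omega>)" for S \<omega>
    by (intro continuous_on_matrix_vector_mult continuous_on_compose2[OF G'c] continuous_intros) auto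
  have map_meas: "(\<lambda>z. (x + (fst z + c) *\<^sub>R v, snd z)) \<in> measurable (lborel \<Otimes>\<^sub>M M) (borel \<Otimes>\<^sub>M M)" for c :: real
    by measurable
  have gm[measurable]: "(\<lambda>z. ?g (fst z) (snd z)) \<in> borel_measurable (lborel \<Otimes>\<^sub>M M)"
  proof -
    have "(\<lambda>z. G' (x + fst z *\<^sub>R v) (snd z)) \<in> borel_measurable (lborel \<Otimes>\<^sub>M M)"
      using measurable_compose[OF map_meas[of 0] G'm] by simp
    then show ?thesis
      by (rule borel_measurable_continuous_on[rotated]) (intro continuous_on_matrix_vector_mult continuous_intros)
  qed
  have gint: "integrable lborel (\<lambda>\<rho>. indicator {0..1} \<rho> *\<^sub>R ?g \<rho> \<omega>)"
     "(\<integral>\<rho>. indicator {0..1} \<rho> *\<^sub>R ?g \<rho> \<omega> \<partial>lborel) = integral {0..1} (\<lambda>\<rho>. ?g \<rho> \<omega>)" for \<omega>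
  proof -
    show i: "integrable lborel (\<lambda>\<rho>. indicator {0..1} \<rho> *\<^sub>R ?g \<rho> \<omega>)"
      by (rule borel_integrable_compact) (auto intro: gcont)
    then have "set_integrable lborel {0..1} (\<lambda>\<rho>. ?g \<rho> \<omega>)" by (simp add: set_integrable_def)
    from set_borel_integral_eq_integral(2)[OF this]
    show "(\<integral>\<rho>. indicator {0..1} \<rho> *\<^sub>R ?g \<rho> \<omega> \<partial>lborel) = integral {0..1} (\<lambda>\<rho>. ?g \<rho> \<omega>)"
      by (simp add: set_lebesgue_integral_def)
  qed
  have key: "\<exists>h. integrable M h \<and> (\<integral>\<omega>. h \<omega> \<partial>M) \<le> \<epsilon> k * norm v \<and>
      (AE \<omega> in M. norm (F k (x + v) \<omega> - F k x \<omega> - integral {0..1} (\<lambda>\<rho>. ?g \<rho> \<omega>)) \<le> h \<omega>)" for k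
  proof -
    let ?J = "\<lambda>\<rho> \<omega>. jacobian (\<lambda>y. F k y \<omega>) (at (x + \<rho> *\<^sub>R v)) *v v"
    have cont: "AE \<omega> in M. continuous_on UNIV (\<lambda>y. F k y \<omega>)"
      using Fd[of k] by eventually_elim (auto simp: continuous_on_eq_continuous_at intro: differentiable_imp_continuous_within)
    obtain F' where F': "\<And>w. continuous_on UNIV (\<lambda>p. F' p w)" "(\<lambda>(p, w). F' p w) \<in> borel_measurable (borel \<Otimes>\<^sub>M M)"
      "\<And>p. F' p \<in> borel_measurable M" "AE w in M. \<forall>p. F' p w = F k p w"
      using continuous_modification[OF Fm cont] by blast
    \<comment> \<open>The Jacobian along the segment is a limit of difference quotients of a jointly measurable modification, and so has the jointly measurable version \<open>E\<close> that Fubini requires.\<close>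
    define q where "q n z = real (Suc n) *\<^sub>R (F' (x + (fst z + inverse (real (Suc n))) *\<^sub>R v) (snd z) - F' (x + (fst z + 0) *\<^sub>R v) (snd z))"
      for n and z :: "real \<times> 'a"
    define E where "E z = lim (\<lambda>n. q n z)" for z
    have [measurable]: "(\<lambda>z. F' (x + (fst z + c) *\<^sub>R v) (snd z)) \<in> borel_measurable (lborel \<Otimes>\<^sub>M M)" for c
      using measurable_compose[OF map_meas[of c] F'(2)] by simp
    have qm: "q n \<in> borel_measurable (lborel \<Otimes>\<^sub>M M)" for n unfolding q_def[abs_def] by measurable
    have Em[measurable]: "E \<in> borel_measurable (lborel \<Otimes>\<^sub>M M)"
      unfolding E_def[abs_def] by (rule borel_measurable_lim_metric[OF qm])
    have EJ: "AE \<omega> in M. \<forall>\<rho>. E (\<rho>, \<omega>) = ?J \<rho> \<omega>"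
      using F'(4) Fd[of k]
    proof eventually_elim
      case (elim \<omega>)
      show ?case
      proof
        fix \<rho>
        have lim: "(\<lambda>n. q n (\<rho>, \<omega>)) \<longlonglongrightarrow> ?J \<rho> \<omega>"
        proof (rule vec_tendstoI)
          fix i
          have "((\<lambda>\<rho>. F k (x + \<rho> *\<^sub>R v) \<omega>) has_vector_derivative ?J \<rho> \<omega>) (at \<rho>)"
            using elim(2) by (intro differentiable_line_derivative) auto
          then have "((\<lambda>\<rho>. F k (x + \<rho> *\<^sub>R v) \<omega> $ i) has_vector_derivative ?J \<rho> \<omega> $ i) (at \<rho>)"
            by (rule bounded_linear.has_vector_derivative[OF bounded_linear_vec_nth])
          then have "((\<lambda>\<rho>. F k (x + \<rho> *\<^sub>R v) \<omega> $ i) has_real_derivative ?J \<rho> \<omega> $ i) (at \<rho>)"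
            by (simp add: has_real_derivative_iff_has_vector_derivative)
          then have "((\<lambda>h. (F k (x + (\<rho> + h) *\<^sub>R v) \<omega> $ i - F k (x + \<rho> *\<^sub>R v) \<omega> $ i) / h) \<longlongrightarrow> ?J \<rho> \<omega> $ i) (at 0)"
            by (rule DERIV_D)
          moreover have "filterlim (\<lambda>n. inverse (real (Suc n))) (at 0) sequentially"
            by (intro filterlim_atI LIMSEQ_inverse_real_of_nat) auto
          ultimately have "(\<lambda>n. (F k (x + (\<rho> + inverse (real (Suc n))) *\<^sub>R v) \<omega> $ i - F k (x + \<rho> *\<^sub>R v) \<omega> $ i) / inverse (real (Suc n))) \<longlonglongrightarrow> ?J \<rho> \<omega> $ i"
            by (rule filterlim_compose)
          then show "(\<lambda>n. q n (\<rho>, \<omega>) $ i) \<longlonglongrightarrow> ?J \<rho> \<omega> $ i"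
            using elim(1) by (simp add: q_def divide_inverse mult.commute del: of_nat_Suc)
        qed
        show "E (\<rho>, \<omega>) = ?J \<rho> \<omega>" unfolding E_def by (rule limI[OF lim])
      qed
    qed
    define H where "H z = indicator {0..1} (fst z) *\<^sub>R (E z - ?g (fst z) (snd z))" for z
    have Hm[measurable]: "H \<in> borel_measurable (lborel \<Otimes>\<^sub>M M)" unfolding H_def[abs_def] by measurable
    have sec: "integrable M (\<lambda>\<omega>. H (\<rho>, \<omega>)) \<and> (\<integral>\<omega>. norm (H (\<rho>, \<omega>)) \<partial>M) \<le> indicator {0..1} \<rho> * (\<epsilon> k * norm v)" for \<rho>
    proof (cases "\<rho> \<in> {0..1}")
      case False then show ?thesis by (simp add: H_def)
    next
      case True
      let ?D = "\<lambda>\<omega>. jacobian (\<lambda>y. F k y \<omega>) (at (x + \<rho> *\<^sub>R v)) - G' (x + \<rho> *\<^sub>R v) \<omega>"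
      have Hs: "(\<lambda>\<omega>. H (\<rho>, \<omega>)) \<in> borel_measurable M"
        using measurable_compose[OF measurable_Pair1' Hm] by simp
      have le: "AE \<omega> in M. norm (H (\<rho>, \<omega>)) \<le> norm (?D \<omega>) * norm v"
        using EJ
      proof eventually_elim
        case (elim \<omega>)
        have "H (\<rho>, \<omega>) = ?D \<omega> *v v" using True elim by (simp add: H_def matrix_vector_mult_diff_rdistrib)
        then show ?case using norm_matrix_vector_le[of "?D \<omega>" v] by simp
      qed
      have di: "integrable M (\<lambda>\<omega>. norm (?D \<omega>) * norm v)" using i2[OF seg[OF True], of k] by auto
      have Hi: "integrable M (\<lambda>\<omega>. H (\<rho>, \<omega>))"
        by (rule Bochner_Integration.integrable_bound[OF di Hs]) (use le in auto)
      have "(\<integral>\<omega>. norm (H (\<rho>, \<omega>)) \<partial>M) \<le> (\<integral>\<omega>. norm (?D \<omega>) * norm v \<partial>M)"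
        using Hi di le by (intro integral_mono_AE) auto
      also have "\<dots> \<le> \<epsilon> k * norm v" using c2(1)[OF seg[OF True], of k] by (simp add: mult_right_mono)
      finally show ?thesis using Hi True by simp
    qed
    have indi: "integrable lborel (\<lambda>\<rho>. indicator {0..1::real} \<rho> * (\<epsilon> k * norm v) :: real)"
      by (intro integrable_mult_left integrable_real_indicator emeasure_bounded_finite) auto
    have nn: "0 \<le> (\<integral>\<omega>. norm (H (\<rho>, \<omega>)) \<partial>M)" for \<rho> by (rule Bochner_Integration.integral_nonneg) simp
    have nn': "0 \<le> indicator {0..1} \<rho> * (\<epsilon> k * norm v)" for \<rho> :: real using order_trans[OF nn conjunct2[OF sec]] .
    have Hi: "integrable (lborel \<Otimes>\<^sub>M M) H"
    proof (rule L.Fubini_integrable[OF Hm])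
      show "AE \<rho> in lborel. integrable M (\<lambda>\<omega>. H (\<rho>, \<omega>))" using sec by auto
      show "integrable lborel (\<lambda>\<rho>. \<integral>\<omega>. norm (H (\<rho>, \<omega>)) \<partial>M)"
      proof (rule Bochner_Integration.integrable_bound[OF indi])
        show "AE \<rho> in lborel. norm (\<integral>\<omega>. norm (H (\<rho>, \<omega>)) \<partial>M) \<le> norm (indicator {0..1} \<rho> * (\<epsilon> k * norm v))"
          unfolding real_norm_def abs_of_nonneg[OF nn] abs_of_nonneg[OF nn'] using sec by blast
      qed measurable
    qed
    have Hn: "integrable (lborel \<Otimes>\<^sub>M M) (\<lambda>z. norm (H z))" using Hi by auto
    define h where "h \<omega> = (\<integral>\<rho>. norm (H (\<rho>, \<omega>)) \<partial>lborel)" for \<omega>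
    have hi: "integrable M h"
      unfolding h_def[abs_def] using L.integrable_snd[of "\<lambda>\<rho> \<omega>. norm (H (\<rho>, \<omega>))"] Hn by (simp add: split_beta')
    have "(\<integral>\<omega>. h \<omega> \<partial>M) = (\<integral>\<rho>. (\<integral>\<omega>. norm (H (\<rho>, \<omega>)) \<partial>M) \<partial>lborel)"
      unfolding h_def using L.Fubini_integral[of "\<lambda>\<rho> \<omega>. norm (H (\<rho>, \<omega>))"] Hn by (simp add: split_beta')
    also have "\<dots> \<le> (\<integral>\<rho>. indicator {0..1::real} \<rho> * (\<epsilon> k * norm v) \<partial>lborel)"
    proof (rule integral_mono'[OF indi])
      show "(\<integral>\<omega>. norm (H (\<rho>, \<omega>)) \<partial>M) \<le> indicator {0..1} \<rho> * (\<epsilon> k * norm v)" for \<rho> using sec by blast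
      show "0 \<le> indicator {0..1} \<rho> * (\<epsilon> k * norm v)" for \<rho> :: real
        by (rule nn')
    qed
    also have "\<dots> = \<epsilon> k * norm v" by simp
    finally have hle: "(\<integral>\<omega>. h \<omega> \<partial>M) \<le> \<epsilon> k * norm v" .
    have "AE \<omega> in M. integrable lborel (\<lambda>\<rho>. H (\<rho>, \<omega>))"
      using L.AE_integrable_snd[of "\<lambda>\<rho> \<omega>. H (\<rho>, \<omega>)"] Hi by (simp add: split_beta')
    then have "AE \<omega> in M. norm (F k (x + v) \<omega> - F k x \<omega> - integral {0..1} (\<lambda>\<rho>. ?g \<rho> \<omega>)) \<le> h \<omega>"
      using EJ Fd[of k]
    proof eventually_elim
      case (elim \<omega>)
      have Jeq: "indicator {0..1} \<rho> *\<^sub>R ?J \<rho> \<omega> = H (\<rho>, \<omega>) + indicator {0..1} \<rho> *\<^sub>R ?g \<rho> \<omega>" for \<rho>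
        using elim(2) by (simp add: H_def algebra_simps)
      have Ji: "integrable lborel (\<lambda>\<rho>. indicator {0..1} \<rho> *\<^sub>R ?J \<rho> \<omega>)"
        unfolding Jeq using elim(1) gint(1) by (rule Bochner_Integration.integrable_add)
      then have Js: "set_integrable lborel {0..1} (\<lambda>\<rho>. ?J \<rho> \<omega>)" by (simp add: set_integrable_def)
      have "((\<lambda>\<rho>. ?J \<rho> \<omega>) has_integral (F k (x + 1 *\<^sub>R v) \<omega> - F k (x + 0 *\<^sub>R v) \<omega>)) {0..1}"
        using elim(3) by (intro fundamental_theorem_of_calculus differentiable_line_derivative) auto
      then have "F k (x + v) \<omega> - F k x \<omega> = integral {0..1} (\<lambda>\<rho>. ?J \<rho> \<omega>)" by (simp add: integral_unique)
      also have "\<dots> = (\<integral>\<rho>. indicator {0..1} \<rho> *\<^sub>R ?J \<rho> \<omega> \<partial>lborel)"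
        using set_borel_integral_eq_integral(2)[OF Js] by (simp add: set_lebesgue_integral_def)
      also have "\<dots> = (\<integral>\<rho>. H (\<rho>, \<omega>) \<partial>lborel) + integral {0..1} (\<lambda>\<rho>. ?g \<rho> \<omega>)"
        unfolding Jeq using elim(1) gint(1)[of \<omega>] gint(2)[of \<omega>] by simp
      finally have "F k (x + v) \<omega> - F k x \<omega> - integral {0..1} (\<lambda>\<rho>. ?g \<rho> \<omega>) = (\<integral>\<rho>. H (\<rho>, \<omega>) \<partial>lborel)" by simp
      then show ?case unfolding h_def by (simp only: integral_norm_bound)
    qed
    then show ?thesis using hi hle by blast
  qed
  define W where "W \<omega> = G (x + v) \<omega> - G x \<omega> - integral {0..1} (\<lambda>\<rho>. ?g \<rho> \<omega>)" for \<omega>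
  have gms: "(\<lambda>z. ?g (snd z) (fst z)) \<in> borel_measurable (M \<Otimes>\<^sub>M lborel)"
    using measurable_compose[OF measurable_pair_swap' gm] by (simp add: split_beta')
  have Wm: "W \<in> borel_measurable M"
  proof -
    have "(\<lambda>\<omega>. \<integral>\<rho>. indicator {0..1} \<rho> *\<^sub>R ?g \<rho> \<omega> \<partial>lborel) \<in> borel_measurable M"
      by (rule lborel.borel_measurable_lebesgue_integral) (unfold split_beta', use gms in measurable)
    then show ?thesis unfolding W_def[abs_def] using Gm[OF xK(1)] Gm[OF xK(2)] by (simp add: gint(2))
  qed
  have bound: "(\<integral>\<omega>. norm (W \<omega>) \<partial>M) \<le> (\<integral>\<omega>. norm (F k (x + v) \<omega> - G (x + v) \<omega>) \<partial>M) + (\<integral>\<omega>. norm (F k x \<omega> - G x \<omega>) \<partial>M) + \<epsilon> k * norm v \<and> integrable M W" for k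
  proof -
    obtain h where h: "integrable M h" "(\<integral>\<omega>. h \<omega> \<partial>M) \<le> \<epsilon> k * norm v"
      "AE \<omega> in M. norm (F k (x + v) \<omega> - F k x \<omega> - integral {0..1} (\<lambda>\<rho>. ?g \<rho> \<omega>)) \<le> h \<omega>" using key by blast
    let ?b = "\<lambda>\<omega>. norm (F k (x + v) \<omega> - G (x + v) \<omega>) + norm (F k x \<omega> - G x \<omega>) + h \<omega>"
    have bi: "integrable M ?b" using i1[OF xK(1), of k] i1[OF xK(2), of k] h by auto
    have le: "AE \<omega> in M. norm (W \<omega>) \<le> ?b \<omega>"
      using h(3)
    proof eventually_elim
      case (elim \<omega>)
      have "W \<omega> = (F k (x + v) \<omega> - F k x \<omega> - integral {0..1} (\<lambda>\<rho>. ?g \<rho> \<omega>)) + (F k x \<omega> - G x \<omega>) - (F k (x + v) \<omega> - G (x + v) \<omega>)"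
        by (simp add: W_def)
      then have "norm (W \<omega>) \<le> norm (F k (x + v) \<omega> - F k x \<omega> - integral {0..1} (\<lambda>\<rho>. ?g \<rho> \<omega>)) + norm (F k x \<omega> - G x \<omega>) + norm (F k (x + v) \<omega> - G (x + v) \<omega>)"
        using norm_triangle_ineq4[of "(F k (x + v) \<omega> - F k x \<omega> - integral {0..1} (\<lambda>\<rho>. ?g \<rho> \<omega>)) + (F k x \<omega> - G x \<omega>)" "F k (x + v) \<omega> - G (x + v) \<omega>"]
          norm_triangle_ineq[of "F k (x + v) \<omega> - F k x \<omega> - integral {0..1} (\<lambda>\<rho>. ?g \<rho> \<omega>)" "F k x \<omega> - G x \<omega>"]
        by (simp only:)
      then show ?case using elim by linarith
    qed
    have Wi: "integrable M W" by (rule Bochner_Integration.integrable_bound[OF bi Wm]) (use le in auto)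
    have "(\<integral>\<omega>. norm (W \<omega>) \<partial>M) \<le> (\<integral>\<omega>. ?b \<omega> \<partial>M)" using Wi bi le by (intro integral_mono_AE) auto
    also have "\<dots> = (\<integral>\<omega>. norm (F k (x + v) \<omega> - G (x + v) \<omega>) \<partial>M) + (\<integral>\<omega>. norm (F k x \<omega> - G x \<omega>) \<partial>M) + (\<integral>\<omega>. h \<omega> \<partial>M)"
      using i1[OF xK(1), of k] i1[OF xK(2), of k] h by simp
    finally show ?thesis using h Wi by simp
  qed
  have "(\<lambda>k. (\<integral>\<omega>. norm (F k (x + v) \<omega> - G (x + v) \<omega>) \<partial>M) + (\<integral>\<omega>. norm (F k x \<omega> - G x \<omega>) \<partial>M) + \<epsilon> k * norm v) \<longlonglongrightarrow> 0"
    by (intro tendsto_add_zero c1 xK tendsto_mult_left_zero c2)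
  then have "(\<integral>\<omega>. norm (W \<omega>) \<partial>M) \<le> 0" by (rule LIMSEQ_le_const) (use bound in auto)
  then have "(\<integral>\<omega>. norm (W \<omega>) \<partial>M) = 0" by (intro antisym) (auto intro: integral_nonneg_AE)
  then have "AE \<omega> in M. norm (W \<omega>) = 0"
    using integral_nonneg_eq_0_iff_AE[of M "\<lambda>\<omega>. norm (W \<omega>)"] bound by auto
  then show ?thesis by eventually_elim (simp add: W_def)
qed

lemma line_integral_continuous:
  fixes g' :: "real ^ 'd \<Rightarrow> real ^ 'd ^ 'd"
  assumes g': "continuous_on UNIV g'" and w: "continuous_on UNIV w"
  shows "continuous_on UNIV (\<lambda>p. integral {0..1} (\<lambda>\<rho>. g' (fst p + \<rho> *\<^sub>R snd p) *v w p))"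
proof -
  have "continuous_on (UNIV \<times> cbox 0 1) (\<lambda>(p, \<rho>). g' (fst p + \<rho> *\<^sub>R snd p) *v w p)"
    unfolding split_beta'
    by (intro continuous_on_matrix_vector_mult continuous_on_compose2[OF g'] continuous_on_compose2[OF w] continuous_intros) auto
  from integral_continuous_on_param[OF this] show ?thesis by simp
qed

text \<open>For fixed end points the exceptional event depends on them. Both sides are continuous in the pair of
  start point and direction, so a countable dense set of pairs suffices.\<close>

lemma (in prob_space) limit_line_integral_all:
  fixes F :: "nat \<Rightarrow> real ^ 'd \<Rightarrow> 'a \<Rightarrow> real ^ 'd" and G :: "real ^ 'd \<Rightarrow> 'a \<Rightarrow> real ^ 'd"
    and G' :: "real ^ 'd \<Rightarrow> 'a \<Rightarrow> real ^ 'd ^ 'd"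
  assumes K: "convex K"
    and Fm: "\<And>k y. F k y \<in> borel_measurable M"
    and Fd: "\<And>k. AE \<omega> in M. \<forall>y. (\<lambda>y. F k y \<omega>) differentiable (at y)"
    and Gm: "\<And>y. y \<in> K \<Longrightarrow> G y \<in> borel_measurable M"
    and Gc: "\<And>\<omega>. continuous_on UNIV (\<lambda>y. G y \<omega>)"
    and G'c: "\<And>\<omega>. continuous_on UNIV (\<lambda>y. G' y \<omega>)"
    and G'm: "(\<lambda>(y, \<omega>). G' y \<omega>) \<in> borel_measurable (borel \<Otimes>\<^sub>M M)"
    and i1: "\<And>k y. y \<in> K \<Longrightarrow> integrable M (\<lambda>\<omega>. F k y \<omega> - G y \<omega>)"
    and c1: "\<And>y. y \<in> K \<Longrightarrow> (\<lambda>k. \<integral>\<omega>. norm (F k y \<omega> - G y \<omega>) \<partial>M) \<longlonglongrightarrow> 0"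
    and i2: "\<And>k y. y \<in> K \<Longrightarrow> integrable M (\<lambda>\<omega>. jacobian (\<lambda>y. F k y \<omega>) (at y) - G' y \<omega>)"
    and c2: "\<And>k y. y \<in> K \<Longrightarrow> (\<integral>\<omega>. norm (jacobian (\<lambda>y. F k y \<omega>) (at y) - G' y \<omega>) \<partial>M) \<le> \<epsilon> k" "\<epsilon> \<longlonglongrightarrow> 0"
  shows "AE \<omega> in M. \<forall>x\<in>K. \<forall>y\<in>K. G y \<omega> - G x \<omega> = integral {0..1} (\<lambda>\<rho>. G' (x + \<rho> *\<^sub>R (y - x)) \<omega> *v (y - x))"
proof -
  define S where "S = {p. fst p \<in> K \<and> fst p + snd p \<in> K}"
  obtain D where D: "countable D" "D \<subseteq> S" "S \<subseteq> closure D" by (rule separable)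
  have "AE \<omega> in M. \<forall>p\<in>D. G (fst p + snd p) \<omega> - G (fst p) \<omega> = integral {0..1} (\<lambda>\<rho>. G' (fst p + \<rho> *\<^sub>R snd p) \<omega> *v snd p)"
  proof (subst AE_ball_countable[OF D(1)], intro ballI)
    fix p assume "p \<in> D"
    then have p: "fst p \<in> K" "fst p + snd p \<in> K" using D(2) by (auto simp: S_def)
    have seg: "fst p + \<rho> *\<^sub>R snd p \<in> K" if "\<rho> \<in> {0..1}" for \<rho>
    proof -
      have "(1 - \<rho>) *\<^sub>R fst p + \<rho> *\<^sub>R (fst p + snd p) \<in> K" using K p that by (intro convexD) auto
      then show ?thesis by (simp add: algebra_simps)
    qed
    show "AE \<omega> in M. G (fst p + snd p) \<omega> - G (fst p) \<omega> = integral {0..1} (\<lambda>\<rho>. G' (fst p + \<rho> *\<^sub>R snd p) \<omega> *v snd p)"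
      by (rule limit_line_integral[OF Fm Fd Gm G'c G'm seg i1 c1 i2 c2])
  qed
  then show ?thesis
  proof eventually_elim
    case (elim \<omega>)
    show ?case
    proof (intro ballI)
      fix x y assume xy: "x \<in> K" "y \<in> K"
      let ?\<Phi> = "\<lambda>p. G (fst p + snd p) \<omega> - G (fst p) \<omega> - integral {0..1} (\<lambda>\<rho>. G' (fst p + \<rho> *\<^sub>R snd p) \<omega> *v snd p)"
      have "continuous_on UNIV ?\<Phi>"
        by (intro continuous_intros line_integral_continuous continuous_on_compose2[OF Gc] G'c) auto
      then have c: "continuous_on (closure D) ?\<Phi>" by (rule continuous_on_subset) simp
      have "(x, y - x) \<in> closure D" using D(3) xy by (auto simp: S_def)
      then have "?\<Phi> (x, y - x) = 0"
        by (rule continuous_constant_on_closure[OF c, rotated]) (use elim in auto)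
      then show "G y \<omega> - G x \<omega> = integral {0..1} (\<lambda>\<rho>. G' (x + \<rho> *\<^sub>R (y - x)) \<omega> *v (y - x))" by simp
    qed
  qed
qed

text \<open>The difference quotient in direction \<open>axis j 1\<close> is the average \<open>\<Psi> r\<close> of the \<open>j\<close>-th column of
  \<open>g'\<close> over a shrinking segment.\<close>

lemma line_integral_component_derivative:
  fixes g :: "real ^ 'd \<Rightarrow> real ^ 'd" and g' :: "real ^ 'd \<Rightarrow> real ^ 'd ^ 'd"
  assumes U: "open U" "U \<subseteq> K" and g': "continuous_on UNIV g'"
    and eq: "\<forall>x\<in>K. \<forall>y\<in>K. g y - g x = integral {0..1} (\<lambda>\<rho>. g' (x + \<rho> *\<^sub>R (y - x)) *v (y - x))"
    and x: "x \<in> U"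
  shows "((\<lambda>r. g (x + r *\<^sub>R axis j 1) $ i) has_real_derivative g' x $ i $ j) (at 0)"
proof -
  let ?e = "axis j 1 :: real ^ 'd"
  define \<Psi> where "\<Psi> r = integral {0..1} (\<lambda>\<rho>. g' (x + \<rho> *\<^sub>R (r *\<^sub>R ?e)) *v ?e)" for r
  have "continuous_on UNIV (\<lambda>p :: (real ^ 'd) \<times> (real ^ 'd). integral {0..1} (\<lambda>\<rho>. g' (fst p + \<rho> *\<^sub>R snd p) *v ?e))"
    by (rule line_integral_continuous[OF g' continuous_on_const])
  then have "continuous_on UNIV (\<lambda>r. integral {0..1} (\<lambda>\<rho>. g' (fst (x, r *\<^sub>R ?e) + \<rho> *\<^sub>R snd (x, r *\<^sub>R ?e)) *v ?e))"
    by (rule continuous_on_compose2) (auto intro!: continuous_intros)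
  then have "continuous_on UNIV \<Psi>" by (simp add: \<Psi>_def[abs_def])
  then have "isCont \<Psi> 0" by (simp add: continuous_on_eq_continuous_at)
  moreover have "\<Psi> 0 = g' x *v ?e" by (simp add: \<Psi>_def)
  ultimately have "(\<Psi> \<longlongrightarrow> g' x *v ?e) (at 0)" by (simp add: isCont_def)
  then have lim: "((\<lambda>r. \<Psi> r $ i) \<longlongrightarrow> g' x $ i $ j) (at 0)"
    using tendsto_vec_nth[of \<Psi> "g' x *v ?e" "at 0" i] by (simp add: matrix_vector_mul_component inner_axis)
  have "open ((\<lambda>r. x + r *\<^sub>R ?e) -` U)" using U(1) by (intro open_vimage) (auto intro!: continuous_intros)
  then have "\<forall>\<^sub>F r in nhds 0. r \<in> (\<lambda>r. x + r *\<^sub>R ?e) -` U" by (rule eventually_nhds_in_open) (use x in simp)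
  then have ev: "\<forall>\<^sub>F r in at 0. x + r *\<^sub>R ?e \<in> U \<and> r \<noteq> 0" by (auto simp: eventually_at_filter elim: eventually_mono)
  have "((\<lambda>h. (g (x + (0 + h) *\<^sub>R ?e) $ i - g (x + 0 *\<^sub>R ?e) $ i) / h) \<longlongrightarrow> g' x $ i $ j) (at 0)"
    using lim
  proof (rule Lim_transform_eventually)
    show "\<forall>\<^sub>F r in at 0. \<Psi> r $ i = (g (x + (0 + r) *\<^sub>R ?e) $ i - g (x + 0 *\<^sub>R ?e) $ i) / r"
      using ev
    proof eventually_elim
      case (elim r)
      have "g (x + r *\<^sub>R ?e) - g x = integral {0..1} (\<lambda>\<rho>. g' (x + \<rho> *\<^sub>R ((x + r *\<^sub>R ?e) - x)) *v ((x + r *\<^sub>R ?e) - x))"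
        using eq x elim U(2) by blast
      also have "\<dots> = integral {0..1} (\<lambda>\<rho>. r *\<^sub>R (g' (x + \<rho> *\<^sub>R (r *\<^sub>R ?e)) *v ?e))"
        by (simp add: matrix_vector_mult_scaleR)
      also have "\<dots> = r *\<^sub>R \<Psi> r" unfolding \<Psi>_def by (rule integral_cmul)
      finally have "(g (x + r *\<^sub>R ?e) - g x) $ i = r * \<Psi> r $ i" by simp
      then show ?case using elim by (simp add: field_simps)
    qed
  qed
  then show ?thesis by (simp add: DERIV_def)
qed

section \<open>Limits in mean square and their continuous versions\<close>

lemma (in finite_measure) square_integrable_imp_integrable:
  fixes f :: "'a \<Rightarrow> 'b::euclidean_space"
  assumes "square_integrable M f"
  shows "integrable M f"
proof (rule Bochner_Integration.integrable_bound)
  show "integrable M (\<lambda>\<omega>. 1 + (norm (f \<omega>))\<^sup>2)" using assms by (auto simp: square_integrable_def)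
  show "AE \<omega> in M. norm (f \<omega>) \<le> norm (1 + (norm (f \<omega>))\<^sup>2)"
  proof (intro AE_I2)
    fix \<omega>
    have "2 * norm (f \<omega>) * 1 \<le> (norm (f \<omega>))\<^sup>2 + 1\<^sup>2" by (rule sum_squares_bound)
    moreover have "0 \<le> norm (f \<omega>)" by simp
    ultimately have "norm (f \<omega>) \<le> 1 + (norm (f \<omega>))\<^sup>2" by (simp only: one_power2)
    then show "norm (f \<omega>) \<le> norm (1 + (norm (f \<omega>))\<^sup>2)" by simp
  qed
qed (use assms in \<open>simp add: square_integrable_def\<close>)

lemma (in prob_space) L1_le_L2_dist:
  fixes f g :: "'a \<Rightarrow> 'b::euclidean_space"
  assumes f: "square_integrable M f" and g: "square_integrable M g"
  shows "integrable M (\<lambda>\<omega>. f \<omega> - g \<omega>)" "(\<integral>\<omega>. norm (f \<omega> - g \<omega>) \<partial>M) \<le> L2_dist M f g"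
proof -
  have [measurable]: "f \<in> borel_measurable M" "g \<in> borel_measurable M" using f g by (auto simp: square_integrable_def)
  let ?h = "\<lambda>\<omega>. norm (f \<omega> - g \<omega>)"
  have sq: "integrable M (\<lambda>\<omega>. (?h \<omega>)\<^sup>2)"
  proof (rule Bochner_Integration.integrable_bound)
    show "integrable M (\<lambda>\<omega>. 2 * (norm (f \<omega>))\<^sup>2 + 2 * (norm (g \<omega>))\<^sup>2)" using f g by (auto simp: square_integrable_def)
    show "AE \<omega> in M. norm ((?h \<omega>)\<^sup>2) \<le> norm (2 * (norm (f \<omega>))\<^sup>2 + 2 * (norm (g \<omega>))\<^sup>2)"
    proof (intro AE_I2)
      fix \<omega>
      have "(?h \<omega>)\<^sup>2 \<le> (norm (f \<omega>) + norm (g \<omega>))\<^sup>2" by (intro power_mono norm_triangle_ineq4) simp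
      also have "\<dots> \<le> 2 * (norm (f \<omega>))\<^sup>2 + 2 * (norm (g \<omega>))\<^sup>2"
        using sum_squares_bound[of "norm (f \<omega>)" "norm (g \<omega>)"] by (simp add: power2_sum)
      finally show "norm ((?h \<omega>)\<^sup>2) \<le> norm (2 * (norm (f \<omega>))\<^sup>2 + 2 * (norm (g \<omega>))\<^sup>2)" by simp
    qed
  qed measurable
  then show i: "integrable M (\<lambda>\<omega>. f \<omega> - g \<omega>)"
    by (intro square_integrable_imp_integrable) (simp add: square_integrable_def)
  then have hi: "integrable M ?h" by simp
  have "0 \<le> (\<integral>\<omega>. (?h \<omega>)\<^sup>2 \<partial>M) - (\<integral>\<omega>. ?h \<omega> \<partial>M)\<^sup>2"
    using variance_eq[OF hi sq] variance_positive[of ?h] by simp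
  then show "(\<integral>\<omega>. ?h \<omega> \<partial>M) \<le> L2_dist M f g"
    unfolding L2_dist_def by (intro real_le_rsqrt) simp
qed

text \<open>Convergence is recorded in mean and for a modification \<open>Zt\<close> of the continuous version. The bound that is
  uniform over \<open>S\<close> is stated for a shifted sequence, because finitely many of the distances may be
  unbounded over \<open>S\<close>.\<close>

lemma (in prob_space) version_of_L2_limit:
  fixes F :: "nat \<Rightarrow> 'p::topological_space \<Rightarrow> 'a \<Rightarrow> 'b::euclidean_space"
  assumes Y: "converges_in_C_L2 M S F Y" and Z: "continuous_version M S Y Z"
    and Zt: "AE \<omega> in M. \<forall>p\<in>S. Zt p \<omega> = Z p \<omega>" "\<And>p. Zt p \<in> borel_measurable M"
  shows "p \<in> S \<Longrightarrow> integrable M (Zt p)" "p \<in> S \<Longrightarrow> integrable M (\<lambda>\<omega>. F k p \<omega> - Zt p \<omega>)"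
    "p \<in> S \<Longrightarrow> (\<lambda>k. \<integral>\<omega>. norm (F k p \<omega> - Zt p \<omega>) \<partial>M) \<longlonglongrightarrow> 0"
    "\<exists>k0 \<epsilon>. \<epsilon> \<longlonglongrightarrow> 0 \<and> (\<forall>k. \<forall>p\<in>S. (\<integral>\<omega>. norm (F (k + k0) p \<omega> - Zt p \<omega>) \<partial>M) \<le> \<epsilon> k)"
proof -
  have sqF: "square_integrable M (F k p)" and sqY: "square_integrable M (Y p)" if "p \<in> S" for k p
    using Y that by (auto simp: converges_in_C_L2_def in_C_L2_def)
  have u: "uniform_limit S (\<lambda>k p. L2_dist M (F k p) (Y p)) (\<lambda>p. 0) sequentially"
    using Y by (simp add: converges_in_C_L2_def)
  have L0: "0 \<le> L2_dist M f g" for f g :: "'a \<Rightarrow> 'b" by (simp add: L2_dist_def integral_nonneg_AE)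
  have ZY: "AE \<omega> in M. Zt p \<omega> = Y p \<omega>" if "p \<in> S" for p
  proof -
    have "AE \<omega> in M. Z p \<omega> = Y p \<omega>" using Z that by (simp add: continuous_version_def)
    with Zt(1) show ?thesis by eventually_elim (use that in auto)
  qed
  show int: "integrable M (Zt p)" if "p \<in> S" for p
    by (rule integrable_cong_AE_imp[OF square_integrable_imp_integrable[OF sqY[OF that]] Zt(2)])
       (use ZY[OF that] in \<open>auto elim: eventually_mono\<close>)
  have Fm: "F k p \<in> borel_measurable M" if "p \<in> S" for k p using sqF[OF that] by (simp add: square_integrable_def)
  show int2: "integrable M (\<lambda>\<omega>. F k p \<omega> - Zt p \<omega>)" if "p \<in> S" for k p
    using square_integrable_imp_integrable[OF sqF[OF that, of k]] int[OF that] by (rule Bochner_Integration.integrable_diff)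
  have le: "(\<integral>\<omega>. norm (F k p \<omega> - Zt p \<omega>) \<partial>M) \<le> L2_dist M (F k p) (Y p)" if "p \<in> S" for k p
  proof -
    have "(\<integral>\<omega>. norm (F k p \<omega> - Zt p \<omega>) \<partial>M) = (\<integral>\<omega>. norm (F k p \<omega> - Y p \<omega>) \<partial>M)"
      using ZY[OF that] int2[OF that, of k] L1_le_L2_dist(1)[OF sqF[OF that, of k] sqY[OF that]]
      by (intro integral_cong_AE) (auto elim: eventually_mono dest: borel_measurable_integrable)
    then show ?thesis using L1_le_L2_dist(2)[OF sqF[OF that, of k] sqY[OF that]] by simp
  qed
  show "(\<lambda>k. \<integral>\<omega>. norm (F k p \<omega> - Zt p \<omega>) \<partial>M) \<longlonglongrightarrow> 0" if "p \<in> S" for p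
  proof (rule Lim_null_comparison)
    show "(\<lambda>k. L2_dist M (F k p) (Y p)) \<longlonglongrightarrow> 0" using tendsto_uniform_limitI[OF u that] .
    show "\<forall>\<^sub>F k in sequentially. norm (\<integral>\<omega>. norm (F k p \<omega> - Zt p \<omega>) \<partial>M) \<le> L2_dist M (F k p) (Y p)"
      using le[OF that] by (auto simp: integral_nonneg_AE)
  qed
  have ev: "\<forall>\<^sub>F k in sequentially. \<forall>p\<in>S. L2_dist M (F k p) (Y p) < e" if "0 < e" for e
    using uniform_limitD[OF u that] L0 by (simp add: dist_real_def)
  obtain k0 where k0: "\<And>k p. k0 \<le> k \<Longrightarrow> p \<in> S \<Longrightarrow> L2_dist M (F k p) (Y p) < 1"
    using ev[of 1] by (auto simp: eventually_sequentially)
  \<comment> \<open>The additional index \<open>None\<close> keeps the supremum meaningful and nonnegative for empty \<open>S\<close>.\<close>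
  define \<epsilon> where "\<epsilon> k = (SUP p\<in>insert None (Some ` S). case p of None \<Rightarrow> 0 | Some p \<Rightarrow> L2_dist M (F (k + k0) p) (Y p))" for k
  have bdd: "bdd_above ((\<lambda>p. case p of None \<Rightarrow> 0 | Some p \<Rightarrow> L2_dist M (F (k + k0) p) (Y p)) ` insert None (Some ` S))" for k
    using k0[of "k + k0"] by (intro bdd_aboveI[of _ 1]) (auto intro: less_imp_le)
  have "\<epsilon> \<longlonglongrightarrow> 0"
  proof (rule LIMSEQ_I)
    fix e :: real assume e: "0 < e"
    obtain k1 where k1: "\<And>k p. k1 \<le> k \<Longrightarrow> p \<in> S \<Longrightarrow> L2_dist M (F k p) (Y p) < e / 2"
      using ev[of "e / 2"] e by (auto simp: eventually_sequentially)
    have "norm (\<epsilon> k - 0) < e" if "k1 \<le> k" for k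
    proof -
      have "\<epsilon> k \<le> e / 2" unfolding \<epsilon>_def
        using k1[of "k + k0"] e that by (intro cSUP_least) (auto intro: less_imp_le)
      moreover have "0 \<le> \<epsilon> k" unfolding \<epsilon>_def by (rule cSUP_upper2[OF bdd, of None]) auto
      ultimately show ?thesis using e by simp
    qed
    then show "\<exists>no. \<forall>k\<ge>no. norm (\<epsilon> k - 0) < e" by blast
  qed
  moreover have "(\<integral>\<omega>. norm (F (k + k0) p \<omega> - Zt p \<omega>) \<partial>M) \<le> \<epsilon> k" if "p \<in> S" for k p
  proof -
    have "L2_dist M (F (k + k0) p) (Y p) \<le> \<epsilon> k" unfolding \<epsilon>_def
      by (rule cSUP_upper2[OF bdd, of "Some p"]) (use that in auto)
    then show ?thesis using le[OF that, of "k + k0"] by simp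
  qed
  ultimately show "\<exists>k0 \<epsilon>. \<epsilon> \<longlonglongrightarrow> 0 \<and> (\<forall>k. \<forall>p\<in>S. (\<integral>\<omega>. norm (F (k + k0) p \<omega> - Zt p \<omega>) \<partial>M) \<le> \<epsilon> k)" by blast
qed

lemma strong_solution_cong:
  assumes X: "strong_solution M T B b s x X" and s: "0 \<le> s" and eq: "\<And>u y. u \<in> {0..T} \<Longrightarrow> b u y = b' u y"
  shows "strong_solution M T B b' s x X"
proof -
  have "AE \<omega> in M. \<forall>t\<in>{s..T}. integrable (lebesgue_on {s..t}) (\<lambda>u. b u (X u \<omega>)) \<and>
        X t \<omega> = x + (\<integral>u. b u (X u \<omega>) \<partial>lebesgue_on {s..t}) + B t \<omega> - B s \<omega>"
    using X by (simp add: strong_solution_def)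
  then have "AE \<omega> in M. \<forall>t\<in>{s..T}. integrable (lebesgue_on {s..t}) (\<lambda>u. b' u (X u \<omega>)) \<and>
        X t \<omega> = x + (\<integral>u. b' u (X u \<omega>) \<partial>lebesgue_on {s..t}) + B t \<omega> - B s \<omega>"
  proof eventually_elim
    case (elim \<omega>)
    show ?case
    proof
      fix t assume t: "t \<in> {s..T}"
      have e: "b u (X u \<omega>) = b' u (X u \<omega>)" if "u \<in> space (lebesgue_on {s..t})" for u using that t s by (intro eq) auto
      have "integrable (lebesgue_on {s..t}) (\<lambda>u. b u (X u \<omega>)) = integrable (lebesgue_on {s..t}) (\<lambda>u. b' u (X u \<omega>))"
        by (rule Bochner_Integration.integrable_cong[OF refl e])
      moreover have "(\<integral>u. b u (X u \<omega>) \<partial>lebesgue_on {s..t}) = (\<integral>u. b' u (X u \<omega>) \<partial>lebesgue_on {s..t})"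
        by (rule Bochner_Integration.integral_cong[OF refl e])
      ultimately show "integrable (lebesgue_on {s..t}) (\<lambda>u. b' u (X u \<omega>)) \<and>
        X t \<omega> = x + (\<integral>u. b' u (X u \<omega>) \<partial>lebesgue_on {s..t}) + B t \<omega> - B s \<omega>" using elim t by auto
    qed
  qed
  then show ?thesis using X by (simp add: strong_solution_def)
qed

text \<open>In the open strip the points violating the bound form an open null set, which is empty; the end times
  are reached by continuity.\<close>

lemma norm_le_on_strip:
  fixes g :: "real \<times> 'a::euclidean_space \<Rightarrow> 'b::real_normed_vector"
  assumes T: "0 < T" and cont: "continuous_on UNIV g"
    and ae: "AE p in lborel. fst p \<in> {0..T} \<longrightarrow> norm (g p) \<le> C" and u: "u \<in> {0..T}"
  shows "norm (g (u, y)) \<le> C"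
proof -
  let ?A = "{p. C < norm (g p)} \<inter> fst -` {0<..<T}"
  have "open ?A"
    using cont by (intro open_Int open_Collect_less open_vimage continuous_intros) auto
  moreover have "AE p in lborel. p \<notin> ?A" using ae by eventually_elim auto
  then have "?A \<in> null_sets lborel" using \<open>open ?A\<close> by (subst AE_iff_null_sets) auto
  then have "negligible ?A" by (simp add: negligible_iff_null_sets null_sets_completionI)
  ultimately have "?A = {}" using open_not_negligible by blast
  then have le: "norm (g (u, y)) \<le> C" if "u \<in> {0<..<T}" for u using that by (auto simp: not_less[symmetric])
  have cl: "closure {0<..<T} = {0..T}" using T by simp
  show ?thesis
  proof (rule continuous_le_on_closure[of "{0<..<T}" "\<lambda>u. norm (g (u, y))"])
    show "continuous_on (closure {0<..<T}) (\<lambda>u. norm (g (u, y)))"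
      by (intro continuous_on_norm continuous_on_compose2[OF cont] continuous_intros) auto
  qed (use cl u le in auto)
qed

section \<open>Random fields and Sobolev derivatives\<close>

lemma field_measure_measurableI:
  fixes Zt :: "real \<times> 'a::euclidean_space \<Rightarrow> 'w \<Rightarrow> 'b::topological_space"
  assumes "(\<lambda>(p, \<omega>). Zt p \<omega>) \<in> borel_measurable (borel \<Otimes>\<^sub>M M)"
  shows "(\<lambda>(t, x, \<omega>). Zt (t, x) \<omega>) \<in> borel_measurable (field_measure s T U M)"
proof -
  have 1: "(\<lambda>z. z) \<in> measurable (restrict_space lborel {s..T}) borel" "(\<lambda>z. z) \<in> measurable (restrict_space lborel U) borel"
    by (intro measurable_restrict_space1; simp)+
  have f: "fst \<in> measurable (field_measure s T U M) borel"
    unfolding field_measure_def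
    using measurable_compose[OF measurable_fst[of "restrict_space lborel {s..T}" "restrict_space lborel U \<Otimes>\<^sub>M M"] 1(1)] by simp
  have g: "(\<lambda>z. fst (snd z)) \<in> measurable (field_measure s T U M) borel"
    unfolding field_measure_def
    using measurable_compose[OF measurable_compose[OF measurable_snd[of "restrict_space lborel {s..T}" "restrict_space lborel U \<Otimes>\<^sub>M M"] measurable_fst] 1(2)] by simp
  have h: "(\<lambda>z. snd (snd z)) \<in> measurable (field_measure s T U M) M" unfolding field_measure_def by measurable
  have "(\<lambda>z. ((fst z, fst (snd z)), snd (snd z))) \<in> measurable (field_measure s T U M) (borel \<Otimes>\<^sub>M M)"
    using f g h unfolding borel_prod[symmetric] by measurable
  from measurable_compose[OF this assms] show ?thesis by (simp add: split_beta')
qed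

text \<open>Fubini's theorem, with \<open>x\<close> and \<open>\<omega>\<close> in either order at each time: the comparison of the fields fixes
  \<open>x\<close> first, the comparison of weak derivatives fixes \<open>\<omega>\<close> first.\<close>

lemma AE_field_measureI:
  fixes P :: "real \<Rightarrow> 'a::euclidean_space \<Rightarrow> 'w \<Rightarrow> bool"
  assumes M: "prob_space M" and U: "U \<in> sets borel"
    and P: "Measurable.pred (field_measure s T U M) (\<lambda>(t, x, \<omega>). P t x \<omega>)"
    and ae: "\<And>t. t \<in> {s..T} \<Longrightarrow>
      (AE x in restrict_space lborel U. AE \<omega> in M. P t x \<omega>) \<or> (AE \<omega> in M. AE x in restrict_space lborel U. P t x \<omega>)"
  shows "AE (t, x, \<omega>) in field_measure s T U M. P t x \<omega>"
proof -
  interpret M: prob_space M by fact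
  let ?R1 = "restrict_space lborel {s..T}" and ?R2 = "restrict_space lborel U"
  interpret R1: sigma_finite_measure ?R1
    by (intro sigma_finite_measure_restrict_space lborel.sigma_finite_measure_axioms) simp
  interpret R2: sigma_finite_measure ?R2
    using U by (intro sigma_finite_measure_restrict_space lborel.sigma_finite_measure_axioms) simp
  interpret P2: pair_sigma_finite ?R2 M by unfold_locales
  interpret P1: pair_sigma_finite ?R1 "?R2 \<Otimes>\<^sub>M M"
    by (intro pair_sigma_finite.intro R1.sigma_finite_measure_axioms sigma_finite_pair_measure
        R2.sigma_finite_measure_axioms M.sigma_finite_measure_axioms)
  have P': "Measurable.pred (?R1 \<Otimes>\<^sub>M (?R2 \<Otimes>\<^sub>M M)) (\<lambda>z. P (fst z) (fst (snd z)) (snd (snd z)))"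
    using P by (simp add: field_measure_def split_beta')
  have "AE z in ?R1 \<Otimes>\<^sub>M (?R2 \<Otimes>\<^sub>M M). P (fst z) (fst (snd z)) (snd (snd z))"
  proof (rule P1.AE_pair_measure)
    show "{z \<in> space (?R1 \<Otimes>\<^sub>M (?R2 \<Otimes>\<^sub>M M)). P (fst z) (fst (snd z)) (snd (snd z))} \<in> sets (?R1 \<Otimes>\<^sub>M (?R2 \<Otimes>\<^sub>M M))"
      using P' by (simp add: pred_def)
    show "AE t in ?R1. AE y in ?R2 \<Otimes>\<^sub>M M. P (fst (t, y)) (fst (snd (t, y))) (snd (snd (t, y)))"
    proof (rule AE_I2)
      fix t assume t: "t \<in> space ?R1"
      have Pt: "Measurable.pred (?R2 \<Otimes>\<^sub>M M) (\<lambda>y. P t (fst y) (snd y))"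
        using measurable_compose[OF measurable_Pair1'[OF t] P'] by simp
      have "AE x in ?R2. AE \<omega> in M. P t x \<omega>"
        using ae[of t] t P2.AE_commute[of "\<lambda>x \<omega>. P t x \<omega>"] Pt by (auto simp: pred_def space_restrict_space)
      then have "AE y in ?R2 \<Otimes>\<^sub>M M. P t (fst y) (snd y)"
        using Pt by (intro P2.AE_pair_measure) (auto simp: pred_def)
      then show "AE y in ?R2 \<Otimes>\<^sub>M M. P (fst (t, y)) (fst (snd (t, y))) (snd (snd (t, y)))" by simp
    qed
  qed
  then show ?thesis unfolding field_measure_def split_beta' .
qed

text \<open>The event \<open>Q\<close> is replaced by the complement of a measurable null set, to which Fubini's theorem applies.\<close>

lemma AE_field_measure_path:
  fixes U :: "'a::euclidean_space set"
  assumes M: "prob_space M" and U: "U \<in> sets borel" and Q: "AE \<omega> in M. Q \<omega>"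
  shows "AE (t, x, \<omega>) in field_measure s T U M. t \<in> {s..T} \<and> x \<in> U \<and> Q \<omega>"
proof -
  obtain N where N: "N \<in> null_sets M" "{\<omega> \<in> space M. \<not> Q \<omega>} \<subseteq> N"
    using Q by (auto elim!: AE_E simp: null_sets_def)
  have "AE (t, x, \<omega>) in field_measure s T U M. \<omega> \<notin> N"
  proof (rule AE_field_measureI[OF M U])
    have [measurable]: "N \<in> sets M" using N(1) by auto
    show "Measurable.pred (field_measure s T U M) (\<lambda>(t, x, \<omega>). \<omega> \<notin> N)"
      unfolding field_measure_def split_beta' by measurable
    show "(AE x in restrict_space lborel U. AE \<omega> in M. \<omega> \<notin> N) \<or> (AE \<omega> in M. AE x in restrict_space lborel U. \<omega> \<notin> N)" for t :: real
      using AE_not_in[OF N(1)] by simp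
  qed
  then show ?thesis
    using AE_space
  proof eventually_elim
    case (elim z)
    then show ?case using N(2)
      by (auto simp: field_measure_def space_pair_measure space_restrict_space split_beta')
  qed
qed

text \<open>Continuous functions are bounded on the bounded set \<open>U\<close>, hence square integrable, and classical partial
  derivatives are weak ones by integration by parts. The function \<open>f\<close> agrees with \<open>g\<close> only almost
  everywhere, as the solution field does with its continuous version.\<close>

lemma W12_with_derivativeI:
  fixes f g :: "real ^ 'd \<Rightarrow> real ^ 'd" and g' :: "real ^ 'd \<Rightarrow> real ^ 'd ^ 'd"
  assumes U: "open U" "bounded U" and f: "f \<in> borel_measurable (lebesgue_on U)" and fg: "AE x in lebesgue_on U. f x = g x"
    and g: "continuous_on UNIV g" "continuous_on UNIV g'"
    and deriv: "\<And>x i j. x \<in> U \<Longrightarrow> ((\<lambda>r. g (x + r *\<^sub>R axis j 1) $ i) has_real_derivative g' x $ i $ j) (at 0)"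
  shows "W12_with_derivative U f g'"
proof -
  have Ul: "U \<in> lmeasurable" using U by (intro lmeasurable_open)
  interpret finite_measure "lebesgue_on U" by (rule finite_measure_lebesgue_on[OF Ul])
  have cm: "h \<in> borel_measurable (lebesgue_on U)" if "continuous_on UNIV h" for h :: "real ^ 'd \<Rightarrow> 'b::euclidean_space"
    using borel_measurable_continuous_onI[OF that] by (intro measurable_restrict_space1 measurable_completion) simp
  have sq: "square_integrable (lebesgue_on U) h" if h: "continuous_on UNIV h" for h :: "real ^ 'd \<Rightarrow> 'b::euclidean_space"
  proof -
    have "compact (h ` closure U)" using U h by (intro compact_continuous_image) (auto intro: continuous_on_subset simp: compact_closure)
    then obtain c where c: "\<And>x. x \<in> closure U \<Longrightarrow> norm (h x) \<le> c" by (meson bounded_iff compact_imp_bounded imageI)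
    have "integrable (lebesgue_on U) (\<lambda>x. (norm (h x))\<^sup>2)"
    proof (rule integrable_const_bound[where B="c\<^sup>2"])
      show "AE x in lebesgue_on U. norm ((norm (h x))\<^sup>2) \<le> c\<^sup>2"
        using c closure_subset[of U] by (intro AE_I2) (auto simp: space_restrict_space intro!: power_mono)
    qed (use cm[OF h] in measurable)
    then show ?thesis using cm[OF h] by (simp add: square_integrable_def)
  qed
  have "integrable (lebesgue_on U) (\<lambda>x. (norm (f x))\<^sup>2)"
  proof (rule integrable_cong_AE_imp)
    show "integrable (lebesgue_on U) (\<lambda>x. (norm (g x))\<^sup>2)" using sq[OF g(1)] by (simp add: square_integrable_def)
    show "AE x in lebesgue_on U. (norm (g x))\<^sup>2 = (norm (f x))\<^sup>2" using fg by eventually_elim simp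
  qed (use f in measurable)
  then have sf: "square_integrable (lebesgue_on U) f" using f by (simp add: square_integrable_def)
  have "(\<integral>x. f x $ i * frechet_derivative \<phi> (at x) (axis j 1) \<partial>lebesgue_on U) = - (\<integral>x. g' x $ i $ j * \<phi> x \<partial>lebesgue_on U)"
    if \<phi>: "C_infinity_c \<phi>" "closure {x. \<phi> x \<noteq> 0} \<subseteq> U" for \<phi> i j
  proof -
    have ax: "axis j 1 \<in> (Basis :: (real ^ 'd) set)" by (simp add: axis_in_Basis_iff)
    have fi: "(\<lambda>x. f x $ i) \<in> borel_measurable (lebesgue_on U)"
      using f by (intro borel_measurable_continuous_on[of "\<lambda>v. v $ i"]) (auto intro!: continuous_intros)
    note dm = cm[OF C_infinity_cD(3)[OF \<phi>(1) ax]]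
    have gi: "(\<lambda>x. g x $ i) \<in> borel_measurable (lebesgue_on U)" using g(1) by (intro cm continuous_intros)
    have "(\<integral>x. f x $ i * frechet_derivative \<phi> (at x) (axis j 1) \<partial>lebesgue_on U)
      = (\<integral>x. g x $ i * frechet_derivative \<phi> (at x) (axis j 1) \<partial>lebesgue_on U)"
    proof (rule integral_cong_AE)
      show "AE x in lebesgue_on U. f x $ i * frechet_derivative \<phi> (at x) (axis j 1) = g x $ i * frechet_derivative \<phi> (at x) (axis j 1)"
        using fg by eventually_elim simp
    qed (rule borel_measurable_times[OF fi dm] borel_measurable_times[OF gi dm])+
    also have "\<dots> = - (\<integral>x. g' x $ i $ j * \<phi> x \<partial>lebesgue_on U)"
      using g by (intro weak_derivative_of_line_derivative U ax \<phi> deriv) (auto intro!: continuous_intros intro: continuous_on_subset)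
    finally show ?thesis .
  qed
  then show ?thesis using sf sq[OF g(2)] by (auto simp: W12_with_derivative_def)
qed

lemma W12_with_derivative_unique:
  fixes f :: "real ^ 'd \<Rightarrow> real ^ 'd" and G1 G2 :: "real ^ 'd \<Rightarrow> real ^ 'd ^ 'd"
  assumes U: "open U" "bounded U" and W: "W12_with_derivative U f G1" "W12_with_derivative U f G2"
  shows "AE x in lebesgue_on U. G1 x = G2 x"
proof -
  have Ul: "U \<in> lmeasurable" using U by (intro lmeasurable_open)
  interpret finite_measure "lebesgue_on U" by (rule finite_measure_lebesgue_on[OF Ul])
  have sG: "square_integrable (lebesgue_on U) G1" "square_integrable (lebesgue_on U) G2"
    using W by (auto simp: W12_with_derivative_def)
  have comp: "integrable (lebesgue_on U) (\<lambda>x. G x $ i $ j)" if "square_integrable (lebesgue_on U) G" for G :: "real ^ 'd \<Rightarrow> real ^ 'd ^ 'd" and i j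
    using square_integrable_imp_integrable[OF that]
    by (intro integrable_bounded_linear[OF bounded_linear_vec_nth])
  have "AE x in lebesgue_on U. G1 x $ i $ j - G2 x $ i $ j = 0" for i j
  proof (rule AE_zero_of_test_functions[OF U(1)])
    show "integrable (lebesgue_on U) (\<lambda>x. G1 x $ i $ j - G2 x $ i $ j)" using comp[OF sG(1)] comp[OF sG(2)] by auto
    fix \<phi> :: "real ^ 'd \<Rightarrow> real" assume \<phi>: "C_infinity_c \<phi>" "closure {x. \<phi> x \<noteq> 0} \<subseteq> U"
    have "compact (\<phi> ` closure {x. \<phi> x \<noteq> 0})"
      using C_infinity_cD(2,4)[OF \<phi>(1)] by (intro compact_continuous_image) (auto intro: continuous_on_subset)
    then obtain c where c: "\<And>x. x \<in> closure {x. \<phi> x \<noteq> 0} \<Longrightarrow> norm (\<phi> x) \<le> c" by (meson bounded_iff compact_imp_bounded imageI)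
    have c': "\<bar>\<phi> x\<bar> \<le> \<bar>c\<bar>" for x
    proof (cases "\<phi> x = 0")
      case False
      then have "norm (\<phi> x) \<le> c" using closure_subset[of "{x. \<phi> x \<noteq> 0}"] by (intro c) auto
      then show ?thesis by simp
    qed simp
    have \<phi>m: "\<phi> \<in> borel_measurable (lebesgue_on U)"
      using borel_measurable_continuous_onI[OF C_infinity_cD(2)[OF \<phi>(1)]] by (intro measurable_restrict_space1 measurable_completion) simp
    have pi: "integrable (lebesgue_on U) (\<lambda>x. v x * \<phi> x)" if v: "integrable (lebesgue_on U) v" for v :: "real ^ 'd \<Rightarrow> real"
    proof (rule Bochner_Integration.integrable_bound)
      show "integrable (lebesgue_on U) (\<lambda>x. v x * c)" using v by auto
      show "AE x in lebesgue_on U. norm (v x * \<phi> x) \<le> norm (v x * c)" using c' by (intro AE_I2) (auto simp: abs_mult intro!: mult_left_mono)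
    qed (rule borel_measurable_times[OF borel_measurable_integrable[OF v] \<phi>m])
    have "(\<integral>x. G1 x $ i $ j * \<phi> x \<partial>lebesgue_on U) = (\<integral>x. G2 x $ i $ j * \<phi> x \<partial>lebesgue_on U)"
    proof -
      have "(\<integral>x. f x $ i * frechet_derivative \<phi> (at x) (axis j 1) \<partial>lebesgue_on U) = - (\<integral>x. G1 x $ i $ j * \<phi> x \<partial>lebesgue_on U)"
        "(\<integral>x. f x $ i * frechet_derivative \<phi> (at x) (axis j 1) \<partial>lebesgue_on U) = - (\<integral>x. G2 x $ i $ j * \<phi> x \<partial>lebesgue_on U)"
        using W \<phi> unfolding W12_with_derivative_def by blast+
      then show ?thesis by simp
    qed
    then show "(\<integral>x. (G1 x $ i $ j - G2 x $ i $ j) * \<phi> x \<partial>lebesgue_on U) = 0"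
      using pi[OF comp[OF sG(1)]] pi[OF comp[OF sG(2)]] by (simp add: left_diff_distrib)
  qed
  then have "AE x in lebesgue_on U. \<forall>i j. G1 x $ i $ j - G2 x $ i $ j = 0"
    by (intro eventually_all_finite)
  then show ?thesis by eventually_elim (simp add: vec_eq_iff)
qed

lemma pred_eq_borel:
  fixes f g :: "'a \<Rightarrow> 'b::euclidean_space"
  assumes "f \<in> borel_measurable N" "g \<in> borel_measurable N"
  shows "Measurable.pred N (\<lambda>z. f z = g z)"
proof -
  have [measurable]: "(\<lambda>z. norm (f z - g z)) \<in> borel_measurable N"
    using assms by measurable
  have "Measurable.pred N (\<lambda>z. norm (f z - g z) = 0)" by measurable
  then show ?thesis by simp
qed

lemma AE_lebesgue_on_iff:
  assumes "U \<in> sets borel"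
  shows "(AE x in lebesgue_on U. P x) \<longleftrightarrow> (AE x in restrict_space lborel U. P x)"
  using assms by (simp add: AE_restrict_space_iff AE_completion_iff)

lemma field_section_measurable:
  fixes X :: "real \<Rightarrow> 'a::euclidean_space \<Rightarrow> 'w \<Rightarrow> 'b::topological_space"
  assumes X: "(\<lambda>(t, x, \<omega>). X t x \<omega>) \<in> borel_measurable (field_measure s T K M)"
    and t: "t \<in> {s..T}" and U: "U \<subseteq> K"
  shows "\<omega> \<in> space M \<Longrightarrow> (\<lambda>x. X t x \<omega>) \<in> borel_measurable (lebesgue_on U)"
    "(\<lambda>(x, \<omega>). X t x \<omega>) \<in> borel_measurable (restrict_space lborel U \<Otimes>\<^sub>M M)"
proof -
  let ?K = "restrict_space lborel K"
  have t': "(\<lambda>_. t) \<in> measurable N (restrict_space lborel {s..T})" for N :: "'c measure"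
    using t by (intro measurable_const) (simp add: space_restrict_space)
  have 1: "(\<lambda>x. x) \<in> measurable (lebesgue_on U) ?K"
    using U by (intro measurable_restrict_space2 measurable_restrict_space1 measurable_completion) (auto simp: space_restrict_space)
  have 2: "(\<lambda>x. x) \<in> measurable (restrict_space lborel U) ?K"
    using U by (intro measurable_restrict_space2 measurable_restrict_space1) (auto simp: space_restrict_space)
  show "(\<lambda>x. X t x \<omega>) \<in> borel_measurable (lebesgue_on U)" if "\<omega> \<in> space M"
  proof -
    have "(\<lambda>x. (t, x, \<omega>)) \<in> measurable (lebesgue_on U) (field_measure s T K M)"
      unfolding field_measure_def by (intro measurable_Pair t' 1 measurable_const that)
    from measurable_compose[OF this X] show ?thesis by simp
  qed
  have "(\<lambda>z. (t, fst z, snd z)) \<in> measurable (restrict_space lborel U \<Otimes>\<^sub>M M) (field_measure s T K M)"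
    unfolding field_measure_def
    by (intro measurable_Pair t' measurable_compose[OF measurable_fst 2] measurable_snd)
  from measurable_compose[OF this X]
  show "(\<lambda>(x, \<omega>). X t x \<omega>) \<in> borel_measurable (restrict_space lborel U \<Otimes>\<^sub>M M)" by (simp add: split_beta')
qed

lemma (in prob_space) AE_lebesgue_on_swap:
  fixes U :: "'b::euclidean_space set"
  assumes U: "U \<in> sets borel"
    and P: "Measurable.pred (restrict_space lborel U \<Otimes>\<^sub>M M) (\<lambda>(x, \<omega>). P x \<omega>)"
    and ae: "\<And>x. x \<in> U \<Longrightarrow> AE \<omega> in M. P x \<omega>"
  shows "AE \<omega> in M. AE x in lebesgue_on U. P x \<omega>"
proof -
  interpret R: sigma_finite_measure "restrict_space lborel U"
    using U by (intro sigma_finite_measure_restrict_space lborel.sigma_finite_measure_axioms) simp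
  interpret P: pair_sigma_finite "restrict_space lborel U" M by unfold_locales
  have "AE x in restrict_space lborel U. AE \<omega> in M. P x \<omega>"
    using ae by (rule AE_I2) (simp add: space_restrict_space)
  then have "AE \<omega> in M. AE x in restrict_space lborel U. P x \<omega>"
    using P.AE_commute[of P] P by (simp add: pred_def split_beta')
  then show ?thesis by (simp add: AE_lebesgue_on_iff[OF U])
qed

section \<open>Identification of the limits\<close>

theorem theorem2p10:
  fixes M :: "'w measure"
    and B :: "real \<Rightarrow> 'w \<Rightarrow> real ^ 'd"
    and H T s C l :: real
    and bn :: "nat \<Rightarrow> real \<Rightarrow> real ^ 'd \<Rightarrow> real ^ 'd"
    and b :: "real \<Rightarrow> real ^ 'd \<Rightarrow> real ^ 'd"
    and a :: "real ^ 'd" and K :: "(real ^ 'd) set"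
    and Xn :: "nat \<Rightarrow> real \<Rightarrow> real ^ 'd \<Rightarrow> 'w \<Rightarrow> real ^ 'd"
    and X Y Z :: "real \<Rightarrow> real ^ 'd \<Rightarrow> 'w \<Rightarrow> real ^ 'd"
    and Y' Z' :: "real \<Rightarrow> real ^ 'd \<Rightarrow> 'w \<Rightarrow> real ^ 'd ^ 'd"
    and r :: "nat \<Rightarrow> nat"
  assumes "T > 0" and "0 < H" and "H < 1 / (2 * (real CARD('d) + 3))"
    and fbm: "fractional_brownian_motion M H T B"
    and bn_smooth: "\<And>n. C_infinity_c_strip T (bn n)"
    and bn_conv: "AE p in lborel. fst p \<in> {0..T} \<longrightarrow>
                    (\<lambda>n. bn n (fst p) (snd p)) \<longlonglongrightarrow> b (fst p) (snd p)"
    and bn_L1: "(SUP n. L1_infinity_norm T (bn n)) < \<top>"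
    and bn_bound: "\<And>n. AE p in lborel. fst p \<in> {0..T} \<longrightarrow> norm (bn n (fst p) (snd p)) \<le> C"
    and s: "0 \<le> s" "s < T"
    and K: "l > 0" "K = cbox a (\<chi> i. a $ i + l)"
    and Xn: "\<And>n x. unique_strong_solution M T B (bn n) s x (\<lambda>t. Xn n t x)"
    and Xn_flow: "\<And>n. AE \<omega> in M. \<forall>t\<in>{s..T}. \<forall>x. (\<lambda>y. Xn n t y \<omega>) differentiable (at x)"
    and X: "\<And>x. unique_strong_solution M T B b s x (\<lambda>t. X t x)"
    and X_measurable: "(\<lambda>(t, x, \<omega>). X t x \<omega>) \<in> borel_measurable (field_measure s T K M)"
    and r: "strict_mono r"
    and Y: "converges_in_C_L2 M ({s..T} \<times> K)
              (\<lambda>k (t, x). Xn (r k) t x) (\<lambda>(t, x). Y t x)"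
    and Y': "converges_in_C_L2 M ({s..T} \<times> K)
              (\<lambda>k (t, x) \<omega>. jacobian (\<lambda>y. Xn (r k) t y \<omega>) (at x)) (\<lambda>(t, x). Y' t x)"
    and Z: "continuous_version M ({s..T} \<times> K) (\<lambda>(t, x). Y t x) (\<lambda>(t, x). Z t x)"
    and Z': "continuous_version M ({s..T} \<times> K) (\<lambda>(t, x). Y' t x) (\<lambda>(t, x). Z' t x)"
  shows "(AE (t, x, \<omega>) in field_measure s T K M. Z t x \<omega> = X t x \<omega>) \<and>
         (\<forall>U. open U \<and> bounded U \<and> U \<subseteq> K \<longrightarrow>
            (\<exists>DX. sobolev_derivative_field M s T U X DX) \<and>
            (\<forall>DX. sobolev_derivative_field M s T U X DX \<longrightarrow>
               (AE (t, x, \<omega>) in field_measure s T U M. Z' t x \<omega> = DX t x \<omega>)))"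
proof -
  have "1 / (2 * (real CARD('d) + 3)) \<le> 1 / 2" by (intro divide_left_mono) auto
  then have H2: "H \<le> 1 / 2" using assms(3) by linarith
  interpret prob_space M using fbm by (simp add: fractional_brownian_motion_def)
  interpret fbm_driver M H T B using fbm assms(2) H2 by unfold_locales
  define c where "c = (\<chi> i. a $ i + l)"
  have Kc: "K = cbox a c" by (simp add: K(2) c_def)
  have aK: "a \<in> K" using K(1) by (simp add: K(2) mem_box_cart)
  have S: "{s..T} \<times> K = cbox (s, a) (T, c)" by (simp add: cbox_Pair_eq Kc)
  have ne: "cbox (s, a) (T, c) \<noteq> {}" using S s(2) aK by auto
  have Kb: "K \<in> sets borel" by (simp add: Kc)
  \<comment> \<open>\<open>Zt\<close> and \<open>Z't\<close> agree almost surely with \<open>Z\<close> and \<open>Z'\<close>, but are jointly measurable and continuous for every outcome and on the whole space.\<close>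
  obtain Zt where Zt: "\<And>w. continuous_on UNIV (\<lambda>p. Zt p w)" "(\<lambda>(p, w). Zt p w) \<in> borel_measurable (borel \<Otimes>\<^sub>M M)"
    "\<And>p. Zt p \<in> borel_measurable M" "AE w in M. \<forall>p\<in>{s..T} \<times> K. Zt p w = (\<lambda>(t, x). Z t x) p w"
  proof (rule continuous_modification_cbox[OF ne, of "\<lambda>(t, x). Z t x" M])
    show "\<And>p. p \<in> cbox (s, a) (T, c) \<Longrightarrow> (\<lambda>(t, x). Z t x) p \<in> borel_measurable M"
      using Z unfolding S continuous_version_def by blast
    show "AE w in M. continuous_on (cbox (s, a) (T, c)) (\<lambda>p. (\<lambda>(t, x). Z t x) p w)"
      using Z unfolding S continuous_version_def by blast
  qed (rule that; simp add: S)
  obtain Z't where Z't: "\<And>w. continuous_on UNIV (\<lambda>p. Z't p w)" "(\<lambda>(p, w). Z't p w) \<in> borel_measurable (borel \<Otimes>\<^sub>M M)"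
    "\<And>p. Z't p \<in> borel_measurable M" "AE w in M. \<forall>p\<in>{s..T} \<times> K. Z't p w = (\<lambda>(t, x). Z' t x) p w"
  proof (rule continuous_modification_cbox[OF ne, of "\<lambda>(t, x). Z' t x" M])
    show "\<And>p. p \<in> cbox (s, a) (T, c) \<Longrightarrow> (\<lambda>(t, x). Z' t x) p \<in> borel_measurable M"
      using Z' unfolding S continuous_version_def by blast
    show "AE w in M. continuous_on (cbox (s, a) (T, c)) (\<lambda>p. (\<lambda>(t, x). Z' t x) p w)"
      using Z' unfolding S continuous_version_def by blast
  qed (rule that; simp add: S)
  note V = version_of_L2_limit[OF Y Z Zt(4,3)]
  note V' = version_of_L2_limit[OF Y' Z' Z't(4,3)]

  have "\<forall>n. \<exists>g. C_infinity_c g \<and> (\<forall>t\<in>{0..T}. \<forall>x. bn n t x = g (t, x))"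
    using bn_smooth by (simp add: C_infinity_c_strip_def)
  then obtain g where g: "\<And>n. C_infinity_c (g n)" "\<And>n t x. t \<in> {0..T} \<Longrightarrow> bn n t x = g n (t, x)" by metis
  have gc: "continuous_on UNIV (g n)" for n
  proof -
    have "C_order 0 (g n)" using g(1)[of n] unfolding C_infinity_c_def by blast
    then show ?thesis by simp
  qed
  have gC: "norm (g n (u, y)) \<le> C" if "u \<in> {0..T}" for n u y
  proof (rule norm_le_on_strip[OF assms(1) gc _ that])
    show "AE p in lborel. fst p \<in> {0..T} \<longrightarrow> norm (g n p) \<le> C"
      using bn_bound[of n]
    proof eventually_elim
      case (elim p)
      then show ?case using g(2)[of "fst p" n "snd p"] by simp
    qed
  qed
  have gconv: "AE p in lborel. fst p \<in> {0..T} \<longrightarrow> (\<lambda>k. g (r k) p) \<longlonglongrightarrow> b (fst p) (snd p)"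
    using bn_conv
  proof eventually_elim
    case (elim p)
    show ?case
    proof
      assume p: "fst p \<in> {0..T}"
      have "(\<lambda>k. bn (r k) (fst p) (snd p)) \<longlonglongrightarrow> b (fst p) (snd p)"
        using LIMSEQ_subseq_LIMSEQ[OF elim[rule_format, OF p] r] by (simp add: comp_def)
      then show "(\<lambda>k. g (r k) p) \<longlonglongrightarrow> b (fst p) (snd p)" using g(2)[OF p, of _ "snd p"] by simp
    qed
  qed
  have Xs: "strong_solution M T B (\<lambda>u y. g n (u, y)) s x (\<lambda>t. Xn n t x)" for n x
    by (rule strong_solution_cong[where b="bn n"])
       (use Xn[of n x] s g(2) in \<open>auto simp: unique_strong_solution_def\<close>)
  have XnM: "Xn n t x \<in> borel_measurable M" if "t \<in> {s..T}" for n t x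
  proof -
    have "Xn n t x \<in> borel_measurable (augmented_filtration M B t)"
      using Xs[of n x] that by (simp add: strong_solution_def)
    then show ?thesis using that s by (intro measurable_from_subalg[OF subalgebra_augmented_filtration]) auto
  qed

  \<comment> \<open>At each point of \<open>K\<close> the limit is another solution of the limiting equation, hence equal to \<open>X\<close>.\<close>
  have sol: "strong_solution M T B b s x (\<lambda>t. Zt (t, x))" if x: "x \<in> K" for x
  proof (rule limit_solves_sde[OF s assms(3), where g="\<lambda>k. g (r k)" and C=C and X="\<lambda>k t. Xn (r k) t x"])
    show "AE \<omega> in M. continuous_on {s..T} (\<lambda>t. Zt (t, x) \<omega>)"
      by (intro AE_I2 continuous_on_compose2[OF Zt(1)] continuous_intros) auto
    fix t k assume t: "t \<in> {s..T}"
    have p: "(t, x) \<in> {s..T} \<times> K" using t x by simp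
    show "integrable M (Zt (t, x))" by (rule V(1)[OF p])
    show "integrable M (\<lambda>\<omega>. Xn (r k) t x \<omega> - Zt (t, x) \<omega>)" using V(2)[OF p, of k] by simp
    show "(\<lambda>k. \<integral>\<omega>. norm (Xn (r k) t x \<omega> - Zt (t, x) \<omega>) \<partial>M) \<longlonglongrightarrow> 0" using V(3)[OF p] by simp
  qed (use gc gC gconv Xs Zt(3) in auto)
  have ZX: "AE \<omega> in M. \<forall>t\<in>{s..T}. Zt (t, x) \<omega> = X t x \<omega>" if x: "x \<in> K" for x
    using X[of x] sol[OF x] unfolding unique_strong_solution_def by blast
  have ZX': "AE \<omega> in M. Zt (t, x) \<omega> = X t x \<omega>" if "t \<in> {s..T}" "x \<in> K" for t x
    using ZX[OF that(2)] by eventually_elim (use that in blast)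

  have first: "AE (t, x, \<omega>) in field_measure s T K M. Z t x \<omega> = X t x \<omega>"
  proof -
    have "AE (t, x, \<omega>) in field_measure s T K M. Zt (t, x) \<omega> = X t x \<omega>"
    proof (rule AE_field_measureI[OF prob_space_axioms Kb])
      show "Measurable.pred (field_measure s T K M) (\<lambda>(t, x, \<omega>). Zt (t, x) \<omega> = X t x \<omega>)"
        using pred_eq_borel[OF field_measure_measurableI[OF Zt(2)] X_measurable] by (simp add: split_beta')
      show "(AE x in restrict_space lborel K. AE \<omega> in M. Zt (t, x) \<omega> = X t x \<omega>) \<or>
        (AE \<omega> in M. AE x in restrict_space lborel K. Zt (t, x) \<omega> = X t x \<omega>)" if "t \<in> {s..T}" for t
        using ZX'[OF that] by (intro disjI1, rule AE_I2) (simp add: space_restrict_space)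
    qed
    then show ?thesis using AE_field_measure_path[OF prob_space_axioms Kb Zt(4)]
      by eventually_elim auto
  qed

  have second: "(\<exists>DX. sobolev_derivative_field M s T U X DX) \<and>
      (\<forall>DX. sobolev_derivative_field M s T U X DX \<longrightarrow> (AE (t, x, \<omega>) in field_measure s T U M. Z' t x \<omega> = DX t x \<omega>))"
    if U: "open U" "bounded U" "U \<subseteq> K" for U
  proof -
    have Ub: "U \<in> sets borel" using U(1) by simp
    obtain k0 \<epsilon> where \<epsilon>: "\<epsilon> \<longlonglongrightarrow> 0" "\<And>k p. p \<in> {s..T} \<times> K \<Longrightarrow>
        (\<integral>\<omega>. norm ((\<lambda>(t, x) \<omega>. jacobian (\<lambda>y. Xn (r (k + k0)) t y \<omega>) (at x)) p \<omega> - Z't p \<omega>) \<partial>M) \<le> \<epsilon> k"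
      using V'(4) by blast
    have W: "AE \<omega> in M. W12_with_derivative U (\<lambda>x. X t x \<omega>) (\<lambda>x. Z't (t, x) \<omega>)" if t: "t \<in> {s..T}" for t
    proof -
      have lines: "AE \<omega> in M. \<forall>x\<in>K. \<forall>y\<in>K. Zt (t, y) \<omega> - Zt (t, x) \<omega> = integral {0..1} (\<lambda>\<rho>. Z't (t, x + \<rho> *\<^sub>R (y - x)) \<omega> *v (y - x))"
      proof (rule limit_line_integral_all[where F="\<lambda>k y. Xn (r (k + k0)) t y" and \<epsilon>=\<epsilon>])
        show "convex K" by (simp add: Kc)
        show "AE \<omega> in M. \<forall>y. (\<lambda>y. Xn (r (k + k0)) t y \<omega>) differentiable (at y)" for k
          using Xn_flow[of "r (k + k0)"] by eventually_elim (use t in blast)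
        show "(\<lambda>(y, \<omega>). Z't (t, y) \<omega>) \<in> borel_measurable (borel \<Otimes>\<^sub>M M)"
        proof -
          have "(\<lambda>z :: (real ^ 'd) \<times> 'w. ((t, fst z), snd z)) \<in> measurable (borel \<Otimes>\<^sub>M M) (borel \<Otimes>\<^sub>M M)"
            by (intro measurable_Pair borel_measurable_Pair borel_measurable_const measurable_fst measurable_snd)
          from measurable_compose[OF this Z't(2)] show ?thesis by (simp add: split_beta')
        qed
        show "continuous_on UNIV (\<lambda>y. Zt (t, y) \<omega>)" "continuous_on UNIV (\<lambda>y. Z't (t, y) \<omega>)" for \<omega>
          by (auto intro!: continuous_on_compose2[OF Zt(1)] continuous_on_compose2[OF Z't(1)] continuous_intros)
        fix y k assume "y \<in> K"
        then have p: "(t, y) \<in> {s..T} \<times> K" using t by simp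
        show "integrable M (\<lambda>\<omega>. Xn (r (k + k0)) t y \<omega> - Zt (t, y) \<omega>)" using V(2)[OF p, of "k + k0"] by simp
        show "integrable M (\<lambda>\<omega>. jacobian (\<lambda>y. Xn (r (k + k0)) t y \<omega>) (at y) - Z't (t, y) \<omega>)"
          using V'(2)[OF p, of "k + k0"] by simp
        show "(\<lambda>k. \<integral>\<omega>. norm (Xn (r (k + k0)) t y \<omega> - Zt (t, y) \<omega>) \<partial>M) \<longlonglongrightarrow> 0"
          using LIMSEQ_ignore_initial_segment[OF V(3)[OF p], of k0] by simp
        show "(\<integral>\<omega>. norm (jacobian (\<lambda>y. Xn (r (k + k0)) t y \<omega>) (at y) - Z't (t, y) \<omega>) \<partial>M) \<le> \<epsilon> k"
          using \<epsilon>(2)[OF p, of k] by simp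
      qed (use XnM[OF t] Zt(3) \<epsilon>(1) in auto)
      \<comment> \<open>The equality at each \<open>x\<close> is turned into an equality of functions of \<open>x\<close> for almost every outcome; the Sobolev derivative only sees \<open>X t\<close> up to null sets.\<close>
      have XZ: "AE \<omega> in M. AE x in lebesgue_on U. X t x \<omega> = Zt (t, x) \<omega>"
      proof (rule AE_lebesgue_on_swap[OF Ub])
        show "Measurable.pred (restrict_space lborel U \<Otimes>\<^sub>M M) (\<lambda>(x, \<omega>). X t x \<omega> = Zt (t, x) \<omega>)"
          using pred_eq_borel[OF field_section_measurable(2)[OF X_measurable t U(3)]
            field_section_measurable(2)[OF field_measure_measurableI[OF Zt(2), of s T U] t order_refl]] by (simp add: split_beta')
        show "AE \<omega> in M. X t x \<omega> = Zt (t, x) \<omega>" if "x \<in> U" for x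
        proof -
          have "x \<in> K" using that U(3) by blast
          from ZX'[OF t this] show ?thesis by eventually_elim simp
        qed
      qed
      show ?thesis
        using lines XZ AE_space
      proof eventually_elim
        case (elim \<omega>)
        show ?case
        proof (rule W12_with_derivativeI[OF U(1,2), where g="\<lambda>x. Zt (t, x) \<omega>"])
          show "(\<lambda>x. X t x \<omega>) \<in> borel_measurable (lebesgue_on U)"
            by (rule field_section_measurable(1)[OF X_measurable t U(3) elim(3)])
          show "continuous_on UNIV (\<lambda>y. Zt (t, y) \<omega>)" by (auto intro!: continuous_on_compose2[OF Zt(1)] continuous_intros)
          show c': "continuous_on UNIV (\<lambda>y. Z't (t, y) \<omega>)" by (auto intro!: continuous_on_compose2[OF Z't(1)] continuous_intros)
          show "((\<lambda>r. Zt (t, x + r *\<^sub>R axis j 1) \<omega> $ i) has_real_derivative Z't (t, x) \<omega> $ i $ j) (at 0)" if "x \<in> U" for x i j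
            by (rule line_integral_component_derivative[OF U(1,3) c' elim(1) that])
        qed (rule elim(2))
      qed
    qed
    have "sobolev_derivative_field M s T U X (\<lambda>t x \<omega>. Z't (t, x) \<omega>)"
      using field_measure_measurableI[OF Z't(2)] W by (simp add: sobolev_derivative_field_def)
    moreover have "AE (t, x, \<omega>) in field_measure s T U M. Z' t x \<omega> = DX t x \<omega>"
      if DX: "sobolev_derivative_field M s T U X DX" for DX
    proof -
      have DXm: "(\<lambda>(t, x, \<omega>). DX t x \<omega>) \<in> borel_measurable (field_measure s T U M)"
        and DXw: "\<And>t. t \<in> {s..T} \<Longrightarrow> AE \<omega> in M. W12_with_derivative U (\<lambda>x. X t x \<omega>) (\<lambda>x. DX t x \<omega>)"
        using DX by (auto simp: sobolev_derivative_field_def)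
      have "AE (t, x, \<omega>) in field_measure s T U M. Z't (t, x) \<omega> = DX t x \<omega>"
      proof (rule AE_field_measureI[OF prob_space_axioms Ub])
        show "Measurable.pred (field_measure s T U M) (\<lambda>(t, x, \<omega>). Z't (t, x) \<omega> = DX t x \<omega>)"
          using pred_eq_borel[OF field_measure_measurableI[OF Z't(2)] DXm] by (simp add: split_beta')
        fix t assume t: "t \<in> {s..T}"
        have "AE \<omega> in M. AE x in restrict_space lborel U. Z't (t, x) \<omega> = DX t x \<omega>"
          using W[OF t] DXw[OF t]
        proof eventually_elim
          case (elim \<omega>)
          show ?case using W12_with_derivative_unique[OF U(1,2) elim] by (simp add: AE_lebesgue_on_iff[OF Ub])
        qed
        then show "(AE x in restrict_space lborel U. AE \<omega> in M. Z't (t, x) \<omega> = DX t x \<omega>) \<or>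
          (AE \<omega> in M. AE x in restrict_space lborel U. Z't (t, x) \<omega> = DX t x \<omega>)" ..
      qed
      then show ?thesis using AE_field_measure_path[OF prob_space_axioms Ub Z't(4)]
        by eventually_elim (use U(3) in auto)
    qed
    ultimately show ?thesis by blast
  qed
  show ?thesis using first second by blast
qed

end
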